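(* Let $l\ge 1$, let $T$ be a perfect matching of $\{1,\dots,2l\}$ each of whose edges joins an element of $\{1,\dots,l\}$ to an element of $\{l+1,\dots,2l\}$, and let $T_0$ be a non-crossing perfect matching of $\{1,\dots,2l\}$. Then the coefficient of $P_{T_0}$ in the decomposition of $P_T$ as a linear combination of the polynomials $P_{T'}$, $T'$ ranging over non-crossing perfect matchings of $\{1,\dots,2l\}$, is equal to the coefficient of the basis element $t_{u(T_0)}$ in $\theta(\omega(T))\in \mathit{TL}_l(-2)$.
   Context: For a perfect matching $T$ of $\{1,\dots,2l\}$ (a two-row rectangular Tableau), $P_T=\prod (x_a-x_b)$, the product being over all edges $\{a<b\}$ of $T$. A perfect matching is non-crossing if it has no two edges $\{a_1<a_2\}$, $\{b_1<b_2\}$ with $a_1<b_1<a_2<b_2$. The polynomials $P_{T'}$ for non-crossing perfect matchings $T'$ form a basis of the span of all the $P_T$. The Temperley-Lieb algebra $\mathit{TL}_l(-2)$ is the $\mathbb{C}$-algebra generated by $t_1,\dots,t_{l-1}$ with relations $t_i^2=-2t_i$, $t_it_jt_i=t_i$ if $|i-j|=1$, $t_it_j=t_jt_i$ if $|i-j|\ge2$. It has a basis $\{t_w\}$ indexed by 321-avoiding permutations $w\in S_l$, where $t_w=t_{i_1}\cdots t_{i_k}$ for a reduced decomposition $w=s_{i_1}\cdots s_{i_k}$. The map $\theta:\mathbb{C}[S_l]\to \mathit{TL}_l(-2)$ is the algebra homomorphism with $\theta(s_i)=t_i+1$. Diagram conventions: fold the line so that $1,\dots,l$ become the left points numbered $1,\dots,l$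 from top to bottom, and $l+1,\dots,2l$ become the right points, with the point $2l+1-j$ being the right point at height $j$. A matching $T$ between $\{1,\dots,l\}$ and $\{l+1,\dots,2l\}$ is then the wiring diagram of a permutation $\omega(T)\in S_l$, namely the one such that $T$ joins the left point $\omega(T)(j)$ to the right point at height $j$ (the point $2l+1-j$) for every $j$. Here the wiring diagram of $s_{i_1}\cdots s_{i_k}$ is the left-to-right concatenation of the diagrams of $s_{i_1},\dots,s_{i_k}$. Elements $t_w$ are likewise represented by Kauffman diagrams: $t_i$ is the diagram joining left points $i,i+1$ to each other, right points at heights $i,i+1$ to each other, and every other left point $j$ to the right point at height $j$; products are left-to-right concatenations, each closed loop being replaced by the factor $-2$. For a non-crossing matching $T_0$, $u(T_0)$ denotes the unique 321-avoiding permutation in $S_l$ such that the Kauffman diagram of $t_{u(T_0)}$ is $T_0$. *)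

theory Defs
  imports
    Complex_Main
    "HOL-Library.Poly_Mapping"
    "HOL-Library.Disjoint_Sets"
    "HOL-Algebra.QuotRing"
    "HOL-Algebra.Sym_Groups"
begin

section \<open>Perfect matchings and their polynomials\<close>

definition perfect_matching :: "nat set \<Rightarrow> nat set set \<Rightarrow> bool" where
  "perfect_matching A T \<longleftrightarrow> partition_on A T \<and> (\<forall>e\<in>T. card e = 2)"

definition noncrossing :: "nat set set \<Rightarrow> bool" where
  "noncrossing T \<longleftrightarrow>
     \<not> (\<exists>a1 a2 b1 b2. {a1, a2} \<in> T \<and> {b1, b2} \<in> T \<and> a1 < b1 \<and> b1 < a2 \<and> a2 < b2)"

definition nc_matchings :: "nat \<Rightarrow> nat set set set" where
  "nc_matchings l = {T. perfect_matching {1..2 * l} T \<and> noncrossing T}"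

text \<open>Polynomials over the complex numbers in variables indexed by natural numbers: finitely
  supported maps from monomials (exponent vectors) to coefficients, with the convolution product.\<close>

type_synonym mpoly = "(nat \<Rightarrow>\<^sub>0 nat) \<Rightarrow>\<^sub>0 complex"

definition mvar :: "nat \<Rightarrow> mpoly" where
  "mvar i = Poly_Mapping.single (Poly_Mapping.single i 1) 1"

definition mpoly_scale :: "complex \<Rightarrow> mpoly \<Rightarrow> mpoly" where
  "mpoly_scale c p = Poly_Mapping.single 0 c * p"

global_interpretation mpoly: vector_space mpoly_scale
  by standard
    (simp_all add: mpoly_scale_def algebra_simps single_add mult_single flip: mult.assoc)

definition matching_poly :: "nat set set \<Rightarrow> mpoly" where
  "matching_poly T = (\<Prod>e\<in>T. mvar (Min e) - mvar (Max e))"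

text \<open>The coefficient of \<open>matching_poly T0\<close> when \<open>matching_poly T\<close> is expanded in the basis
  formed by the polynomials of the non-crossing perfect matchings.\<close>

definition nc_coeff :: "nat \<Rightarrow> nat set set \<Rightarrow> nat set set \<Rightarrow> complex" where
  "nc_coeff l T T0 =
     mpoly.representation (matching_poly ` nc_matchings l) (matching_poly T) (matching_poly T0)"


section \<open>Monoid algebras\<close>

definition delta :: "'a \<Rightarrow> 'a \<Rightarrow> complex" where
  "delta x = (\<lambda>y. if y = x then 1 else 0)"

definition monoid_algebra :: "('a, 'b) monoid_scheme \<Rightarrow> ('a \<Rightarrow> complex) ring" where
  "monoid_algebra G =
     \<lparr>carrier = {f. finite {x. f x \<noteq> 0} \<and> {x. f x \<noteq> 0} \<subseteq> carrier G},
      monoid.mult = (\<lambda>f g x. \<Sum>(y, z) \<in> {(y, z). f y \<noteq> 0 \<and> g z \<noteq> 0 \<and> y \<otimes>\<^bsub>G\<^esub> z = x}. f y * g z),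
      one = delta \<one>\<^bsub>G\<^esub>,
      zero = (\<lambda>_. 0),
      add = (\<lambda>f g x. f x + g x)\<rparr>"

lemma monoid_algebra_mult:
  assumes "finite A" "finite B" "{x. f x \<noteq> 0} \<subseteq> A" "{x. g x \<noteq> 0} \<subseteq> B"
  shows "(f \<otimes>\<^bsub>monoid_algebra G\<^esub> g) x =
    (\<Sum>y\<in>A. \<Sum>z\<in>B. if y \<otimes>\<^bsub>G\<^esub> z = x then f y * g z else 0)"
proof -
  have "(f \<otimes>\<^bsub>monoid_algebra G\<^esub> g) x =
      (\<Sum>(y, z) \<in> {(y, z). f y \<noteq> 0 \<and> g z \<noteq> 0 \<and> y \<otimes>\<^bsub>G\<^esub> z = x}. f y * g z)"
    by (simp add: monoid_algebra_def)
  also have "\<dots> = (\<Sum>(y, z) \<in> A \<times> B. if y \<otimes>\<^bsub>G\<^esub> z = x then f y * g z else 0)"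
    using assms by (intro sum.mono_neutral_cong_left) (auto split: if_splits)
  finally show ?thesis
    by (simp add: sum.cartesian_product)
qed

lemma sum_rotate3:
  "(\<Sum>b\<in>B. \<Sum>c\<in>C. \<Sum>u\<in>U. k b c u) = (\<Sum>u\<in>U. \<Sum>b\<in>B. \<Sum>c\<in>C. k b c u)"
proof -
  have "(\<Sum>b\<in>B. \<Sum>c\<in>C. \<Sum>u\<in>U. k b c u) = (\<Sum>b\<in>B. \<Sum>u\<in>U. \<Sum>c\<in>C. k b c u)"
    by (rule sum.cong[OF refl], rule sum.swap)
  also have "\<dots> = (\<Sum>u\<in>U. \<Sum>b\<in>B. \<Sum>c\<in>C. k b c u)"
    by (rule sum.swap)
  finally show ?thesis .
qed

lemma sum_rotate4:
  "(\<Sum>u\<in>U. \<Sum>c\<in>C. \<Sum>a\<in>A. \<Sum>b\<in>B. k u c a b) = (\<Sum>a\<in>A. \<Sum>b\<in>B. \<Sum>c\<in>C. \<Sum>u\<in>U. k u c a b)"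
proof -
  have "(\<Sum>u\<in>U. \<Sum>c\<in>C. \<Sum>a\<in>A. \<Sum>b\<in>B. k u c a b) = (\<Sum>a\<in>A. \<Sum>u\<in>U. \<Sum>c\<in>C. \<Sum>b\<in>B. k u c a b)"
    by (rule sum_rotate3)
  also have "\<dots> = (\<Sum>a\<in>A. \<Sum>b\<in>B. \<Sum>u\<in>U. \<Sum>c\<in>C. k u c a b)"
    by (rule sum.cong[OF refl], rule sum_rotate3)
  also have "\<dots> = (\<Sum>a\<in>A. \<Sum>b\<in>B. \<Sum>c\<in>C. \<Sum>u\<in>U. k u c a b)"
    by (rule sum.cong[OF refl], rule sum.cong[OF refl], rule sum.swap)
  finally show ?thesis .
qed

lemma ring_monoid_algebra:
  assumes "monoid G"
  shows "ring (monoid_algebra G)"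
proof -
  interpret monoid G by fact
  let ?R = "monoid_algebra G"
  let ?S = "\<lambda>f :: 'a \<Rightarrow> complex. {x. f x \<noteq> 0}"
  have carrier: "f \<in> carrier ?R \<longleftrightarrow> finite (?S f) \<and> ?S f \<subseteq> carrier G" for f
    by (simp add: monoid_algebra_def)
  have add: "f \<oplus>\<^bsub>?R\<^esub> g = (\<lambda>x. f x + g x)" for f g
    by (simp add: monoid_algebra_def)
  have zero: "\<zero>\<^bsub>?R\<^esub> = (\<lambda>_. 0)" and one: "\<one>\<^bsub>?R\<^esub> = delta \<one>\<^bsub>G\<^esub>"
    by (simp_all add: monoid_algebra_def)
  have S_one: "?S (delta \<one>\<^bsub>G\<^esub>) = {\<one>\<^bsub>G\<^esub>}"
    by (auto simp: delta_def)
  have add_closed: "f \<oplus>\<^bsub>?R\<^esub> g \<in> carrier ?R" if "f \<in> carrier ?R" "g \<in> carrier ?R" for f g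
  proof -
    have "?S (\<lambda>x. f x + g x) \<subseteq> ?S f \<union> ?S g" by auto
    with that show ?thesis
      unfolding carrier add by (meson Un_least finite_UnI finite_subset subset_trans)
  qed
  have S_mult: "?S (f \<otimes>\<^bsub>?R\<^esub> g) \<subseteq> (\<lambda>(y, z). y \<otimes>\<^bsub>G\<^esub> z) ` (?S f \<times> ?S g)"
    if "f \<in> carrier ?R" "g \<in> carrier ?R" for f g
  proof (rule subsetI, rule ccontr)
    fix x assume x: "x \<in> ?S (f \<otimes>\<^bsub>?R\<^esub> g)"
      and n: "x \<notin> (\<lambda>(y, z). y \<otimes>\<^bsub>G\<^esub> z) ` (?S f \<times> ?S g)"
    have "(f \<otimes>\<^bsub>?R\<^esub> g) x =
        (\<Sum>y\<in>?S f. \<Sum>z\<in>?S g. if y \<otimes>\<^bsub>G\<^esub> z = x then f y * g z else 0)"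
      using that by (intro monoid_algebra_mult) (auto simp: carrier)
    also have "\<dots> = 0"
      using n by (intro sum.neutral ballI) auto
    finally show False using x by simp
  qed
  have mult_closed: "f \<otimes>\<^bsub>?R\<^esub> g \<in> carrier ?R" if "f \<in> carrier ?R" "g \<in> carrier ?R" for f g
  proof -
    have "finite ((\<lambda>(y, z). y \<otimes>\<^bsub>G\<^esub> z) ` (?S f \<times> ?S g))"
      using that by (auto simp: carrier)
    moreover have "(\<lambda>(y, z). y \<otimes>\<^bsub>G\<^esub> z) ` (?S f \<times> ?S g) \<subseteq> carrier G"
      using that by (auto simp: carrier)
    ultimately show ?thesis
      unfolding carrier using S_mult[OF that] by (meson finite_subset subset_trans)
  qed
  have neg_closed: "(\<lambda>x. - f x) \<in> carrier ?R" if "f \<in> carrier ?R" for f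
    using that by (simp add: carrier)
  have assoc: "(f \<otimes>\<^bsub>?R\<^esub> g) \<otimes>\<^bsub>?R\<^esub> h = f \<otimes>\<^bsub>?R\<^esub> (g \<otimes>\<^bsub>?R\<^esub> h)"
    if f: "f \<in> carrier ?R" and g: "g \<in> carrier ?R" and h: "h \<in> carrier ?R" for f g h
  proof
    fix x
    let ?F = "?S f" and ?G = "?S g" and ?H = "?S h"
    have fin: "finite ?F" "finite ?G" "finite ?H"
      using f g h by (auto simp: carrier)
    have mem: "y \<in> carrier G" if "y \<in> ?F \<union> ?G \<union> ?H" for y
      using that f g h by (auto simp: carrier)
    let ?FG = "(\<lambda>(y, z). y \<otimes>\<^bsub>G\<^esub> z) ` (?F \<times> ?G)" and ?GH = "(\<lambda>(y, z). y \<otimes>\<^bsub>G\<^esub> z) ` (?G \<times> ?H)"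
    have fin2: "finite ?FG" "finite ?GH"
      using fin by auto
    have "((f \<otimes>\<^bsub>?R\<^esub> g) \<otimes>\<^bsub>?R\<^esub> h) x =
        (\<Sum>u\<in>?FG. \<Sum>c\<in>?H. if u \<otimes>\<^bsub>G\<^esub> c = x then (f \<otimes>\<^bsub>?R\<^esub> g) u * h c else 0)"
      using S_mult[OF f g] by (intro monoid_algebra_mult fin fin2) auto
    also have "\<dots> = (\<Sum>u\<in>?FG. \<Sum>c\<in>?H. \<Sum>a\<in>?F. \<Sum>b\<in>?G.
        if u = a \<otimes>\<^bsub>G\<^esub> b then (if u \<otimes>\<^bsub>G\<^esub> c = x then f a * g b * h c else 0) else 0)"
      by (intro sum.cong refl)
        (auto simp: monoid_algebra_mult[OF fin(1,2) order_refl order_refl] sum_distrib_right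
          intro!: sum.cong sum.neutral)
    also have "\<dots> = (\<Sum>a\<in>?F. \<Sum>b\<in>?G. \<Sum>c\<in>?H. \<Sum>u\<in>?FG.
        if u = a \<otimes>\<^bsub>G\<^esub> b then (if u \<otimes>\<^bsub>G\<^esub> c = x then f a * g b * h c else 0) else 0)"
      by (rule sum_rotate4)
    also have "\<dots> = (\<Sum>a\<in>?F. \<Sum>b\<in>?G. \<Sum>c\<in>?H.
        if a \<otimes>\<^bsub>G\<^esub> b \<otimes>\<^bsub>G\<^esub> c = x then f a * g b * h c else 0)"
      using fin2 by (intro sum.cong refl) (subst sum.delta, auto)
    also have "\<dots> = (\<Sum>a\<in>?F. \<Sum>b\<in>?G. \<Sum>c\<in>?H.
        if a \<otimes>\<^bsub>G\<^esub> (b \<otimes>\<^bsub>G\<^esub> c) = x then f a * (g b * h c) else 0)"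
      by (intro sum.cong refl) (simp add: m_assoc mem mult.assoc)
    also have "\<dots> = (\<Sum>a\<in>?F. \<Sum>b\<in>?G. \<Sum>c\<in>?H. \<Sum>u\<in>?GH.
        if u = b \<otimes>\<^bsub>G\<^esub> c then (if a \<otimes>\<^bsub>G\<^esub> u = x then f a * (g b * h c) else 0) else 0)"
      using fin2 by (intro sum.cong refl) (subst sum.delta, auto)
    also have "\<dots> = (\<Sum>a\<in>?F. \<Sum>u\<in>?GH. \<Sum>b\<in>?G. \<Sum>c\<in>?H.
        if u = b \<otimes>\<^bsub>G\<^esub> c then (if a \<otimes>\<^bsub>G\<^esub> u = x then f a * (g b * h c) else 0) else 0)"
      by (rule sum.cong[OF refl], rule sum_rotate3)
    also have "\<dots> = (\<Sum>a\<in>?F. \<Sum>u\<in>?GH. if a \<otimes>\<^bsub>G\<^esub> u = x then f a * (g \<otimes>\<^bsub>?R\<^esub> h) u else 0)"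
      by (intro sum.cong refl)
        (auto simp: monoid_algebra_mult[OF fin(2,3) order_refl order_refl] sum_distrib_left
          intro!: sum.cong sum.neutral)
    also have "\<dots> = (f \<otimes>\<^bsub>?R\<^esub> (g \<otimes>\<^bsub>?R\<^esub> h)) x"
      using S_mult[OF g h] by (intro monoid_algebra_mult[symmetric] fin fin2) auto
    finally show "((f \<otimes>\<^bsub>?R\<^esub> g) \<otimes>\<^bsub>?R\<^esub> h) x = (f \<otimes>\<^bsub>?R\<^esub> (g \<otimes>\<^bsub>?R\<^esub> h)) x" .
  qed
  show ?thesis
  proof (rule ringI)
    show "abelian_group ?R"
    proof (rule abelian_groupI)
      fix f assume "f \<in> carrier ?R"
      then show "\<exists>g\<in>carrier ?R. g \<oplus>\<^bsub>?R\<^esub> f = \<zero>\<^bsub>?R\<^esub>"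
        by (intro bexI[OF _ neg_closed]) (auto simp: add zero)
    qed (use add_closed in \<open>auto simp: add zero carrier add_ac\<close>)
    show "Group.monoid ?R"
    proof (rule monoidI)
      show "\<one>\<^bsub>?R\<^esub> \<in> carrier ?R"
        using S_one by (simp add: carrier one)
      fix f assume f: "f \<in> carrier ?R"
      then have fin: "finite (?S f)" and mem: "\<And>y. f y \<noteq> 0 \<Longrightarrow> y \<in> carrier G"
        by (auto simp: carrier)
      show "\<one>\<^bsub>?R\<^esub> \<otimes>\<^bsub>?R\<^esub> f = f"
      proof
        fix x
        have "(\<one>\<^bsub>?R\<^esub> \<otimes>\<^bsub>?R\<^esub> f) x = (\<Sum>y\<in>{\<one>\<^bsub>G\<^esub>}. \<Sum>z\<in>?S f.
            if y \<otimes>\<^bsub>G\<^esub> z = x then delta \<one>\<^bsub>G\<^esub> y * f z else 0)"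
          unfolding one by (intro monoid_algebra_mult fin) (auto simp: S_one)
        also have "\<dots> = (\<Sum>z\<in>?S f. if z = x then f z else 0)"
          by (auto simp: delta_def mem intro!: sum.cong)
        also have "\<dots> = f x"
          using fin by simp
        finally show "(\<one>\<^bsub>?R\<^esub> \<otimes>\<^bsub>?R\<^esub> f) x = f x" .
      qed
      show "f \<otimes>\<^bsub>?R\<^esub> \<one>\<^bsub>?R\<^esub> = f"
      proof
        fix x
        have "(f \<otimes>\<^bsub>?R\<^esub> \<one>\<^bsub>?R\<^esub>) x = (\<Sum>y\<in>?S f. \<Sum>z\<in>{\<one>\<^bsub>G\<^esub>}.
            if y \<otimes>\<^bsub>G\<^esub> z = x then f y * delta \<one>\<^bsub>G\<^esub> z else 0)"
          unfolding one by (intro monoid_algebra_mult fin) (auto simp: S_one)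
        also have "\<dots> = (\<Sum>y\<in>?S f. if y = x then f y else 0)"
          by (auto simp: delta_def mem intro!: sum.cong)
        also have "\<dots> = f x"
          using fin by simp
        finally show "(f \<otimes>\<^bsub>?R\<^esub> \<one>\<^bsub>?R\<^esub>) x = f x" .
      qed
    qed (use mult_closed assoc in auto)
    fix f g h assume f: "f \<in> carrier ?R" and g: "g \<in> carrier ?R" and h: "h \<in> carrier ?R"
    let ?U = "?S f \<union> ?S g" and ?V = "?S h"
    have fin: "finite ?U" "finite ?V"
      using f g h by (auto simp: carrier)
    show "(f \<oplus>\<^bsub>?R\<^esub> g) \<otimes>\<^bsub>?R\<^esub> h = f \<otimes>\<^bsub>?R\<^esub> h \<oplus>\<^bsub>?R\<^esub> g \<otimes>\<^bsub>?R\<^esub> h"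
      using fin unfolding add
      by (intro ext, subst (1 2 3) monoid_algebra_mult[of ?U ?V])
        (auto simp: sum.distrib[symmetric] distrib_right intro!: sum.cong)
    show "h \<otimes>\<^bsub>?R\<^esub> (f \<oplus>\<^bsub>?R\<^esub> g) = h \<otimes>\<^bsub>?R\<^esub> f \<oplus>\<^bsub>?R\<^esub> h \<otimes>\<^bsub>?R\<^esub> g"
      using fin unfolding add
      by (intro ext, subst (1 2 3) monoid_algebra_mult[of ?V ?U])
        (auto simp: sum.distrib[symmetric] distrib_left intro!: sum.cong)
  qed
qed

text \<open>The structure map from the complex numbers to the monoid algebra.\<close>

definition scalar :: "('a, 'b) monoid_scheme \<Rightarrow> complex \<Rightarrow> ('a \<Rightarrow> complex)" where
  "scalar G c = (\<lambda>x. if x = \<one>\<^bsub>G\<^esub> then c else 0)"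


section \<open>The Temperley-Lieb algebra with loop value -2\<close>

definition word_monoid :: "nat \<Rightarrow> nat list monoid" where
  "word_monoid l = \<lparr>carrier = lists {1..<l}, monoid.mult = (@), one = []\<rparr>"

abbreviation free_algebra :: "nat \<Rightarrow> (nat list \<Rightarrow> complex) ring" where
  "free_algebra l \<equiv> monoid_algebra (word_monoid l)"

definition tl_relators :: "nat \<Rightarrow> (nat list \<Rightarrow> complex) set" where
  "tl_relators l =
     {delta [i, i] \<ominus>\<^bsub>free_algebra l\<^esub> scalar (word_monoid l) (-2) \<otimes>\<^bsub>free_algebra l\<^esub> delta [i] |
        i. i \<in> {1..<l}} \<union>
     {delta [i, j, i] \<ominus>\<^bsub>free_algebra l\<^esub> delta [i] |
        i j. i \<in> {1..<l} \<and> j \<in> {1..<l} \<and> \<bar>int i - int j\<bar> = 1} \<union>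
     {delta [i, j] \<ominus>\<^bsub>free_algebra l\<^esub> delta [j, i] |
        i j. i \<in> {1..<l} \<and> j \<in> {1..<l} \<and> \<bar>int i - int j\<bar> \<ge> 2}"

definition tl_ideal :: "nat \<Rightarrow> (nat list \<Rightarrow> complex) set" where
  "tl_ideal l = Idl\<^bsub>free_algebra l\<^esub> (tl_relators l)"

definition TL :: "nat \<Rightarrow> (nat list \<Rightarrow> complex) set ring" where
  "TL l = free_algebra l Quot tl_ideal l"

definition tl_gen :: "nat \<Rightarrow> nat \<Rightarrow> (nat list \<Rightarrow> complex) set" where
  "tl_gen l i = tl_ideal l +>\<^bsub>free_algebra l\<^esub> delta [i]"

definition tl_scalar :: "nat \<Rightarrow> complex \<Rightarrow> (nat list \<Rightarrow> complex) set" where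
  "tl_scalar l c = tl_ideal l +>\<^bsub>free_algebra l\<^esub> scalar (word_monoid l) c"

text \<open>The homomorphism \<open>\<theta>\<close> of complex algebras sending \<open>s\<^sub>i\<close> to \<open>t\<^sub>i + 1\<close>. A ring homomorphism is
  complex-linear iff it commutes with the structure maps; extensionality fixes the values outside
  the carrier.\<close>

definition tl_theta :: "nat \<Rightarrow> ((nat \<Rightarrow> nat) \<Rightarrow> complex) \<Rightarrow> (nat list \<Rightarrow> complex) set" where
  "tl_theta l = (THE h.
     h \<in> ring_hom (monoid_algebra (sym_group l)) (TL l) \<and>
     h \<in> extensional (carrier (monoid_algebra (sym_group l))) \<and>
     (\<forall>c. h (scalar (sym_group l) c) = tl_scalar l c) \<and>
     (\<forall>i\<in>{1..<l}. h (delta (transpose i (i + 1))) = tl_gen l i \<oplus>\<^bsub>TL l\<^esub> \<one>\<^bsub>TL l\<^esub>))"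


section \<open>The basis indexed by 321-avoiding permutations\<close>

definition avoiding321 :: "nat \<Rightarrow> (nat \<Rightarrow> nat) set" where
  "avoiding321 l = {w. w permutes {1..l} \<and>
     \<not> (\<exists>i j k. 1 \<le> i \<and> i < j \<and> j < k \<and> k \<le> l \<and> w i > w j \<and> w j > w k)}"

definition word_perm :: "nat list \<Rightarrow> nat \<Rightarrow> nat" where
  "word_perm is = foldr (\<lambda>i p. transpose i (i + 1) \<circ> p) is id"

definition reduced_word :: "nat \<Rightarrow> (nat \<Rightarrow> nat) \<Rightarrow> nat list \<Rightarrow> bool" where
  "reduced_word l w is \<longleftrightarrow>
     is \<in> lists {1..<l} \<and> word_perm is = w \<and>
     (\<forall>js \<in> lists {1..<l}. word_perm js = w \<longrightarrow> length is \<le> length js)"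

text \<open>A fixed choice of reduced decomposition; for 321-avoiding permutations neither \<open>tl_basis\<close>
  nor the diagram of the decomposition depends on it.\<close>

definition red_word :: "nat \<Rightarrow> (nat \<Rightarrow> nat) \<Rightarrow> nat list" where
  "red_word l w = (SOME is. reduced_word l w is)"

definition tl_basis :: "nat \<Rightarrow> (nat \<Rightarrow> nat) \<Rightarrow> (nat list \<Rightarrow> complex) set" where
  "tl_basis l w = foldr (\<lambda>i x. tl_gen l i \<otimes>\<^bsub>TL l\<^esub> x) (red_word l w) \<one>\<^bsub>TL l\<^esub>"

definition tl_coeff :: "nat \<Rightarrow> (nat list \<Rightarrow> complex) set \<Rightarrow> (nat \<Rightarrow> nat) \<Rightarrow> complex" where
  "tl_coeff l x = (THE c. c \<in> extensional (avoiding321 l) \<and>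
     x = (\<Oplus>\<^bsub>TL l\<^esub>w\<in>avoiding321 l. tl_scalar l (c w) \<otimes>\<^bsub>TL l\<^esub> tl_basis l w))"


section \<open>Diagrams\<close>

text \<open>The left point at height \<open>j\<close> is \<open>j\<close>, the right point at height \<open>j\<close> is \<open>2 * l + 1 - j\<close>.\<close>

definition matching_perm :: "nat \<Rightarrow> nat set set \<Rightarrow> nat \<Rightarrow> nat" where
  "matching_perm l T = (THE w. w permutes {1..l} \<and> (\<forall>j\<in>{1..l}. {w j, 2 * l + 1 - j} \<in> T))"

definition id_diagram :: "nat \<Rightarrow> nat set set" where
  "id_diagram l = {{j, 2 * l + 1 - j} | j. j \<in> {1..l}}"

definition gen_diagram :: "nat \<Rightarrow> nat \<Rightarrow> nat set set" where
  "gen_diagram l i =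
     {{i, i + 1}, {2 * l + 1 - i, 2 * l + 1 - (i + 1)}} \<union>
     {{j, 2 * l + 1 - j} | j. j \<in> {1..l} - {i, i + 1}}"

text \<open>In a concatenation \<open>D\<close>, \<open>E\<close> there are three columns of \<open>l\<close> points: \<open>D\<close> connects columns 0
  and 1, and \<open>E\<close> connects columns 1 and 2. A point is a pair (column, height).\<close>

definition column_point :: "nat \<Rightarrow> nat \<Rightarrow> nat \<Rightarrow> nat \<Rightarrow> nat \<times> nat" where
  "column_point l left right p = (if p \<le> l then (left, p) else (right, 2 * l + 1 - p))"

definition glued :: "nat \<Rightarrow> nat set set \<Rightarrow> nat set set \<Rightarrow> ((nat \<times> nat) \<times> (nat \<times> nat)) set" where
  "glued l D E =
     {(column_point l 0 1 a, column_point l 0 1 b) | a b. {a, b} \<in> D} \<union>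
     {(column_point l 1 2 a, column_point l 1 2 b) | a b. {a, b} \<in> E}"

definition diagram_comp :: "nat \<Rightarrow> nat set set \<Rightarrow> nat set set \<Rightarrow> nat set set" where
  "diagram_comp l D E =
     {{p, q} | p q. p \<in> {1..2 * l} \<and> q \<in> {1..2 * l} \<and> p \<noteq> q \<and>
        (column_point l 0 2 p, column_point l 0 2 q) \<in> (glued l D E)\<^sup>*}"

text \<open>Closed loops are the connected components contained in the middle column.\<close>

definition loops :: "nat \<Rightarrow> nat set set \<Rightarrow> nat set set \<Rightarrow> nat" where
  "loops l D E =
     card {C. \<exists>j\<in>{1..l}. C = (glued l D E)\<^sup>* `` {(1, j)} \<and> C \<subseteq> {1} \<times> UNIV}"

text \<open>A pair \<open>(c, D)\<close> stands for the scalar multiple \<open>c\<close> of the diagram \<open>D\<close>.\<close>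

definition diagram_mult ::
  "nat \<Rightarrow> complex \<times> nat set set \<Rightarrow> complex \<times> nat set set \<Rightarrow> complex \<times> nat set set" where
  "diagram_mult l x y =
     (fst x * fst y * (-2) ^ loops l (snd x) (snd y), diagram_comp l (snd x) (snd y))"

definition kauffman :: "nat \<Rightarrow> (nat \<Rightarrow> nat) \<Rightarrow> complex \<times> nat set set" where
  "kauffman l w =
     foldr (\<lambda>i. diagram_mult l (1, gen_diagram l i)) (red_word l w) (1, id_diagram l)"

definition matching_avoiding :: "nat \<Rightarrow> nat set set \<Rightarrow> nat \<Rightarrow> nat" where
  "matching_avoiding l T0 = (THE w. w \<in> avoiding321 l \<and> kauffman l w = (1, T0))"

end

theory Submission
  imports Defs "HOL-Library.Fun_Lexorder"
begin

text \<open>Let \<open>S\<^sub>l\<close> act on functions of the variables \<open>x\<^sub>1, \<dots>, x\<^sub>2\<^sub>l\<close> by permuting the first \<open>l\<close> of them, and let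
  \<open>t\<^sub>i\<close> act as \<open>s\<^sub>i - 1\<close>. On the polynomial of a noncrossing matching, \<open>t\<^sub>i\<close> gives by the Pluecker
  relation the polynomial of the diagram composed with the diagram of \<open>t\<^sub>i\<close>, with the factor \<open>-2\<close>
  for a closed loop. So \<open>TL\<^sub>l(-2)\<close> acts on the span \<open>V\<close> of these polynomials, and
  \<open>t\<^sub>w P\<^sub>i\<^sub>d\<close> is a multiple of the polynomial of the Kauffman diagram of \<open>t\<^sub>w\<close>. The multiple is 1 and the
  diagrams of 321-avoiding permutations are distinct because \<open>t\<^sub>w P\<^sub>i\<^sub>d\<close> has the leading term \<open>w P\<^sub>i\<^sub>d\<close>
  in the lexicographic order. Since the \<open>t\<^sub>w\<close> span, \<open>x \<mapsto> x P\<^sub>i\<^sub>d\<close> is an isomorphism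
  from \<open>TL\<^sub>l(-2)\<close> to \<open>V\<close>. The defining relations of \<open>S\<^sub>l\<close> need not be known for the existence of \<open>\<theta>\<close>:
  \<open>\<theta>(w)\<close> is the element whose action on \<open>P\<^sub>i\<^sub>d\<close> is that of \<open>w\<close>. The theorem compares the expansions of
  \<open>\<theta>(w) P\<^sub>i\<^sub>d = w P\<^sub>i\<^sub>d = P\<^sub>T\<close> on both sides.\<close>

section \<open>Linear extensions of monoid actions\<close>

text \<open>The square and commutation relations hold for s_i - 1 on all functions, but t_i t_j t_i
  - t_i is, up to sign, the antisymmetrizer in three variables; it vanishes on noncrossing matching
  polynomials, not on every function. The ideal of relations is therefore compared with the
  annihilator of all noncrossing polynomials, which is two-sided because words send these
  polynomials to multiples of each other. A priori t_w P_id is (-2)^n times a noncrossing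
  polynomial. At a suitable 0/1 point w P_id has absolute value 1, the lower terms vanish, and every
  matching polynomial has absolute value 0 or 1; hence n = 0. Evaluation at 0/1 points also gives
  the linear independence of the noncrossing polynomials. That every noncrossing matching occurs as
  a Kauffman diagram comes from surjectivity of the action on P_id: Pluecker relations write each
  P_D as an integral combination of the w P_id, and independence then forces \<open>D\<close> to
  occur.\<close>

definition cst :: "complex \<Rightarrow> mpoly" where
  "cst c = Poly_Mapping.single 0 c"

lemma cst_simps:
  "cst 0 = 0" "cst 1 = 1" "cst (a + b) = cst a + cst b" "cst (a * b) = cst a * cst b"
  "cst (- a) = - cst a" "cst (a - b) = cst a - cst b"
  by (simp_all add: cst_def single_add mult_single single_uminus single_diff)

lemma cst_sum: "cst (sum f S) = (\<Sum>x\<in>S. cst (f x))"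
  by (induction S rule: infinite_finite_induct) (simp_all add: cst_simps)

text \<open>A polynomial is handled as the function that sends an assignment of its variables to a
  value in \<open>mpoly\<close>; the assignment \<open>mvar\<close> gives the polynomial back.
  Permuting variables becomes precomposition of the assignment.\<close>

type_synonym polyfun = "(nat \<Rightarrow> mpoly) \<Rightarrow> mpoly"

definition linear_op :: "(polyfun \<Rightarrow> polyfun) \<Rightarrow> bool" where
  "linear_op L \<longleftrightarrow>
     (\<forall>u v. L (\<lambda>a. u a + v a) = (\<lambda>a. L u a + L v a)) \<and>
     (\<forall>c v. L (\<lambda>a. cst c * v a) = (\<lambda>a. cst c * L v a))"

lemma linear_op_zero: "linear_op L \<Longrightarrow> L (\<lambda>a. 0) = (\<lambda>a. 0)"
proof -
  assume "linear_op L"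
  then have "L (\<lambda>a. cst 0 * 0) = (\<lambda>a. cst 0 * L (\<lambda>_. 0) a)" unfolding linear_op_def by fast
  then show ?thesis by (simp add: cst_simps)
qed

lemma linear_op_sum:
  assumes "linear_op L" "finite S"
  shows "L (\<lambda>a. \<Sum>x\<in>S. cst (c x) * v x a) = (\<lambda>a. \<Sum>x\<in>S. cst (c x) * L (v x) a)"
  using assms(2)
proof (induction S rule: finite_induct)
  case empty
  then show ?case using linear_op_zero[OF assms(1)] by simp
next
  case (insert x S)
  have "L (\<lambda>a. cst (c x) * v x a + (\<Sum>x\<in>S. cst (c x) * v x a)) =
      (\<lambda>a. L (\<lambda>a. cst (c x) * v x a) a + L (\<lambda>a. \<Sum>x\<in>S. cst (c x) * v x a) a)"
    using assms(1) unfolding linear_op_def by fast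
  also have "L (\<lambda>a. cst (c x) * v x a) = (\<lambda>a. cst (c x) * L (v x) a)"
    using assms(1) unfolding linear_op_def by fast
  finally show ?case using insert by simp
qed

text \<open>Extends the action of a monoid to its monoid algebra. The two instances are words acting
  through the t_i and permutations acting on variables.\<close>

definition lin_ext :: "('g \<Rightarrow> polyfun \<Rightarrow> polyfun) \<Rightarrow> ('g \<Rightarrow> complex) \<Rightarrow> polyfun \<Rightarrow> polyfun" where
  "lin_ext A f v = (\<lambda>a. \<Sum>x | f x \<noteq> 0. cst (f x) * A x v a)"

text \<open>Terms outside the support vanish, so sums over different supports can be brought to a
  common index set.\<close>

lemma lin_ext_superset:
  assumes "finite S" "{x. f x \<noteq> 0} \<subseteq> S"
  shows "lin_ext A f v = (\<lambda>a. \<Sum>x\<in>S. cst (f x) * A x v a)"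
  unfolding lin_ext_def using assms by (intro ext sum.mono_neutral_left) (auto simp: cst_simps)

lemma lin_ext_delta: "lin_ext A (delta x) v = A x v"
  by (subst lin_ext_superset[of "{x}"]) (auto simp: delta_def cst_simps)

lemma lin_ext_add:
  assumes "finite {x. f x \<noteq> 0}" "finite {x. g x \<noteq> 0}"
  shows "lin_ext A (\<lambda>x. f x + g x) v = (\<lambda>a. lin_ext A f v a + lin_ext A g v a)"
  using assms by (subst (1 2 3) lin_ext_superset[of "{x. f x \<noteq> 0} \<union> {x. g x \<noteq> 0}"])
    (auto simp: cst_simps sum.distrib distrib_right)

lemma lin_ext_scale:
  assumes "finite {x. f x \<noteq> 0}"
  shows "lin_ext A (\<lambda>x. c * f x) v = (\<lambda>a. cst c * lin_ext A f v a)"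
  using assms by (subst (1 2) lin_ext_superset[of "{x. f x \<noteq> 0}"])
    (auto simp: cst_simps sum_distrib_left mult.assoc)

lemma lin_ext_diff:
  assumes "finite {x. f x \<noteq> 0}" "finite {x. g x \<noteq> 0}"
  shows "lin_ext A (\<lambda>x. f x - g x) v = (\<lambda>a. lin_ext A f v a - lin_ext A g v a)"
  using assms by (subst (1 2 3) lin_ext_superset[of "{x. f x \<noteq> 0} \<union> {x. g x \<noteq> 0}"])
    (auto simp: cst_simps sum_subtractf left_diff_distrib)

lemma lin_ext_sum:
  assumes "finite S" "\<And>s. s \<in> S \<Longrightarrow> finite {x. f s x \<noteq> 0}"
  shows "lin_ext A (\<lambda>x. \<Sum>s\<in>S. c s * f s x) v = (\<lambda>a. \<Sum>s\<in>S. cst (c s) * lin_ext A (f s) v a)"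
  using assms
proof (induction S rule: finite_induct)
  case empty
  then show ?case by (simp add: lin_ext_def)
next
  case (insert s S)
  have "{x. (\<Sum>s\<in>S. c s * f s x) \<noteq> 0} \<subseteq> (\<Union>s\<in>S. {x. f s x \<noteq> 0})"
    by auto (metis (no_types, lifting) mult_zero_right sum.neutral)
  then have fin: "finite {x. (\<Sum>s\<in>S. c s * f s x) \<noteq> 0}"
    using insert by (meson finite_UN_I finite_subset insertI2)
  have "finite {x. c s * f s x \<noteq> 0}" using insert.prems[of s] by (rule rev_finite_subset) auto
  with fin show ?case using insert by (simp add: lin_ext_add lin_ext_scale)
qed

lemma linear_op_lin_ext:
  assumes "\<And>x. f x \<noteq> 0 \<Longrightarrow> linear_op (A x)"
  shows "linear_op (lin_ext A f)"
proof -
  have 1: "A x (\<lambda>a. u a + v a) = (\<lambda>a. A x u a + A x v a)" if "f x \<noteq> 0" for x u v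
    using assms[OF that] unfolding linear_op_def by fast
  have 2: "A x (\<lambda>a. cst c * v a) = (\<lambda>a. cst c * A x v a)" if "f x \<noteq> 0" for x c v
    using assms[OF that] unfolding linear_op_def by fast
  show ?thesis unfolding linear_op_def lin_ext_def
    by (auto simp: 1 2 sum.distrib[symmetric] distrib_left sum_distrib_left mult.left_commute intro!: ext sum.cong)
qed

lemma monoid_algebra_carrier:
  "f \<in> carrier (monoid_algebra G) \<longleftrightarrow> finite {x. f x \<noteq> 0} \<and> {x. f x \<noteq> 0} \<subseteq> carrier G"
  by (simp add: monoid_algebra_def)

lemma monoid_algebra_add: "f \<oplus>\<^bsub>monoid_algebra G\<^esub> g = (\<lambda>x. f x + g x)"
  by (simp add: monoid_algebra_def)

lemma monoid_algebra_zero: "\<zero>\<^bsub>monoid_algebra G\<^esub> = (\<lambda>_. 0)"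
  by (simp add: monoid_algebra_def)

lemma monoid_algebra_one: "\<one>\<^bsub>monoid_algebra G\<^esub> = delta \<one>\<^bsub>G\<^esub>"
  by (simp add: monoid_algebra_def)

lemma support_delta: "{y. delta x y \<noteq> 0} = {x}"
  by (auto simp: delta_def)

lemma delta_carrier [simp]: "delta x \<in> carrier (monoid_algebra G) \<longleftrightarrow> x \<in> carrier G"
  by (simp add: monoid_algebra_carrier support_delta)

lemma scale_carrier:
  "f \<in> carrier (monoid_algebra G) \<Longrightarrow> (\<lambda>x. c * f x) \<in> carrier (monoid_algebra G)"
  unfolding monoid_algebra_carrier by (auto elim: rev_finite_subset)

lemma scalar_eq: "scalar G c = (\<lambda>x. c * delta \<one>\<^bsub>G\<^esub> x)"
  by (auto simp: scalar_def delta_def)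

lemma scalar_carrier: "monoid G \<Longrightarrow> scalar G c \<in> carrier (monoid_algebra G)"
  unfolding scalar_eq by (intro scale_carrier) (simp add: monoid.one_closed)

lemma sum_carrier:
  assumes "finite S" "\<And>s. s \<in> S \<Longrightarrow> f s \<in> carrier (monoid_algebra G)"
  shows "(\<lambda>x. \<Sum>s\<in>S. f s x) \<in> carrier (monoid_algebra G)"
proof -
  have "{x. (\<Sum>s\<in>S. f s x) \<noteq> 0} \<subseteq> (\<Union>s\<in>S. {x. f s x \<noteq> 0})"
    by (auto elim: sum.not_neutral_contains_not_neutral)
  moreover have "finite (\<Union>s\<in>S. {x. f s x \<noteq> 0})" "(\<Union>s\<in>S. {x. f s x \<noteq> 0}) \<subseteq> carrier G"
    using assms by (auto simp: monoid_algebra_carrier)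
  ultimately show ?thesis unfolding monoid_algebra_carrier by (meson finite_subset subset_trans)
qed

lemma add_carrier:
  assumes "f \<in> carrier (monoid_algebra G)" "g \<in> carrier (monoid_algebra G)"
  shows "(\<lambda>x. f x + g x) \<in> carrier (monoid_algebra G)"
  using sum_carrier[of "{True, False}" "\<lambda>b. if b then f else g" G] assms by simp

lemma diff_carrier:
  assumes "f \<in> carrier (monoid_algebra G)" "g \<in> carrier (monoid_algebra G)"
  shows "(\<lambda>x. f x - g x) \<in> carrier (monoid_algebra G)"
  using add_carrier[OF assms(1) scale_carrier[OF assms(2), of "-1"]] by simp

lemma delta_mult: "delta x \<otimes>\<^bsub>monoid_algebra G\<^esub> delta y = delta (x \<otimes>\<^bsub>G\<^esub> y)"
  by (rule ext, subst monoid_algebra_mult[of "{x}" "{y}"]) (auto simp: delta_def)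

lemma scale_delta_mult:
  assumes "monoid G" "f \<in> carrier (monoid_algebra G)"
  shows "scalar G c \<otimes>\<^bsub>monoid_algebra G\<^esub> f = (\<lambda>x. c * f x)"
proof
  fix x
  have fin: "finite {x. f x \<noteq> 0}" and mem: "\<And>y. f y \<noteq> 0 \<Longrightarrow> y \<in> carrier G"
    using assms(2) by (auto simp: monoid_algebra_carrier)
  have "(scalar G c \<otimes>\<^bsub>monoid_algebra G\<^esub> f) x =
      (\<Sum>y\<in>{\<one>\<^bsub>G\<^esub>}. \<Sum>z | f z \<noteq> 0. if y \<otimes>\<^bsub>G\<^esub> z = x then scalar G c y * f z else 0)"
    using fin by (intro monoid_algebra_mult) (auto simp: scalar_def split: if_splits)
  also have "\<dots> = (\<Sum>z | f z \<noteq> 0. if z = x then c * f z else 0)"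
    using assms(1) mem by (auto simp: scalar_def monoid.l_one intro!: sum.cong)
  also have "\<dots> = c * f x" using fin by simp
  finally show "(scalar G c \<otimes>\<^bsub>monoid_algebra G\<^esub> f) x = c * f x" .
qed

lemma monoid_algebra_minus:
  assumes "monoid G" "f \<in> carrier (monoid_algebra G)" "g \<in> carrier (monoid_algebra G)"
  shows "f \<ominus>\<^bsub>monoid_algebra G\<^esub> g = (\<lambda>x. f x - g x)"
proof -
  interpret ring "monoid_algebra G" by (rule ring_monoid_algebra[OF assms(1)])
  have neg: "(\<lambda>x. - g x) \<in> carrier (monoid_algebra G)"
    using scale_carrier[OF assms(3), of "-1"] by simp
  have "\<ominus>\<^bsub>monoid_algebra G\<^esub> g = (\<lambda>x. - g x)"
    by (rule minus_equality) (use assms(3) neg in \<open>auto simp: monoid_algebra_add monoid_algebra_zero\<close>)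
  then show ?thesis by (simp add: a_minus_def monoid_algebra_add)
qed

text \<open>The outer operator has to be linear to pass through the sum that defines the inner one;
  compatibility with products is asked at the vector \<open>v\<close> only.\<close>

lemma lin_ext_mult:
  assumes "monoid G" and f: "f \<in> carrier (monoid_algebra G)" and g: "g \<in> carrier (monoid_algebra G)"
    and lin: "\<And>x. x \<in> carrier G \<Longrightarrow> linear_op (A x)"
    and A: "\<And>x y. x \<in> carrier G \<Longrightarrow> y \<in> carrier G \<Longrightarrow> A (x \<otimes>\<^bsub>G\<^esub> y) v = A x (A y v)"
  shows "lin_ext A (f \<otimes>\<^bsub>monoid_algebra G\<^esub> g) v = lin_ext A f (lin_ext A g v)"
proof
  fix a
  let ?F = "{x. f x \<noteq> 0}" and ?G = "{x. g x \<noteq> 0}"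
  let ?X = "(\<lambda>(y, z). y \<otimes>\<^bsub>G\<^esub> z) ` (?F \<times> ?G)"
  have fin: "finite ?F" "finite ?G" "?F \<subseteq> carrier G" "?G \<subseteq> carrier G"
    using f g by (auto simp: monoid_algebra_carrier)
  note m = monoid_algebra_mult[OF fin(1,2) order_refl order_refl, of G]
  have "{x. (f \<otimes>\<^bsub>monoid_algebra G\<^esub> g) x \<noteq> 0} \<subseteq> ?X"
  proof
    fix x assume "x \<in> {x. (f \<otimes>\<^bsub>monoid_algebra G\<^esub> g) x \<noteq> 0}"
    then have "(\<Sum>y\<in>?F. \<Sum>z\<in>?G. if y \<otimes>\<^bsub>G\<^esub> z = x then f y * g z else 0) \<noteq> 0" by (simp add: m)
    then obtain y where "y \<in> ?F" "(\<Sum>z\<in>?G. if y \<otimes>\<^bsub>G\<^esub> z = x then f y * g z else 0) \<noteq> 0"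
      by (rule sum.not_neutral_contains_not_neutral)
    moreover from this(2) obtain z where "z \<in> ?G" "(if y \<otimes>\<^bsub>G\<^esub> z = x then f y * g z else 0) \<noteq> 0"
      by (rule sum.not_neutral_contains_not_neutral)
    ultimately show "x \<in> ?X" by (force split: if_splits)
  qed
  then have "lin_ext A (f \<otimes>\<^bsub>monoid_algebra G\<^esub> g) v a =
      (\<Sum>x\<in>?X. cst ((f \<otimes>\<^bsub>monoid_algebra G\<^esub> g) x) * A x v a)"
    using fin by (subst lin_ext_superset[of ?X]) auto
  also have "\<dots> = (\<Sum>x\<in>?X. \<Sum>y\<in>?F. \<Sum>z\<in>?G.
      if x = y \<otimes>\<^bsub>G\<^esub> z then cst (f y) * cst (g z) * A x v a else 0)"
    unfolding m cst_sum sum_distrib_right by (intro sum.cong refl) (auto simp: cst_simps)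
  also have "\<dots> = (\<Sum>y\<in>?F. \<Sum>z\<in>?G. \<Sum>x\<in>?X.
      if x = y \<otimes>\<^bsub>G\<^esub> z then cst (f y) * cst (g z) * A x v a else 0)"
    by (rule sum_rotate3[symmetric])
  also have "\<dots> = (\<Sum>y\<in>?F. \<Sum>z\<in>?G. cst (f y) * cst (g z) * A (y \<otimes>\<^bsub>G\<^esub> z) v a)"
    using fin by (intro sum.cong refl) (subst sum.delta, auto)
  also have "\<dots> = (\<Sum>y\<in>?F. cst (f y) * A y (lin_ext A g v) a)"
  proof (intro sum.cong refl)
    fix y assume y: "y \<in> ?F"
    then have yG: "y \<in> carrier G" using fin by auto
    have "A y (lin_ext A g v) = (\<lambda>a. \<Sum>z\<in>?G. cst (g z) * A y (A z v) a)"
      unfolding lin_ext_def by (rule linear_op_sum) (use lin[OF yG] fin in auto)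
    moreover have "A (y \<otimes>\<^bsub>G\<^esub> z) v = A y (A z v)" if "z \<in> ?G" for z using A yG fin that by auto
    ultimately show "(\<Sum>z\<in>?G. cst (f y) * cst (g z) * A (y \<otimes>\<^bsub>G\<^esub> z) v a) =
        cst (f y) * A y (lin_ext A g v) a"
      by (simp add: sum_distrib_left mult.assoc)
  qed
  finally show "lin_ext A (f \<otimes>\<^bsub>monoid_algebra G\<^esub> g) v a = lin_ext A f (lin_ext A g v) a"
    by (simp add: lin_ext_def)
qed

section \<open>The operators s_i and t_i on functions of the variables\<close>

abbreviation adj_swap :: "nat \<Rightarrow> nat \<Rightarrow> nat" where
  "adj_swap i \<equiv> transpose i (i + 1)"

text \<open>Composition on the right of the assignment makes this a left action; on a polynomial it
  replaces x_j by x_(s j).\<close>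

definition perm_act :: "(nat \<Rightarrow> nat) \<Rightarrow> polyfun \<Rightarrow> polyfun" where
  "perm_act s v = (\<lambda>a. v (a \<circ> s))"

definition tl_op :: "nat \<Rightarrow> polyfun \<Rightarrow> polyfun" where
  "tl_op i v = (\<lambda>a. v (a \<circ> adj_swap i) - v a)"

definition word_act :: "nat list \<Rightarrow> polyfun \<Rightarrow> polyfun" where
  "word_act is v = foldr tl_op is v"

lemma word_act_simps [simp]:
  "word_act [] v = v" "word_act (i # is) v = tl_op i (word_act is v)"
  by (simp_all add: word_act_def)

lemma word_act_append: "word_act (is @ js) v = word_act is (word_act js v)"
  by (simp add: word_act_def)

lemma linear_perm_act: "linear_op (perm_act s)"
  by (simp add: linear_op_def perm_act_def)

lemma linear_tl_op: "linear_op (tl_op i)"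
  by (simp add: linear_op_def tl_op_def algebra_simps)

lemma tl_op_scale: "tl_op i (\<lambda>a. c * v a) = (\<lambda>a. c * tl_op i v a)"
  by (simp add: tl_op_def right_diff_distrib)

lemma linear_word_act: "linear_op (word_act is)"
proof (induction "is")
  case (Cons i "is")
  with linear_tl_op[of i] show ?case unfolding linear_op_def by simp
qed (simp add: linear_op_def)

lemma perm_act_comp: "perm_act (s \<circ> t) v = perm_act s (perm_act t v)"
  by (simp add: perm_act_def comp_assoc)

section \<open>Reduced words of 321-avoiding permutations\<close>

definition inversions :: "nat \<Rightarrow> (nat \<Rightarrow> nat) \<Rightarrow> (nat \<times> nat) set" where
  "inversions l p = {(a, b). 1 \<le> a \<and> a < b \<and> b \<le> l \<and> p b < p a}"

lemma finite_inversions: "finite (inversions l p)"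
  by (rule finite_subset[of _ "{1..l} \<times> {1..l}"]) (auto simp: inversions_def)

text \<open>The swap of positions keeps the order of every pair except \<open>(i, i + 1)\<close>, so
  it carries inversions to inversions and adds just that pair.\<close>

lemma inversions_swap:
  assumes "i \<in> {1..<l}" "p i < p (i + 1)"
  shows "inversions l (p \<circ> adj_swap i) =
    insert (i, i + 1) (map_prod (adj_swap i) (adj_swap i) ` inversions l p)"
    (is "?L = insert _ (map_prod ?s ?s ` ?I)")
proof (intro equalityI subsetI)
  fix x assume "x \<in> ?L"
  then obtain a b where x: "x = (a, b)" "1 \<le> a" "a < b" "b \<le> l" "p (?s b) < p (?s a)"
    by (auto simp: inversions_def)
  show "x \<in> insert (i, i + 1) (map_prod ?s ?s ` ?I)"
  proof (cases "x = (i, i + 1)")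
    case False
    then have "?s a < ?s b" "1 \<le> ?s a" "?s b \<le> l" using x assms by (auto simp: transpose_def)
    then have "(?s a, ?s b) \<in> ?I" using x by (simp add: inversions_def)
    then have "map_prod ?s ?s (?s a, ?s b) \<in> map_prod ?s ?s ` ?I" by (rule imageI)
    then show ?thesis using x(1) by simp
  qed simp
next
  fix x assume "x \<in> insert (i, i + 1) (map_prod ?s ?s ` ?I)"
  then consider "x = (i, i + 1)" | a b where "x = (?s a, ?s b)" "1 \<le> a" "a < b" "b \<le> l" "p b < p a"
    by (auto simp: inversions_def)
  then show "x \<in> ?L"
  proof cases
    case 1
    then show ?thesis using assms by (simp add: inversions_def)
  next
    case 2
    then have "?s a < ?s b" "1 \<le> ?s a" "?s b \<le> l" using assms by (auto simp: transpose_def)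
    then show ?thesis using 2 by (simp add: inversions_def)
  qed
qed

lemma card_inversions_swap:
  assumes "i \<in> {1..<l}" "p i < p (i + 1)"
  shows "card (inversions l (p \<circ> adj_swap i)) = Suc (card (inversions l p))"
proof -
  let ?s = "adj_swap i"
  have "(i, i + 1) \<notin> map_prod ?s ?s ` inversions l p"
    by (auto simp: inversions_def transpose_def split: if_splits)
  moreover have "card (map_prod ?s ?s ` inversions l p) = card (inversions l p)"
    by (intro card_image inj_on_subset[OF prod.inj_map]) auto
  ultimately show ?thesis unfolding inversions_swap[OF assms] by (simp add: finite_inversions)
qed

lemma swap_twice: "p \<circ> transpose i j \<circ> transpose i j = p"
  by (simp add: comp_assoc)

lemma card_inversions_swap':
  assumes "i \<in> {1..<l}" "p i > p (i + 1)"
  shows "card (inversions l p) = Suc (card (inversions l (p \<circ> adj_swap i)))"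
  using card_inversions_swap[of i l "p \<circ> adj_swap i"] assms by (simp add: swap_twice)

lemma card_inversions_swap_le:
  assumes "i \<in> {1..<l}" "p permutes {1..l}"
  shows "card (inversions l (p \<circ> adj_swap i)) \<le> Suc (card (inversions l p))"
proof -
  have "p i \<noteq> p (i + 1)" using permutes_inj[OF assms(2)] by (simp add: inj_eq)
  then consider "p i < p (i + 1)" | "p i > p (i + 1)" by linarith
  then show ?thesis
    using card_inversions_swap[OF assms(1), of p] card_inversions_swap'[OF assms(1), of p]
    by cases linarith+
qed

lemma permutes_swap:
  fixes p :: "nat \<Rightarrow> nat"
  shows "p permutes {1..l} \<Longrightarrow> i \<in> {1..<l} \<Longrightarrow> p \<circ> adj_swap i permutes {1..l}"
  by (intro permutes_compose permutes_swap_id) auto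

text \<open>An increasing permutation satisfies \<open>i \<le> p i\<close> by induction, which
  forces the identity.\<close>

lemma permutes_no_descent:
  fixes p :: "nat \<Rightarrow> nat"
  assumes p: "p permutes {1..l}" and asc: "\<And>i. i \<in> {1..<l} \<Longrightarrow> p i < p (i + 1)"
  shows "p = id"
proof -
  have "i \<in> {1..l} \<Longrightarrow> i \<le> p i" for i
  proof (induction i)
    case (Suc i)
    show ?case
    proof (cases "i = 0")
      case True
      then show ?thesis using Suc permutes_in_image[OF p, of "Suc i"] by auto
    next
      case False
      then show ?thesis using Suc asc[of i] by auto
    qed
  qed simp
  then show ?thesis by (intro permutes_natset_ge[OF p]) auto
qed

text \<open>This is the inverse of \<open>word_perm\<close>: a new first letter multiplies on the
  right and thus swaps two adjacent positions of the one-line notation, where inversions and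
  321-patterns are easy to follow.\<close>

definition pos_perm :: "nat list \<Rightarrow> nat \<Rightarrow> nat" where
  "pos_perm is = foldl (\<lambda>p i. p \<circ> adj_swap i) id (rev is)"

lemma pos_perm_simps [simp]:
  "pos_perm [] = id" "pos_perm (i # is) = pos_perm is \<circ> adj_swap i"
  by (simp_all add: pos_perm_def)

lemma word_perm_simps [simp]:
  "word_perm [] = id" "word_perm (i # is) = adj_swap i \<circ> word_perm is"
  by (simp_all add: word_perm_def)

lemma word_perm_permutes: "is \<in> lists {1..<l} \<Longrightarrow> word_perm is permutes {1..l}"
  by (induction "is") (auto intro!: permutes_compose permutes_swap_id permutes_id[unfolded id_def] simp: permutes_id)

lemma pos_perm_permutes: "is \<in> lists {1..<l} \<Longrightarrow> pos_perm is permutes {1..l}"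
proof (induction "is")
  case (Cons i "is")
  then show ?case unfolding pos_perm_simps by (intro permutes_swap) auto
qed (simp add: permutes_id)

lemma inv_word_perm:
  assumes "is \<in> lists {1..<l}"
  shows "inv' (word_perm is) = pos_perm is"
  using assms
proof (induction "is")
  case (Cons i "is")
  then have "bij (word_perm is)" using word_perm_permutes permutes_bij by auto
  then have "inv' (word_perm (i # is)) = inv' (word_perm is) \<circ> adj_swap i"
    unfolding word_perm_simps by (subst o_inv_distrib) auto
  with Cons.IH Cons.prems show ?case unfolding pos_perm_simps by (simp only: lists.simps)
qed (simp add: inv_id)

lemma word_perm_eq_inv:
  assumes "is \<in> lists {1..<l}"
  shows "word_perm is = inv' (pos_perm is)"
  by (subst inv_word_perm[OF assms, symmetric])
    (rule permutes_inv_inv[OF word_perm_permutes[OF assms], symmetric])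

text \<open>Measures length by inversions instead of by minimality among words;
  \<open>reduced_word_iff\<close> shows that both notions agree.\<close>

definition reduced :: "nat \<Rightarrow> nat list \<Rightarrow> bool" where
  "reduced l is \<longleftrightarrow> is \<in> lists {1..<l} \<and> length is = card (inversions l (pos_perm is))"

lemma inversions_id: "inversions l id = {}"
  by (auto simp: inversions_def)

lemma card_inversions_le_length:
  "is \<in> lists {1..<l} \<Longrightarrow> card (inversions l (pos_perm is)) \<le> length is"
proof (induction "is")
  case (Cons i "is")
  then show ?case using card_inversions_swap_le[of i l "pos_perm is", OF _ pos_perm_permutes]
    by (fastforce simp del: o_apply)
qed (simp add: inversions_id)

text \<open>If the tail had a descent at \<open>i\<close>, the letter would remove an inversion, and
  the tail would have more inversions than letters.\<close>

lemma reduced_ConsD: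
  assumes "reduced l (i # is)"
  shows "reduced l is" "pos_perm is i < pos_perm is (i + 1)" "i \<in> {1..<l}"
proof -
  have i: "i \<in> {1..<l}" and "is": "is \<in> lists {1..<l}"
    and len: "Suc (length is) = card (inversions l (pos_perm is \<circ> adj_swap i))"
    using assms by (auto simp: reduced_def)
  note perm = pos_perm_permutes[OF "is"]
  have ne: "pos_perm is i \<noteq> pos_perm is (i + 1)" using permutes_inj[OF perm] by (simp add: inj_eq)
  show "pos_perm is i < pos_perm is (i + 1)"
    using card_inversions_swap'[OF i, of "pos_perm is"] len ne card_inversions_le_length[OF "is"] by force
  then show "reduced l is"
    using card_inversions_swap[OF i, of "pos_perm is"] len "is" by (simp add: reduced_def)
  show "i \<in> {1..<l}" by fact
qed

lemma reduced_ConsI: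
  "reduced l is \<Longrightarrow> i \<in> {1..<l} \<Longrightarrow> pos_perm is i < pos_perm is (i + 1) \<Longrightarrow> reduced l (i # is)"
  using card_inversions_swap[of i l "pos_perm is"] by (auto simp: reduced_def)

text \<open>Bubble sort: a descent is removed and becomes the first letter, with induction on the
  number of inversions.\<close>

lemma reduced_exists:
  assumes "p permutes {1..l}"
  obtains "is" where "reduced l is" "pos_perm is = p"
proof -
  have "\<exists>is. reduced l is \<and> pos_perm is = p" using assms
  proof (induction "card (inversions l p)" arbitrary: p rule: less_induct)
    case less
    show ?case
    proof (cases "\<exists>i\<in>{1..<l}. p i > p (i + 1)")
      case False
      moreover have "p i \<noteq> p (i + 1)" for i using permutes_inj[OF less.prems] by (simp add: inj_eq)
      ultimately have "p = id"
        by (intro permutes_no_descent[OF less.prems]) (meson linorder_neqE_nat)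
      then have "reduced l [] \<and> pos_perm [] = p" by (simp add: reduced_def inversions_id)
      then show ?thesis by blast
    next
      case True
      then obtain i where i: "i \<in> {1..<l}" "p i > p (i + 1)" by blast
      then obtain "is" where "is": "reduced l is" "pos_perm is = p \<circ> adj_swap i"
        using less.hyps[of "p \<circ> adj_swap i"] card_inversions_swap'[OF i] permutes_swap[OF less.prems i(1)]
        by auto
      have "reduced l (i # is)" using "is" i by (intro reduced_ConsI) auto
      moreover have "pos_perm (i # is) = p" by (simp add: "is"(2) swap_twice del: One_nat_def)
      ultimately show ?thesis by blast
    qed
  qed
  then show thesis using that by blast
qed

lemma reduced_exists_Cons:
  assumes "p permutes {1..l}" "i \<in> {1..<l}" "p i > p (i + 1)"
  obtains "is" where "reduced l (i # is)" "pos_perm (i # is) = p" "pos_perm is = p \<circ> adj_swap i"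
proof -
  obtain "is" where "is": "reduced l is" "pos_perm is = p \<circ> adj_swap i"
    using reduced_exists[OF permutes_swap[OF assms(1,2)]] by blast
  have "reduced l (i # is)" using "is" assms by (intro reduced_ConsI) auto
  moreover have "pos_perm (i # is) = p" by (simp add: "is"(2) swap_twice)
  ultimately show thesis using that "is" by blast
qed

lemma reduced_same_length:
  "reduced l is \<Longrightarrow> pos_perm js = pos_perm is \<Longrightarrow> js \<in> lists {1..<l} \<Longrightarrow> length js = length is
    \<Longrightarrow> reduced l js"
  by (simp add: reduced_def)

section \<open>321-avoidance under inversion and adjacent swaps\<close>

definition avoids321 :: "nat \<Rightarrow> (nat \<Rightarrow> nat) \<Rightarrow> bool" where
  "avoids321 l w \<longleftrightarrow> \<not> (\<exists>i j k. 1 \<le> i \<and> i < j \<and> j < k \<and> k \<le> l \<and> w i > w j \<and> w j > w k)"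

lemma avoiding321_iff: "w \<in> avoiding321 l \<longleftrightarrow> w permutes {1..l} \<and> avoids321 l w"
  by (auto simp: avoiding321_def avoids321_def)

lemma avoids321D:
  "avoids321 l w \<Longrightarrow> 1 \<le> i \<Longrightarrow> i < j \<Longrightarrow> j < k \<Longrightarrow> k \<le> l \<Longrightarrow> w i > w j \<Longrightarrow> w j > w k \<Longrightarrow> False"
  unfolding avoids321_def by blast

text \<open>A 321-pattern stays one when positions and values are exchanged, so a pattern of the
  inverse gives one of \<open>w\<close>.\<close>

lemma avoids321_inv:
  assumes w: "w permutes {1..l}" and av: "avoids321 l w"
  shows "avoids321 l (inv' w)"
  unfolding avoids321_def
proof clarify
  fix i j k assume *: "1 \<le> i" "i < j" "j < k" "k \<le> l" "inv' w j < inv' w i" "inv' w k < inv' w j"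
  have "inv' w i \<in> {1..l}" "inv' w k \<in> {1..l}"
    using * permutes_in_image[OF permutes_inv[OF w], of i] permutes_in_image[OF permutes_inv[OF w], of k]
    by simp_all
  moreover have "w (inv' w i) = i" "w (inv' w j) = j" "w (inv' w k) = k"
    by (simp_all add: permutes_inverses[OF w])
  ultimately show False using * avoids321D[OF av, of "inv' w k" "inv' w j" "inv' w i"] by auto
qed

text \<open>A pattern of \<open>p\<close> cannot use both \<open>i\<close> and \<open>i + 1\<close>,
  since \<open>p\<close> ascends there; the swap therefore keeps its positions in order and it
  survives in \<open>p \<circ> adj_swap i\<close>.\<close>

lemma avoids321_swap_asc:
  assumes "i \<in> {1..<l}" "p i < p (i + 1)" "avoids321 l (p \<circ> adj_swap i)"
  shows "avoids321 l p"
  unfolding avoids321_def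
proof clarify
  let ?s = "adj_swap i"
  fix a b c assume *: "1 \<le> a" "a < b" "b < c" "c \<le> l" "p b < p a" "p c < p b"
  have "1 \<le> ?s a" "?s a < ?s b" "?s b < ?s c" "?s c \<le> l"
    using * assms(1,2) by (auto simp: transpose_def)
  with * show False by (intro avoids321D[OF assms(3), of "?s a" "?s b" "?s c"]) simp_all
qed

text \<open>A pattern that appears with the swap must have both swapped positions as neighbouring
  entries; the third entry lies to their left or to their right.\<close>

lemma not_avoids321_swap:
  assumes "i \<in> {1..<l}" "p i < p (i + 1)" "avoids321 l p" "\<not> avoids321 l (p \<circ> adj_swap i)"
  shows "(\<exists>k. 1 \<le> k \<and> k < i \<and> p (i + 1) < p k) \<or> (\<exists>k. i + 1 < k \<and> k \<le> l \<and> p k < p i)"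
proof -
  let ?s = "adj_swap i"
  obtain a b c where *: "1 \<le> a" "a < b" "b < c" "c \<le> l" "p (?s b) < p (?s a)" "p (?s c) < p (?s b)"
    using assms(4) by (auto simp: avoids321_def)
  consider "a = i \<and> b = i + 1" | "b = i \<and> c = i + 1" | "\<not> (a = i \<and> b = i + 1)" "\<not> (b = i \<and> c = i + 1)"
    by blast
  then show ?thesis
  proof cases
    case 1
    then have "c > i + 1" "p c < p i" using * by (auto simp: transpose_def split: if_splits)
    then show ?thesis using * by blast
  next
    case 2
    then have "a < i" "p (i + 1) < p a" using * by (auto simp: transpose_def split: if_splits)
    then show ?thesis using * by blast
  next
    case 3
    then have "1 \<le> ?s a" "?s a < ?s b" "?s b < ?s c" "?s c \<le> l"
      using * assms(1,2) by (auto simp: transpose_def)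
    then show ?thesis using avoids321D[OF assms(3), of "?s a" "?s b" "?s c"] * by blast
  qed
qed

section \<open>Reduced words of 321-avoiding permutations as normal forms of words\<close>

definition good :: "nat \<Rightarrow> nat list \<Rightarrow> bool" where
  "good l is \<longleftrightarrow> reduced l is \<and> avoids321 l (pos_perm is)"

lemma good_ConsD: "good l (i # is) \<Longrightarrow> good l is"
  unfolding good_def using reduced_ConsD[of l i "is"] avoids321_swap_asc[of i l "pos_perm is"] by auto

lemma good_lists: "good l is \<Longrightarrow> is \<in> lists {1..<l}"
  by (simp add: good_def reduced_def)

text \<open>Stands for t_u = (-2)^n t_v, where \<open>n\<close> counts the squares contracted. The
  relations are directed rewriting rules at the front of a word, and \<open>tl_cong_Cons\<close>
  carries them further in. Square and braid rules only shorten; commutation can be undone by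
  itself.\<close>

inductive tl_cong :: "nat \<Rightarrow> nat list \<Rightarrow> nat \<Rightarrow> nat list \<Rightarrow> bool" for l where
  tl_cong_refl: "u \<in> lists {1..<l} \<Longrightarrow> tl_cong l u 0 u"
| tl_cong_trans: "tl_cong l u m v \<Longrightarrow> tl_cong l v n w \<Longrightarrow> tl_cong l u (m + n) w"
| tl_cong_Cons: "tl_cong l u n v \<Longrightarrow> i \<in> {1..<l} \<Longrightarrow> tl_cong l (i # u) n (i # v)"
| tl_cong_square: "i \<in> {1..<l} \<Longrightarrow> u \<in> lists {1..<l} \<Longrightarrow> tl_cong l (i # i # u) 1 (i # u)"
| tl_cong_braid: "i \<in> {1..<l} \<Longrightarrow> j \<in> {1..<l} \<Longrightarrow> j = i + 1 \<or> i = j + 1 \<Longrightarrow> u \<in> lists {1..<l} \<Longrightarrow>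
    tl_cong l (i # j # i # u) 0 (i # u)"
| tl_cong_commute: "i \<in> {1..<l} \<Longrightarrow> j \<in> {1..<l} \<Longrightarrow> i + 1 < j \<or> j + 1 < i \<Longrightarrow> u \<in> lists {1..<l} \<Longrightarrow>
    tl_cong l (i # j # u) 0 (j # i # u)"

lemma tl_cong_lists: "tl_cong l u n v \<Longrightarrow> u \<in> lists {1..<l} \<and> v \<in> lists {1..<l}"
  by (induction rule: tl_cong.induct) auto

lemma tl_cong_trans0: "tl_cong l u 0 v \<Longrightarrow> tl_cong l v n w \<Longrightarrow> tl_cong l u n w"
  using tl_cong_trans by fastforce

lemma swap_commute:
  assumes "i + 1 < j \<or> j + 1 < (i::nat)"
  shows "adj_swap i \<circ> adj_swap j = adj_swap j \<circ> adj_swap i"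
  using assms by (auto simp: fun_eq_iff transpose_def)

text \<open>Reduced words of one 321-avoiding permutation differ by commutations alone. Distinct
  first letters \<open>i\<close> and \<open>j\<close> are both descents; neighbouring descents would
  make a 321-pattern, and distant ones can both be brought to the front.\<close>

lemma tl_cong_good:
  assumes "good l is" "good l js" "pos_perm is = pos_perm js"
  shows "tl_cong l is 0 js"
  using assms
proof (induction "length is" arbitrary: "is" js rule: less_induct)
  case less
  let ?p = "pos_perm is"
  have len: "length is = length js" using less.prems by (simp add: good_def reduced_def)
  show ?case
  proof (cases "is")
    case Nil
    then show ?thesis using len by (auto intro: tl_cong_refl)
  next
    case (Cons i u)
    then obtain j v where js: "js = j # v" using len by (cases js) auto
    have good: "good l u" "good l v" using good_ConsD less.prems Cons js by auto
    have i: "i \<in> {1..<l}" and j: "j \<in> {1..<l}"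
      using good_lists[OF less.prems(1)] good_lists[OF less.prems(2)] Cons js by auto
    have p: "?p = pos_perm u \<circ> adj_swap i" "?p = pos_perm v \<circ> adj_swap j"
      using less.prems(3) Cons js by simp_all
    have di: "?p i > ?p (i + 1)"
      unfolding p(1) using reduced_ConsD(2)[of l i u] less.prems(1) Cons by (simp add: good_def)
    have dj: "?p j > ?p (j + 1)"
      unfolding p(2) using reduced_ConsD(2)[of l j v] less.prems(2) js by (simp add: good_def)
    have av: "avoids321 l ?p" using less.prems(1) by (simp add: good_def)
    consider "i = j" | "j = i + 1 \<or> i = j + 1" | "i + 1 < j \<or> j + 1 < i" by linarith
    then show ?thesis
    proof cases
      case 1
      then have "pos_perm u = pos_perm v" using p by (metis swap_twice)
      then have "tl_cong l u 0 v" using less.hyps[of u v] good Cons by simp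
      then show ?thesis using tl_cong_Cons i Cons js 1 by auto
    next
      case 2
      then show ?thesis
        using avoids321D[OF av, of i "i+1" "i+2"] avoids321D[OF av, of j "j+1" "j+2"] di dj i j by auto
    next
      case 3
      have pu: "pos_perm u = ?p \<circ> adj_swap i" and pv: "pos_perm v = ?p \<circ> adj_swap j"
        using p by (metis swap_twice)+
      have "pos_perm u (j + 1) < pos_perm u j" using 3 dj unfolding pu by (auto simp: transpose_def)
      \<comment> \<open>\<open>z\<close> is the common tail: the words \<open>i # j # z\<close> and
        \<open>j # i # z\<close> link the two given ones, and induction handles the tails
        \<open>u\<close> and \<open>v\<close>.\<close>
      then obtain z where z: "reduced l (j # z)" "pos_perm (j # z) = pos_perm u"
          "pos_perm z = pos_perm u \<circ> adj_swap j"
        using reduced_exists_Cons[OF pos_perm_permutes[OF good_lists[OF good(1)]] j] by metis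
      have zl: "z \<in> lists {1..<l}" using z(1) by (auto simp: reduced_def)
      have gz: "good l (j # z)" using z good(1) by (simp add: good_def)
      have lenz: "length u = Suc (length z)"
        using gz good(1) z(2) by (simp add: good_def reduced_def)
      have c1: "tl_cong l u 0 (j # z)" using less.hyps[of u "j # z"] good(1) gz z(2) Cons by simp
      have "pos_perm (i # z) = ?p \<circ> (adj_swap i \<circ> adj_swap j) \<circ> adj_swap i"
        by (simp add: z(3) pu comp_assoc)
      also have "\<dots> = pos_perm v" unfolding swap_commute[OF 3] pv by (simp add: comp_assoc)
      finally have pz: "pos_perm (i # z) = pos_perm v" .
      have giz: "good l (i # z)"
        using good(2) pz reduced_same_length[of l v "i # z"] zl i len lenz Cons js by (auto simp: good_def)
      have c2: "tl_cong l (i # z) 0 v"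
        using less.hyps[of "i # z" v] giz good(2) pz Cons lenz by simp
      have "tl_cong l (i # u) 0 (j # v)"
        using tl_cong_Cons[OF c1 i] tl_cong_commute[OF i j 3 zl] tl_cong_Cons[OF c2 j]
        by (meson tl_cong_trans0)
      then show ?thesis using Cons js by simp
    qed
  qed
qed

text \<open>The exchange property in the form that rewriting needs: any descent can be moved to the
  front without producing a factor.\<close>

lemma good_descent:
  assumes "good l u" "i \<in> {1..<l}" "pos_perm u i > pos_perm u (i + 1)"
  obtains v where "good l (i # v)" "tl_cong l u 0 (i # v)" "pos_perm v = pos_perm u \<circ> adj_swap i"
    "length u = Suc (length v)"
proof -
  obtain v where v: "reduced l (i # v)" "pos_perm (i # v) = pos_perm u"
      "pos_perm v = pos_perm u \<circ> adj_swap i"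
    using reduced_exists_Cons[OF pos_perm_permutes[OF good_lists[OF assms(1)]] assms(2,3)] by metis
  then have g: "good l (i # v)" using assms(1) by (simp add: good_def)
  moreover have "tl_cong l u 0 (i # v)" using tl_cong_good[OF assms(1) g] v by simp
  moreover have "length u = length (i # v)" using assms(1) v(1,2) by (metis good_def reduced_def)
  ultimately show thesis using that v by simp
qed

text \<open>The two successive descents rewrite \<open>u\<close> to \<open>m # i # z\<close>, and
  the braid rule turns \<open>i # m # i # z\<close> into \<open>i # z\<close>.\<close>

lemma tl_cong_shorten_adjacent:
  assumes u: "good l u" and i: "i \<in> {1..<l}" and m: "m \<in> {1..<l}" and im: "m = i + 1 \<or> i = m + 1"
    and desc: "pos_perm u (m + 1) < pos_perm u m"
      "(pos_perm u \<circ> adj_swap m) (i + 1) < (pos_perm u \<circ> adj_swap m) i"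
  shows "\<exists>n v. tl_cong l (i # u) n v \<and> length v \<le> length u"
proof -
  obtain v where v: "good l (m # v)" "tl_cong l u 0 (m # v)" "length u = Suc (length v)"
      "pos_perm v = pos_perm u \<circ> adj_swap m"
    using good_descent[OF u m desc(1)] by metis
  obtain z where z: "good l (i # z)" "tl_cong l v 0 (i # z)" "length v = Suc (length z)"
    using good_descent[OF good_ConsD[OF v(1)] i desc(2)[folded v(4)]] by metis
  have "z \<in> lists {1..<l}" using good_lists[OF z(1)] by simp
  then have "tl_cong l (i # m # i # z) 0 (i # z)" using im i m by (intro tl_cong_braid) auto
  then have "tl_cong l (i # u) 0 (i # z)"
    using tl_cong_Cons[OF v(2) i] tl_cong_Cons[OF tl_cong_Cons[OF z(2) m] i] by (meson tl_cong_trans0)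
  then show ?thesis using v(3) z(3) by force
qed

text \<open>The letter \<open>m\<close> of \<open>u\<close> commutes with \<open>i\<close>, so it is
  pulled out in front and the shortening takes place in the rest of the word.\<close>

lemma tl_cong_shorten_far:
  assumes u: "good l u" and i: "i \<in> {1..<l}" and m: "m \<in> {1..<l}" and im: "i + 1 < m \<or> m + 1 < i"
    and desc: "pos_perm u (m + 1) < pos_perm u m"
    and shorten: "\<And>v. good l v \<Longrightarrow> pos_perm v = pos_perm u \<circ> adj_swap m \<Longrightarrow> length v < length u \<Longrightarrow>
      \<exists>n z. tl_cong l (i # v) n z \<and> length z \<le> length v"
  shows "\<exists>n v. tl_cong l (i # u) n v \<and> length v \<le> length u"
proof -
  obtain v where v: "good l (m # v)" "tl_cong l u 0 (m # v)" "length u = Suc (length v)"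
      "pos_perm v = pos_perm u \<circ> adj_swap m"
    using good_descent[OF u m desc] by metis
  obtain n z where z: "tl_cong l (i # v) n z" "length z \<le> length v"
    using shorten[OF good_ConsD[OF v(1)] v(4)] v(3) by auto
  have "tl_cong l (i # m # v) 0 (m # i # v)"
    using im good_lists[OF v(1)] by (intro tl_cong_commute i m) auto
  then have "tl_cong l (i # u) n (m # z)"
    using tl_cong_Cons[OF v(2) i] tl_cong_Cons[OF z(1) m] by (meson tl_cong_trans0)
  then show ?thesis using v(3) z(2) by force
qed

text \<open>A 321-pattern created by \<open>s\<^sub>i\<close> uses the positions \<open>i\<close>, \<open>i + 1\<close> and a third position \<open>k\<close>;
  commuting letters past \<open>i\<close> moves \<open>k\<close> next to them, where a braid relation shortens the word.\<close>

lemma tl_cong_shorten_left: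
  assumes "good l u" "i \<in> {1..<l}" "pos_perm u i < pos_perm u (i + 1)"
    and "1 \<le> k" "k < i" "pos_perm u (i + 1) < pos_perm u k"
  shows "\<exists>n v. tl_cong l (i # u) n v \<and> length v \<le> length u"
  using assms
proof (induction "length u" arbitrary: u k rule: less_induct)
  case less
  let ?p = "pos_perm u"
  let ?K = "{k. 1 \<le> k \<and> k < i \<and> ?p (i + 1) < ?p k}"
  \<comment> \<open>The rightmost larger entry: the entry after it does not exceed
    \<open>?p (i + 1)\<close>, so \<open>m\<close> is a descent, and swapping there moves the large
    entry one step towards \<open>i\<close>.\<close>
  define m where "m = Max ?K"
  have fin: "finite ?K" by simp
  have "m \<in> ?K" unfolding m_def using less.prems fin by (intro Max_in) auto
  then have m: "1 \<le> m" "m < i" "?p (i + 1) < ?p m" by auto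
  have ml: "m \<in> {1..<l}" using m less.prems by auto
  show ?case
  proof (cases "m + 1 = i")
    case True
    then show ?thesis
      using m less.prems by (intro tl_cong_shorten_adjacent[OF less.prems(1,2) ml]) (auto simp: transpose_def)
  next
    case False
    then have far: "m + 1 < i" using m by simp
    have "m + 1 \<notin> ?K" using Max_ge[OF fin, of "m + 1"] unfolding m_def[symmetric] by linarith
    then have "?p (m + 1) < ?p m" using far m by auto
    moreover have "i + 1 < m \<or> m + 1 < i" using far by simp
    ultimately show ?thesis
    proof (intro tl_cong_shorten_far[OF less.prems(1,2) ml])
      fix v assume v: "good l v" "pos_perm v = ?p \<circ> adj_swap m" "length v < length u"
      have "pos_perm v i = ?p i" "pos_perm v (i + 1) = ?p (i + 1)" "pos_perm v (m + 1) = ?p m"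
        unfolding v(2) using far by (auto simp: transpose_def)
      then show "\<exists>n z. tl_cong l (i # v) n z \<and> length z \<le> length v"
        using less.hyps[of v "m + 1"] v less.prems(2,3) m far by auto
    qed
  qed
qed

lemma tl_cong_shorten_right:
  assumes "good l u" "i \<in> {1..<l}" "pos_perm u i < pos_perm u (i + 1)"
    and "i + 1 < k" "k \<le> l" "pos_perm u k < pos_perm u i"
  shows "\<exists>n v. tl_cong l (i # u) n v \<and> length v \<le> length u"
  using assms
proof (induction "length u" arbitrary: u k rule: less_induct)
  case less
  let ?p = "pos_perm u"
  let ?K = "{k. i + 1 < k \<and> k \<le> l \<and> ?p k < ?p i}"
  \<comment> \<open>The entry at \<open>Min ?K\<close> is to move one step left; the letter doing so
    is the left one of the two positions, hence the subtraction.\<close>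
  define m where "m = Min ?K - 1"
  have fin: "finite ?K" by simp
  have "Min ?K \<in> ?K" using less.prems fin by (intro Min_in) auto
  then have m1: "m + 1 = Min ?K" and m: "i < m" "m + 1 \<le> l" "?p (m + 1) < ?p i"
    unfolding m_def by auto
  have ml: "m \<in> {1..<l}" using m less.prems by auto
  show ?case
  proof (cases "m = i + 1")
    case True
    then show ?thesis
      using m less.prems by (intro tl_cong_shorten_adjacent[OF less.prems(1,2) ml]) (auto simp: transpose_def)
  next
    case False
    then have far: "i + 1 < m" using m by simp
    have "m \<notin> ?K" using Min_le[OF fin, of m] unfolding m1[symmetric] by linarith
    then have "?p (m + 1) < ?p m" using far m by auto
    moreover have "i + 1 < m \<or> m + 1 < i" using far by simp
    ultimately show ?thesis
    proof (intro tl_cong_shorten_far[OF less.prems(1,2) ml])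
      fix v assume v: "good l v" "pos_perm v = ?p \<circ> adj_swap m" "length v < length u"
      have "pos_perm v i = ?p i" "pos_perm v (i + 1) = ?p (i + 1)" "pos_perm v m = ?p (m + 1)"
        unfolding v(2) using far by (auto simp: transpose_def)
      then show "\<exists>n z. tl_cong l (i # v) n z \<and> length z \<le> length v"
        using less.hyps[of v m] v less.prems(2,3) m far by auto
    qed
  qed
qed

text \<open>At an ascent the word stays reduced, so only a new 321-pattern can spoil it, and then
  the word shortens. At a descent \<open>i\<close> can be brought to the front of \<open>u\<close>,
  and the square rule contracts the two copies.\<close>

lemma tl_cong_Cons_good:
  assumes "good l u" "i \<in> {1..<l}"
  shows "good l (i # u) \<or> (\<exists>n v. tl_cong l (i # u) n v \<and> length v \<le> length u)"
proof (cases "pos_perm u i < pos_perm u (i + 1)")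
  case True
  have red: "reduced l (i # u)" using assms True by (intro reduced_ConsI) (auto simp: good_def)
  show ?thesis
  proof (cases "avoids321 l (pos_perm u \<circ> adj_swap i)")
    case True
    then show ?thesis using red by (simp add: good_def)
  next
    case False
    then show ?thesis using not_avoids321_swap[of i l "pos_perm u"] assms True
        tl_cong_shorten_left[OF assms True] tl_cong_shorten_right[OF assms True]
      by (auto simp: good_def)
  qed
next
  case False
  have "pos_perm u i \<noteq> pos_perm u (i + 1)"
    using permutes_inj[OF pos_perm_permutes[OF good_lists[OF assms(1)]]] by (simp add: inj_eq)
  then have "pos_perm u (i + 1) < pos_perm u i" using False by linarith
  then obtain v where v: "good l (i # v)" "tl_cong l u 0 (i # v)" "length u = Suc (length v)"
    using good_descent[OF assms] by blast
  have "tl_cong l (i # i # v) 1 (i # v)" using good_lists[OF v(1)] by (intro tl_cong_square) auto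
  then have "tl_cong l (i # u) 1 (i # v)"
    using tl_cong_Cons[OF v(2) assms(2)] by (meson tl_cong_trans0)
  then show ?thesis using v(3) by force
qed

text \<open>Shortening may yield a word that is not good, which has to be rewritten again; hence the
  induction on length instead of on the structure of the word.\<close>

lemma tl_cong_exists_good:
  assumes "is \<in> lists {1..<l}"
  shows "\<exists>n js. good l js \<and> tl_cong l is n js \<and> length js \<le> length is"
  using assms
proof (induction "length is" arbitrary: "is" rule: less_induct)
  case less
  show ?case
  proof (cases "is")
    case Nil
    then have "good l is" by (auto simp: good_def reduced_def inversions_id avoids321_def)
    then show ?thesis using less.prems by (blast intro: tl_cong_refl)
  next
    case (Cons i u)
    then have i: "i \<in> {1..<l}" using less.prems by auto
    obtain m u' where u': "good l u'" "tl_cong l u m u'" "length u' \<le> length u"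
      using less.hyps[of u] less.prems Cons by auto
    have c: "tl_cong l is m (i # u')" using tl_cong_Cons[OF u'(2) i] Cons by simp
    from tl_cong_Cons_good[OF u'(1) i] show ?thesis
    proof
      assume "good l (i # u')"
      then show ?thesis using c u'(3) Cons by force
    next
      assume "\<exists>n v. tl_cong l (i # u') n v \<and> length v \<le> length u'"
      then obtain n v where v: "tl_cong l (i # u') n v" "length v \<le> length u'" by blast
      then obtain k w where w: "good l w" "tl_cong l v k w" "length w \<le> length v"
        using less.hyps[of v] tl_cong_lists[OF v(1)] u'(3) Cons by auto
      have "tl_cong l is (m + n + k) w" using c v(1) w(2) by (meson tl_cong_trans)
      moreover have "length w \<le> length is" using w(3) v(2) u'(3) Cons by simp
      ultimately show ?thesis using w(1) by blast
    qed
  qed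
qed

lemma reduced_word_iff:
  "reduced_word l w is \<longleftrightarrow> reduced l is \<and> word_perm is = w"
proof
  assume r: "reduced_word l w is"
  then have "is": "is \<in> lists {1..<l}" "word_perm is = w" by (auto simp: reduced_word_def)
  obtain js where js: "reduced l js" "pos_perm js = pos_perm is"
    using reduced_exists[OF pos_perm_permutes[OF "is"(1)]] by blast
  then have jl: "js \<in> lists {1..<l}" by (simp add: reduced_def)
  have "word_perm js = w"
    using word_perm_eq_inv[OF jl] word_perm_eq_inv[OF "is"(1)] js(2) "is"(2) by simp
  then have "length is \<le> length js" using r jl by (auto simp: reduced_word_def)
  then have "length is = card (inversions l (pos_perm is))"
    using js card_inversions_le_length[OF "is"(1)] by (simp add: reduced_def)
  then show "reduced l is \<and> word_perm is = w" using "is" by (simp add: reduced_def)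
next
  assume r: "reduced l is \<and> word_perm is = w"
  then have "length is \<le> length js" if "js \<in> lists {1..<l}" "word_perm js = w" for js
    using card_inversions_le_length[OF that(1)] inv_word_perm[OF that(1)] inv_word_perm[of "is" l] that(2)
    by (auto simp: reduced_def)
  then show "reduced_word l w is" using r by (auto simp: reduced_word_def reduced_def)
qed

lemma red_word:
  assumes "w permutes {1..l}"
  shows "reduced l (red_word l w)" "word_perm (red_word l w) = w" "red_word l w \<in> lists {1..<l}"
proof -
  obtain "is" where "is": "reduced l is" "pos_perm is = inv' w"
    using reduced_exists[OF permutes_inv[OF assms]] by blast
  then have "word_perm is = inv' (inv' w)"
    using word_perm_eq_inv[of "is" l] by (simp add: reduced_def)
  then have "word_perm is = w" unfolding permutes_inv_inv[OF assms] .
  then have "reduced_word l w is" using "is" by (simp add: reduced_word_iff)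
  then have "reduced_word l w (red_word l w)" unfolding red_word_def by (rule someI)
  then show "reduced l (red_word l w)" "word_perm (red_word l w) = w" "red_word l w \<in> lists {1..<l}"
    by (auto simp: reduced_word_iff reduced_def)
qed

lemma good_red_word: "w \<in> avoiding321 l \<Longrightarrow> good l (red_word l w)"
  using red_word[of w l] inv_word_perm[of "red_word l w" l] avoids321_inv[of w l]
  by (simp add: good_def avoiding321_iff)

lemma tl_cong_red_word:
  assumes "is \<in> lists {1..<l}"
  obtains n w where "w \<in> avoiding321 l" "tl_cong l is n (red_word l w)"
proof -
  obtain n js where js: "good l js" "tl_cong l is n js"
    using tl_cong_exists_good[OF assms] by blast
  let ?w = "word_perm js"
  have jl: "js \<in> lists {1..<l}" using good_lists[OF js(1)] .
  have w: "?w permutes {1..l}" using word_perm_permutes[OF jl] .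
  have av: "?w \<in> avoiding321 l" using avoids321_inv[OF pos_perm_permutes[OF jl]] js(1) w
    unfolding word_perm_eq_inv[OF jl] by (simp add: avoiding321_iff good_def)
  \<comment> \<open>The chosen reduced word of \<open>?w\<close> may differ from \<open>js\<close>,
    but commutations lead from one to the other.\<close>
  have "tl_cong l js 0 (red_word l ?w)"
    using tl_cong_good[OF js(1) good_red_word[OF av]] inv_word_perm[OF jl]
      inv_word_perm[OF red_word(3)[OF w]] red_word(2)[OF w] by simp
  then have "tl_cong l is n (red_word l ?w)" using tl_cong_trans[OF js(2)] by fastforce
  with av that show thesis by blast
qed

section \<open>Lexicographic order and the leading term of a word\<close>

lemma less_fun_swap:
  fixes v :: "nat \<Rightarrow> nat"
  assumes v: "v permutes {1..l}" and asc: "inv' v i < inv' v (i + 1)"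
  shows "less_fun v (adj_swap i \<circ> v)"
proof (rule less_funI, intro exI conjI allI impI)
  note inv = permutes_inverses[OF v]
  show "v (inv' v i) < (adj_swap i \<circ> v) (inv' v i)" by (simp add: inv)
  fix k assume "k < inv' v i"
  then have "v k \<noteq> i" "v k \<noteq> i + 1" using inv(2)[of k] asc by auto
  then show "v k = (adj_swap i \<circ> v) k" by (simp add: transpose_def)
qed

text \<open>The order could be reversed only if \<open>u\<close> and \<open>v\<close> first differ
  by \<open>u k = i\<close> and \<open>v k = i + 1\<close>. But then \<open>v\<close> takes the
  value \<open>i\<close> earlier, where \<open>u\<close> agrees with it, so \<open>u\<close> would
  take this value twice.\<close>

lemma less_fun_swap_mono:
  fixes u v :: "nat \<Rightarrow> nat"
  assumes u: "u permutes {1..l}" and v: "v permutes {1..l}" and asc: "inv' v i < inv' v (i + 1)"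
    and less: "less_fun u v"
  shows "less_fun (adj_swap i \<circ> u) (adj_swap i \<circ> v)"
proof -
  obtain k where k: "u k < v k" "\<And>k'. k' < k \<Longrightarrow> u k' = v k'"
    using less by (blast elim!: less_funE)
  have "\<not> (u k = i \<and> v k = i + 1)"
  proof
    assume *: "u k = i \<and> v k = i + 1"
    then have "inv' v (i + 1) = k" using permutes_inverses(2)[OF v, of k] by simp
    then have "inv' v i < k" using asc by simp
    then have "u (inv' v i) = u k" using k(2) * permutes_inverses[OF v] by simp
    then show False using permutes_inj[OF u] \<open>inv' v i < k\<close> by (simp add: inj_eq)
  qed
  then have "adj_swap i (u k) < adj_swap i (v k)" using k(1) by (auto simp: transpose_def)
  then show ?thesis using k(2) by (intro less_funI) auto
qed

text \<open>Integral combinations of the \<open>perm_act u F\<close> with \<open>u\<close>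
  lexicographically below \<open>w\<close>: zero and closure under differences give an additive
  group.\<close>

inductive_set lower :: "nat \<Rightarrow> polyfun \<Rightarrow> (nat \<Rightarrow> nat) \<Rightarrow> polyfun set"
  for l F w where
  lower_perm: "u permutes {1..l} \<Longrightarrow> less_fun u w \<Longrightarrow> perm_act u F \<in> lower l F w"
| lower_zero: "(\<lambda>_. 0) \<in> lower l F w"
| lower_diff: "g \<in> lower l F w \<Longrightarrow> h \<in> lower l F w \<Longrightarrow> (\<lambda>a. g a - h a) \<in> lower l F w"

lemma lower_mono: "g \<in> lower l F v \<Longrightarrow> less_fun v w \<Longrightarrow> g \<in> lower l F w"
  by (induction rule: lower.induct) (auto intro: lower.intros less_fun_trans)

lemma lower_swap:
  assumes "g \<in> lower l F v" "v permutes {1..l}" "inv' v i < inv' v (i + 1)" "i \<in> {1..<l}"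
  shows "perm_act (adj_swap i) g \<in> lower l F (adj_swap i \<circ> v)"
  using assms(1)
proof (induction rule: lower.induct)
  case (lower_perm u)
  then show ?case unfolding perm_act_comp[symmetric] using assms
    by (intro lower.lower_perm less_fun_swap_mono permutes_compose permutes_swap_id) auto
next
  case lower_zero
  then show ?case by (simp add: perm_act_def lower.lower_zero)
next
  case (lower_diff g h)
  from lower.lower_diff[OF lower_diff.IH] show ?case by (simp add: perm_act_def)
qed

text \<open>Expanding \<open>t\<^sub>i = s\<^sub>i - 1\<close> along a reduced word of \<open>w\<close>, all permutations other than \<open>w\<close> that
  occur are lexicographically smaller.\<close>

lemma word_act_reduced:
  assumes "reduced l is"
  shows "(\<lambda>a. word_act is F a - perm_act (word_perm is) F a) \<in> lower l F (word_perm is)"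
  using assms
proof (induction "is")
  case Nil
  then show ?case using lower_zero by (simp add: perm_act_def comp_def)
next
  case (Cons i "is")
  let ?s = "adj_swap i" and ?v = "word_perm is"
  note red = reduced_ConsD[OF Cons.prems]
  have "is": "is \<in> lists {1..<l}" using red(1) by (simp add: reduced_def)
  have v: "?v permutes {1..l}" using word_perm_permutes[OF "is"] .
  have asc: "inv' ?v i < inv' ?v (i + 1)" using red(2) inv_word_perm[OF "is"] by simp
  note less = less_fun_swap[OF v asc]
  define r where "r = (\<lambda>a. word_act is F a - perm_act ?v F a)"
  have r: "r \<in> lower l F ?v" using Cons.IH[OF red(1)] by (simp add: r_def)
  \<comment> \<open>Applying s_i - 1 to v F + r gives s_i v F and the remainder s_i r - v F - r, all
    of whose parts are lower.\<close>
  have "(\<lambda>a. (perm_act ?s r a - perm_act ?v F a) - r a) \<in> lower l F (?s \<circ> ?v)"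
    by (intro lower_diff lower_swap[OF r v asc red(3)] lower_perm[OF v less] lower_mono[OF r less])
  moreover have "(\<lambda>a. (perm_act ?s r a - perm_act ?v F a) - r a) =
      (\<lambda>a. word_act (i # is) F a - perm_act (word_perm (i # is)) F a)"
    by (simp add: r_def tl_op_def perm_act_def comp_assoc algebra_simps)
  ultimately show ?case by (simp only: word_perm_simps)
qed

section \<open>Reconnecting matchings\<close>

definition mate :: "nat set set \<Rightarrow> nat \<Rightarrow> nat" where
  "mate T p = (THE q. {p, q} \<in> T)"

lemma perfect_matching_iff:
  "perfect_matching A T \<longleftrightarrow>
     (\<forall>e\<in>T. \<exists>p q. e = {p, q} \<and> p \<noteq> q \<and> p \<in> A \<and> q \<in> A) \<and> (\<forall>p\<in>A. \<exists>!e. e \<in> T \<and> p \<in> e)"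
proof
  assume pm: "perfect_matching A T"
  then have part: "\<Union>T = A" "disjoint T" and card: "\<And>e. e \<in> T \<Longrightarrow> card e = 2"
    by (auto simp: perfect_matching_def partition_on_def)
  have "\<exists>p q. e = {p, q} \<and> p \<noteq> q \<and> p \<in> A \<and> q \<in> A" if e: "e \<in> T" for e
  proof -
    obtain p q where pq: "e = {p, q}" "p \<noteq> q" using card[OF e] unfolding card_2_iff by blast
    moreover have "e \<subseteq> A" using part(1) e by blast
    ultimately show ?thesis by blast
  qed
  moreover have "\<exists>!e. e \<in> T \<and> p \<in> e" if p: "p \<in> A" for p
  proof -
    obtain e where e: "e \<in> T" "p \<in> e" using p part(1) by blast
    moreover have "e' = e" if "e' \<in> T \<and> p \<in> e'" for e'
      using disjointD[OF part(2), of e' e] e that by blast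
    ultimately show ?thesis by blast
  qed
  ultimately show "(\<forall>e\<in>T. \<exists>p q. e = {p, q} \<and> p \<noteq> q \<and> p \<in> A \<and> q \<in> A) \<and>
      (\<forall>p\<in>A. \<exists>!e. e \<in> T \<and> p \<in> e)"
    by blast
next
  assume *: "(\<forall>e\<in>T. \<exists>p q. e = {p, q} \<and> p \<noteq> q \<and> p \<in> A \<and> q \<in> A) \<and> (\<forall>p\<in>A. \<exists>!e. e \<in> T \<and> p \<in> e)"
  have "partition_on A T"
  proof (rule partition_onI)
    have sub: "e \<subseteq> A" if "e \<in> T" for e using *[THEN conjunct1, rule_format, OF that] by blast
    show "\<Union>T = A"
      using sub *[THEN conjunct2, rule_format] by (metis Sup_least UnionI subsetI subset_antisym)
    show "disjnt e e'" if e: "e \<in> T" "e' \<in> T" "e \<noteq> e'" for e e'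
    proof -
      have "p \<notin> e'" if p: "p \<in> e" for p
      proof
        assume "p \<in> e'"
        moreover have "p \<in> A" using p sub[OF e(1)] by blast
        ultimately show False using *[THEN conjunct2, rule_format, of p] p e by blast
      qed
      then show ?thesis by (auto simp: disjnt_def)
    qed
    show "{} \<notin> T" using *[THEN conjunct1, rule_format, of "{}"] by blast
  qed
  moreover have "card e = 2" if "e \<in> T" for e
    using *[THEN conjunct1, rule_format, OF that] unfolding card_2_iff by metis
  ultimately show "perfect_matching A T" by (simp add: perfect_matching_def)
qed

context
  fixes A T assumes pm: "perfect_matching A T"
begin

lemma matching_edgeE:
  assumes "e \<in> T"
  obtains p q where "e = {p, q}" "p \<noteq> q" "p \<in> A" "q \<in> A"
  using pm[unfolded perfect_matching_iff, THEN conjunct1, rule_format, OF assms] by blast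

lemma edge_unique:
  assumes "e \<in> T" "e' \<in> T" "p \<in> e" "p \<in> e'"
  shows "e = e'"
proof -
  have "p \<in> A" using matching_edgeE[OF assms(1)] assms(3) by blast
  then have "\<exists>!e. e \<in> T \<and> p \<in> e"
    by (rule pm[unfolded perfect_matching_iff, THEN conjunct2, rule_format])
  then show ?thesis using assms by blast
qed

lemma edge_props:
  assumes "{p, q} \<in> T"
  shows "p \<noteq> q" "p \<in> A" "q \<in> A"
proof -
  obtain r s where "{p, q} = {r, s}" "r \<noteq> s" "r \<in> A" "s \<in> A"
    using matching_edgeE[OF assms] by blast
  then show "p \<noteq> q" "p \<in> A" "q \<in> A" by (auto simp: doubleton_eq_iff)
qed

lemma mate_eq:
  assumes "{p, q} \<in> T"
  shows "mate T p = q"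
  unfolding mate_def
proof (rule the_equality)
  fix r assume "{p, r} \<in> T"
  then have "{p, r} = {p, q}" using edge_unique[of "{p, r}" "{p, q}" p] assms by simp
  then show "r = q" by (auto simp: doubleton_eq_iff)
qed (rule assms)

lemma mate:
  assumes "p \<in> A"
  shows "{p, mate T p} \<in> T" "mate T p \<noteq> p" "mate T p \<in> A" "mate T (mate T p) = p"
proof -
  have "\<exists>e. e \<in> T \<and> p \<in> e"
    using pm[unfolded perfect_matching_iff, THEN conjunct2, rule_format, OF assms] by (rule ex1_implies_ex)
  then obtain e where e: "e \<in> T" "p \<in> e" by blast
  obtain r s where rs: "e = {r, s}" using matching_edgeE[OF e(1)] by blast
  have "\<exists>q. {p, q} \<in> T"
  proof (cases "p = r")
    case False
    then have "{p, r} \<in> T" using e rs by (simp add: insert_commute)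
    then show ?thesis by blast
  qed (use e rs in blast)
  then obtain q where q: "{p, q} \<in> T" by blast
  then show *: "{p, mate T p} \<in> T" using mate_eq[OF q] by simp
  show "mate T p \<noteq> p" "mate T p \<in> A" using edge_props[OF *] by auto
  have "{mate T p, p} \<in> T" using * by (simp add: insert_commute)
  then show "mate T (mate T p) = p" by (rule mate_eq)
qed

lemma edge_iff: "{p, q} \<in> T \<longleftrightarrow> p \<in> A \<and> q = mate T p"
proof
  assume "{p, q} \<in> T"
  from mate_eq[OF this] edge_props[OF this] show "p \<in> A \<and> q = mate T p" by simp
qed (use mate(1) in simp)

lemma edge_eq:
  assumes "e \<in> T" "p \<in> e"
  shows "e = {p, mate T p}"
proof -
  obtain r s where "e = {r, s}" "r \<in> A" "s \<in> A" using matching_edgeE[OF assms(1)] by blast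
  then have "p \<in> A" using assms(2) by auto
  then show ?thesis using edge_unique[OF assms(1) mate(1) assms(2)] by simp
qed

lemma edge_cases_less:
  assumes "e \<in> T"
  obtains p q where "p \<in> A" "q \<in> A" "p < q" "e = {p, q}"
proof -
  obtain p q where pq: "e = {p, q}" "p \<noteq> q" "p \<in> A" "q \<in> A"
    using matching_edgeE[OF assms] by blast
  then consider "p < q" | "q < p" by linarith
  then show thesis
  proof cases
    case 1
    with pq that[of p q] show ?thesis by simp
  next
    case 2
    with pq that[of q p] show ?thesis by (simp add: insert_commute)
  qed
qed

lemma mate_inj:
  assumes "p \<in> A" "q \<in> A" "mate T p = mate T q"
  shows "p = q"
proof -
  have "p = mate T (mate T p)" by (rule mate(4)[OF assms(1), symmetric])
  also have "\<dots> = q" unfolding assms(3) by (rule mate(4)[OF assms(2)])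
  finally show ?thesis .
qed

end

lemma finite_matching:
  assumes "perfect_matching A T" "finite A"
  shows "finite T"
  using assms finite_elements unfolding perfect_matching_def by blast

text \<open>For \<open>q = p + 1\<close> this is what composition with the diagram of a generator
  does: an arc joins \<open>p\<close> and \<open>q\<close>, and their former mates become joined. If
  \<open>p\<close> and \<open>q\<close> were joined already, nothing changes.\<close>

definition reconnect :: "nat set set \<Rightarrow> nat \<Rightarrow> nat \<Rightarrow> nat set set" where
  "reconnect T p q = {{p, q}, {mate T p, mate T q}} \<union> {e \<in> T. p \<notin> e \<and> q \<notin> e}"

lemma perfect_matching_reconnect:
  assumes pm: "perfect_matching A T" and "p \<in> A" "q \<in> A" "p \<noteq> q"
  shows "perfect_matching A (reconnect T p q)"
proof -
  let ?x = "mate T p" and ?y = "mate T q"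
  note p = mate[OF pm \<open>p \<in> A\<close>] and q = mate[OF pm \<open>q \<in> A\<close>]
  have ne: "?x \<noteq> ?y" using mate_inj[OF pm] assms by blast
  show ?thesis unfolding perfect_matching_iff
  proof (intro conjI ballI)
    fix e assume "e \<in> reconnect T p q"
    then consider "e = {p, q}" | "e = {?x, ?y}" | "e \<in> T" unfolding reconnect_def by blast
    then show "\<exists>p q. e = {p, q} \<and> p \<noteq> q \<and> p \<in> A \<and> q \<in> A"
    proof cases
      case 3
      from matching_edgeE[OF pm this] show ?thesis by blast
    next
      case 1
      with assms(2-4) show ?thesis by blast
    next
      case 2
      with p(3) q(3) ne show ?thesis by blast
    qed
  next
    fix r assume r: "r \<in> A"
    show "\<exists>!e. e \<in> reconnect T p q \<and> r \<in> e"
    proof (cases "r \<in> {p, q, ?x, ?y}")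
      case False
      have "mate T r \<noteq> p" "mate T r \<noteq> q" using mate(4)[OF pm r] False by auto
      then have "{r, mate T r} \<in> reconnect T p q"
        using False mate(1)[OF pm r] by (auto simp: reconnect_def)
      moreover have "e = {r, mate T r}" if "e \<in> reconnect T p q \<and> r \<in> e" for e
      proof -
        have "e \<in> T" "r \<in> e" using that False by (auto simp: reconnect_def)
        then show ?thesis by (rule edge_eq[OF pm])
      qed
      ultimately show ?thesis by blast
    next
      case True
      have none: "r \<notin> e" if e: "e \<in> T" "p \<notin> e" "q \<notin> e" for e
      proof
        assume "r \<in> e"
        then have "e = {r, mate T r}" by (rule edge_eq[OF pm e(1)])
        then show False using True e(2,3) p(4) q(4) by auto
      qed
      show ?thesis
      proof (cases "r \<in> {p, q}")
        case True
        show ?thesis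
        proof (intro ex1I[of _ "{p, q}"])
          fix e assume "e \<in> reconnect T p q \<and> r \<in> e"
          then have "e = {p, q} \<or> (e = {?x, ?y} \<and> r \<in> {?x, ?y})" using none by (auto simp: reconnect_def)
          moreover have "r \<notin> {?x, ?y} \<or> {?x, ?y} = {p, q}" using True p(2,4) q(2,4) by auto
          ultimately show "e = {p, q}" by blast
        qed (use True in \<open>simp add: reconnect_def\<close>)
      next
        case False
        show ?thesis
        proof (intro ex1I[of _ "{?x, ?y}"])
          fix e assume "e \<in> reconnect T p q \<and> r \<in> e"
          then show "e = {?x, ?y}" using none False by (auto simp: reconnect_def)
        qed (use False True in \<open>simp add: reconnect_def\<close>)
      qed
    qed
  qed
qed

lemma reconnect_edge:
  assumes pm: "perfect_matching A T" and "{p, q} \<in> T"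
  shows "reconnect T p q = T"
proof -
  have m: "mate T p = q" "mate T q = p" using mate_eq[OF pm] assms(2) by (auto simp: insert_commute)
  have eq: "e = {p, q}" if "e \<in> T" "p \<in> e \<or> q \<in> e" for e
    using edge_unique[OF pm that(1) assms(2), of p] edge_unique[OF pm that(1) assms(2), of q] that(2) by auto
  have "{q, p} = {p, q}" by blast
  then have "reconnect T p q = {{p, q}} \<union> {e \<in> T. p \<notin> e \<and> q \<notin> e}" unfolding reconnect_def m by simp
  also have "\<dots> = T" using assms(2) eq by blast
  finally show ?thesis .
qed

text \<open>Edges are unordered pairs, so this form of the condition does not presuppose sorted
  endpoints.\<close>

definition crossing :: "nat \<Rightarrow> nat \<Rightarrow> nat \<Rightarrow> nat \<Rightarrow> bool" where
  "crossing p q r s \<longleftrightarrow> min p q < min r s \<and> min r s < max p q \<and> max p q < max r s \<or>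
     min r s < min p q \<and> min p q < max r s \<and> max r s < max p q"

lemma noncrossing_iff:
  "noncrossing T \<longleftrightarrow> (\<forall>p q r s. {p, q} \<in> T \<longrightarrow> {r, s} \<in> T \<longrightarrow> \<not> crossing p q r s)"
proof
  assume nc: "noncrossing T"
  have mm: "{min p q, max p q} = {p, q}" for p q :: nat by (auto simp: min_def max_def)
  show "\<forall>p q r s. {p, q} \<in> T \<longrightarrow> {r, s} \<in> T \<longrightarrow> \<not> crossing p q r s"
    using nc unfolding noncrossing_def crossing_def by (metis mm)
next
  assume *: "\<forall>p q r s. {p, q} \<in> T \<longrightarrow> {r, s} \<in> T \<longrightarrow> \<not> crossing p q r s"
  show "noncrossing T" unfolding noncrossing_def
  proof clarify
    fix a1 a2 b1 b2 assume "{a1, a2} \<in> T" "{b1, b2} \<in> T" "a1 < b1" "b1 < a2" "a2 < b2"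
    then show False using *[rule_format, of a1 a2 b1 b2] by (simp add: crossing_def)
  qed
qed

lemma crossing_iff:
  assumes "p \<notin> {r, s}" "q \<notin> {r, s}"
  shows "crossing p q r s \<longleftrightarrow> (min r s < p \<and> p < max r s) \<noteq> (min r s < q \<and> q < max r s)"
proof -
  have ne: "p \<noteq> r" "p \<noteq> s" "q \<noteq> r" "q \<noteq> s" using assms by auto
  consider "p \<le> q" "r \<le> s" | "p \<le> q" "s \<le> r" | "q \<le> p" "r \<le> s" | "q \<le> p" "s \<le> r" by linarith
  then show ?thesis
    using ne by cases (simp_all add: crossing_def min_absorb1 min_absorb2 max_absorb1 max_absorb2; linarith)+
qed

lemma crossing_commute:
  "crossing p q r s \<longleftrightarrow> crossing r s p q" "crossing p q r s \<longleftrightarrow> crossing q p r s"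
  unfolding crossing_def by (simp_all add: min.commute max.commute disj_commute)

text \<open>No point lies between \<open>i\<close> and \<open>i + 1\<close>, so any other edge
  encloses both of them or neither. As it crosses neither old edge, it also encloses both mates or
  neither, and so does not cross the edge joining them.\<close>

lemma noncrossing_reconnect:
  assumes pm: "perfect_matching A T" and nc: "noncrossing T" and iA: "i \<in> A" "i + 1 \<in> A"
  shows "noncrossing (reconnect T i (i + 1))"
proof -
  let ?x = "mate T i" and ?y = "mate T (i + 1)"
  note ncD = nc[unfolded noncrossing_iff, rule_format]
  have xy: "{i, ?x} \<in> T" "{i + 1, ?y} \<in> T" using mate(1)[OF pm] iA by auto
  have adj: "\<not> crossing i (i + 1) r s" for r s by (auto simp: crossing_def)
  have refl: "\<not> crossing p q p q" for p q by (simp add: crossing_def)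
  have old: "\<not> crossing ?x ?y r s" if rs: "{r, s} \<in> T" "i \<notin> {r, s}" "i + 1 \<notin> {r, s}" for r s
  proof -
    have "?x \<notin> {r, s}" using edge_unique[OF pm rs(1) xy(1), of ?x] rs(2) by blast
    moreover have "?y \<notin> {r, s}" using edge_unique[OF pm rs(1) xy(2), of ?y] rs(3) by blast
    moreover have "min r s < i \<and> i < max r s \<longleftrightarrow> min r s < i + 1 \<and> i + 1 < max r s"
      using rs(2,3) unfolding min_def max_def by auto
    ultimately show ?thesis
      using ncD[OF xy(1) rs(1)] ncD[OF xy(2) rs(1)] rs(2,3) by (simp add: crossing_iff)
  qed
  have eq: "crossing p q r s = crossing p' q' r s" if "{p, q} = {p', q'}" for p q p' q' r s
    using that crossing_commute(2)[of p q r s] by (auto simp: doubleton_eq_iff)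
  have eq2: "crossing p q r s = crossing p q r' s'" if "{r, s} = {r', s'}" for p q r s r' s'
    using eq[OF that, of p q] crossing_commute(1)[of p q] by simp
  show ?thesis unfolding noncrossing_iff
  proof (intro allI impI)
    fix p q r s assume pq: "{p, q} \<in> reconnect T i (i + 1)" and rs: "{r, s} \<in> reconnect T i (i + 1)"
    have cases: "{p, q} = {i, i + 1} \<or> {p, q} = {?x, ?y} \<or> {p, q} \<in> T \<and> i \<notin> {p, q} \<and> i + 1 \<notin> {p, q}"
      if "{p, q} \<in> reconnect T i (i + 1)" for p q
      using that unfolding reconnect_def by blast
    have cup: "\<not> crossing p q r s" if "{p, q} = {i, i + 1}" for p q r s
      using adj eq[OF that] by simp
    have new: "\<not> crossing p q r s" if "{p, q} = {?x, ?y}" "{r, s} \<in> T" "i \<notin> {r, s}" "i + 1 \<notin> {r, s}" for p q r s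
      using eq[OF that(1)] old[OF that(2-4)] by simp
    have new2: "\<not> crossing p q r s" if "{p, q} = {?x, ?y}" "{r, s} = {?x, ?y}" for p q r s
      using eq[OF that(1), of r s] eq2[OF that(2), of ?x ?y] refl by simp
    show "\<not> crossing p q r s"
      using cases[OF pq] cases[OF rs] cup new new2 ncD crossing_commute(1)[of p q r s] by metis
  qed
qed

lemma nc_matchings_reconnect:
  "T \<in> nc_matchings l \<Longrightarrow> i \<in> {1..<2 * l} \<Longrightarrow> reconnect T i (i + 1) \<in> nc_matchings l"
  unfolding nc_matchings_def
  by (auto intro!: perfect_matching_reconnect[of "{1..2 * l}", simplified]
      noncrossing_reconnect[of "{1..2 * l}", simplified])

lemma finite_nc_matchings: "finite (nc_matchings l)"
  by (rule finite_subset[of _ "Pow (Pow {1..2 * l})"])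
    (auto simp: nc_matchings_def perfect_matching_def partition_on_def)

text \<open>The ring is left open: over \<open>mpoly\<close> this is the matching polynomial as a
  function of its variables, over the complex numbers it is its value at a 0/1 point.\<close>

definition matching_fun :: "nat set set \<Rightarrow> (nat \<Rightarrow> 'a :: comm_ring_1) \<Rightarrow> 'a" where
  "matching_fun T a = (\<Prod>e\<in>T. a (Min e) - a (Max e))"

lemma matching_poly_eq: "matching_poly T = matching_fun T mvar"
  by (simp add: matching_poly_def matching_fun_def)

lemma Min_Max_pair:
  "p < q \<Longrightarrow> Min {p, q} = p" "p < q \<Longrightarrow> Max {p, q} = q"
  "q < p \<Longrightarrow> Min {p, q} = q" "q < p \<Longrightarrow> Max {p, q} = (p :: nat)"
  by auto

context
  fixes A :: "nat set" and T p q
  assumes fin: "finite A" and pm: "perfect_matching A T" and pq: "p \<in> A" "q \<in> A" "p \<noteq> q" "{p, q} \<notin> T"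
begin

lemma mate_distinct: "mate T p \<notin> {p, q}" "mate T q \<notin> {p, q}" "mate T p \<noteq> mate T q"
proof -
  have "mate T p \<noteq> q" using mate(1)[OF pm pq(1)] pq(4) by auto
  then show "mate T p \<notin> {p, q}" using mate(2)[OF pm pq(1)] by simp
  have "mate T q \<noteq> p" using mate(1)[OF pm pq(2)] pq(4) by (auto simp: insert_commute)
  then show "mate T q \<notin> {p, q}" using mate(2)[OF pm pq(2)] by simp
  show "mate T p \<noteq> mate T q" using mate_inj[OF pm pq(1,2)] pq(3) by blast
qed

lemma matching_split:
  "T = {{p, mate T p}, {q, mate T q}} \<union> {e \<in> T. p \<notin> e \<and> q \<notin> e}"
proof (intro equalityI subsetI)
  fix e assume e: "e \<in> T"
  show "e \<in> {{p, mate T p}, {q, mate T q}} \<union> {e \<in> T. p \<notin> e \<and> q \<notin> e}"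
    using edge_eq[OF pm e, of p] edge_eq[OF pm e, of q] e by blast
next
  fix e assume "e \<in> {{p, mate T p}, {q, mate T q}} \<union> {e \<in> T. p \<notin> e \<and> q \<notin> e}"
  then show "e \<in> T" using mate(1)[OF pm pq(1)] mate(1)[OF pm pq(2)] by blast
qed

lemma matching_fun_split:
  "matching_fun T a = (a (Min {p, mate T p}) - a (Max {p, mate T p})) *
     (a (Min {q, mate T q}) - a (Max {q, mate T q})) * matching_fun {e \<in> T. p \<notin> e \<and> q \<notin> e} a"
proof -
  let ?R = "{e \<in> T. p \<notin> e \<and> q \<notin> e}"
  have "{p, mate T p} \<noteq> {q, mate T q}" using mate_distinct pq(3) by (auto simp: doubleton_eq_iff)
  moreover have "finite ?R" using finite_matching[OF pm fin] by simp
  moreover have "matching_fun T a = matching_fun ({{p, mate T p}, {q, mate T q}} \<union> ?R) a"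
    using matching_split by simp
  ultimately show ?thesis by (simp add: matching_fun_def)
qed

lemma matching_fun_reconnect:
  "matching_fun (reconnect T p q) a = (a (Min {p, q}) - a (Max {p, q})) *
     (a (Min {mate T p, mate T q}) - a (Max {mate T p, mate T q})) *
     matching_fun {e \<in> T. p \<notin> e \<and> q \<notin> e} a"
proof -
  let ?R = "{e \<in> T. p \<notin> e \<and> q \<notin> e}"
  have "{p, q} \<noteq> {mate T p, mate T q}" using mate_distinct by (auto simp: doubleton_eq_iff)
  moreover have "finite {e \<in> T. p \<notin> e \<and> q \<notin> e}" using finite_matching[OF pm fin] by simp
  moreover have "{mate T p, mate T q} \<notin> T"
  proof
    assume "{mate T p, mate T q} \<in> T"
    then have "mate T q = mate T (mate T p)" unfolding edge_iff[OF pm] by blast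
    then show False using mate(4)[OF pm pq(1)] mate_distinct(2) by simp
  qed
  ultimately show ?thesis by (simp add: matching_fun_def reconnect_def)
qed

end

lemma matching_fun_cong:
  assumes "\<And>x e. e \<in> T \<Longrightarrow> x \<in> e \<Longrightarrow> a x = b x" "\<And>e. e \<in> T \<Longrightarrow> finite e \<and> e \<noteq> {}"
  shows "matching_fun T a = matching_fun T b"
  unfolding matching_fun_def using assms
  by (intro prod.cong refl arg_cong2[of _ _ _ _ minus]) (auto simp: Min_in Max_in)

lemma perfect_matching_edge_finite: "perfect_matching A T \<Longrightarrow> e \<in> T \<Longrightarrow> finite e \<and> e \<noteq> {}"
  by (elim matching_edgeE[of A T e]) auto

text \<open>If \<open>i\<close> and \<open>i + 1\<close> are joined, the swap negates the factor x_i
  - x_(i+1). Otherwise the difference is a three-term Pluecker relation, and noncrossingness fixes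
  the order of the four endpoints and with it the sign.\<close>

lemma tl_op_matching_fun:
  assumes fin: "finite A" and pm: "perfect_matching A T" and nc: "noncrossing T" and iA: "i \<in> A" "i + 1 \<in> A"
  shows "tl_op i (matching_fun T) =
    (if {i, i + 1} \<in> T then \<lambda>a. - 2 * matching_fun T a else matching_fun (reconnect T i (i + 1)))"
proof (cases "{i, i + 1} \<in> T")
  case True
  have "T = insert {i, i + 1} (T - {{i, i + 1}})" using True by blast
  then have split: "matching_fun T b = (b i - b (i + 1)) * matching_fun (T - {{i, i + 1}}) b" for b :: "nat \<Rightarrow> mpoly"
    unfolding matching_fun_def using finite_matching[OF pm fin]
    by (subst \<open>T = _\<close>, subst prod.insert) (auto simp: Min_Max_pair)
  have "matching_fun (T - {{i, i + 1}}) (a \<circ> adj_swap i) = matching_fun (T - {{i, i + 1}}) a"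
    for a :: "nat \<Rightarrow> mpoly"
  proof (rule matching_fun_cong)
    fix x e assume e: "e \<in> T - {{i, i + 1}}" "x \<in> e"
    have "i \<notin> e" "i + 1 \<notin> e"
      using edge_unique[OF pm _ True, of e i] edge_unique[OF pm _ True, of e "i + 1"] e by auto
    then have "x \<noteq> i" "x \<noteq> i + 1" using e(2) by blast+
    then show "(a \<circ> adj_swap i) x = a x" by simp
  qed (use perfect_matching_edge_finite[OF pm] in auto)
  then show ?thesis using True by (auto simp: tl_op_def split algebra_simps)
next
  case False
  let ?x = "mate T i" and ?y = "mate T (i + 1)" and ?R = "{e \<in> T. i \<notin> e \<and> i + 1 \<notin> e}"
  have R: "matching_fun ?R (a \<circ> adj_swap i) = matching_fun ?R a" for a :: "nat \<Rightarrow> mpoly"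
  proof (rule matching_fun_cong)
    fix x e assume e: "e \<in> ?R" "x \<in> e"
    then have "x \<noteq> i" "x \<noteq> i + 1" by blast+
    then show "(a \<circ> adj_swap i) x = a x" by simp
  qed (use perfect_matching_edge_finite[OF pm] in auto)
  have ne: "i \<noteq> i + 1" by simp
  note d = mate_distinct[OF fin pm iA ne False]
  note split = matching_fun_split[OF fin pm iA ne False] matching_fun_reconnect[OF fin pm iA ne False]
  have nxy: "\<not> crossing i ?x (i + 1) ?y"
    using nc mate(1)[OF pm] iA unfolding noncrossing_iff by blast
  have sx: "(a \<circ> adj_swap i) ?x = a ?x" "(a \<circ> adj_swap i) ?y = a ?y"
    "(a \<circ> adj_swap i) i = a (i + 1)" "(a \<circ> adj_swap i) (i + 1) = a i" for a :: "nat \<Rightarrow> mpoly"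
    using d by simp_all
  \<comment> \<open>The mates lie both to the right, on opposite sides, or both to the left.
    Noncrossingness gives the nesting within a side and excludes the remaining arrangement.\<close>
  consider "?x > i + 1" "?y > i + 1" "?y < ?x" | "?x < i" "?y > i + 1" | "?x < i" "?y < i" "?y < ?x"
  proof -
    have ne: "?x \<noteq> i" "?x \<noteq> i + 1" "?y \<noteq> i" "?y \<noteq> i + 1" "?x \<noteq> ?y" using d by auto
    have iff: "(min (i + 1) ?y < i \<and> i < max (i + 1) ?y) = (min (i + 1) ?y < ?x \<and> ?x < max (i + 1) ?y)"
      using nxy crossing_iff[of i "i + 1" ?y ?x] ne by simp
    show thesis
    proof (cases "?y < i")
      case True
      then show ?thesis using iff ne that(3) by (simp add: min_def max_def split: if_splits)
    next
      case False
      then have "?y > i + 1" using ne by linarith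
      then show ?thesis using iff ne that(1,2) by (cases "?x < i") (simp_all add: min_def max_def)
    qed
  qed
  then have "matching_fun T (a \<circ> adj_swap i) - matching_fun T a =
      matching_fun (reconnect T i (i + 1)) a" for a :: "nat \<Rightarrow> mpoly"
  proof cases
    case 1
    then have "i < ?x" "i + 1 < ?y" "i < i + 1" by linarith+
    with 1 show ?thesis unfolding split R by (simp only: Min_Max_pair sx) (simp only: algebra_simps)
  next
    case 2
    then have "?x < i" "i + 1 < ?y" "?x < ?y" "i < i + 1" by linarith+
    then show ?thesis unfolding split R by (simp only: Min_Max_pair sx) (simp only: algebra_simps)
  next
    case 3
    then have "?x < i" "?y < i + 1" "?y < ?x" "i < i + 1" by linarith+
    then show ?thesis unfolding split R by (simp only: Min_Max_pair sx) (simp only: algebra_simps)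
  qed
  then show ?thesis using False by (simp add: tl_op_def)
qed

section \<open>Linear independence of the noncrossing polynomials\<close>

text \<open>Substitution of 1 for the variables in \<open>S\<close> and 0 for the others: a monomial
  survives iff all its variables lie in \<open>S\<close>.\<close>

definition eval01 :: "nat set \<Rightarrow> mpoly \<Rightarrow> complex" where
  "eval01 S p = (\<Sum>m | m \<in> Poly_Mapping.keys p \<and> Poly_Mapping.keys m \<subseteq> S. Poly_Mapping.lookup p m)"

lemma eval01_superset:
  assumes "finite M" "Poly_Mapping.keys p \<subseteq> M"
  shows "eval01 S p = (\<Sum>m\<in>M. if Poly_Mapping.keys m \<subseteq> S then Poly_Mapping.lookup p m else 0)"
proof -
  have "eval01 S p = (\<Sum>m\<in>Poly_Mapping.keys p. if Poly_Mapping.keys m \<subseteq> S then Poly_Mapping.lookup p m else 0)"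
    unfolding eval01_def by (subst sum.inter_filter[symmetric]) auto
  also have "\<dots> = (\<Sum>m\<in>M. if Poly_Mapping.keys m \<subseteq> S then Poly_Mapping.lookup p m else 0)"
    using assms by (intro sum.mono_neutral_left) (auto simp: in_keys_iff)
  finally show ?thesis .
qed

lemma eval01_add: "eval01 S (p + q) = eval01 S p + eval01 S q"
  using keys_add[of p q]
  by (subst (1 2 3) eval01_superset[of "Poly_Mapping.keys p \<union> Poly_Mapping.keys q"])
    (auto simp: lookup_add sum.distrib[symmetric] intro!: sum.cong)

lemma eval01_zero [simp]: "eval01 S 0 = 0"
  by (simp add: eval01_def)

lemma eval01_sum: "eval01 S (sum f X) = (\<Sum>x\<in>X. eval01 S (f x))"
  by (induction X rule: infinite_finite_induct) (auto simp: eval01_add)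

lemma eval01_diff: "eval01 S (p - q) = eval01 S p - eval01 S q"
  using eval01_add[of S "p - q" q] by simp

lemma eval01_single: "eval01 S (Poly_Mapping.single m c) = (if Poly_Mapping.keys m \<subseteq> S then c else 0)"
  by (subst eval01_superset[of "{m}"]) auto

lemma poly_mapping_sum_single: "p = (\<Sum>m\<in>Poly_Mapping.keys p. Poly_Mapping.single m (Poly_Mapping.lookup p m))"
proof (rule poly_mapping_eqI)
  fix k
  have "Poly_Mapping.lookup (\<Sum>m\<in>Poly_Mapping.keys p. Poly_Mapping.single m (Poly_Mapping.lookup p m)) k =
      (\<Sum>m\<in>Poly_Mapping.keys p. if k = m then Poly_Mapping.lookup p m else 0)"
    by (auto simp: lookup_sum lookup_single when_def intro!: sum.cong)
  also have "\<dots> = Poly_Mapping.lookup p k" by (auto simp: in_keys_iff)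
  finally show "Poly_Mapping.lookup p k = Poly_Mapping.lookup (\<Sum>m\<in>Poly_Mapping.keys p. Poly_Mapping.single m (Poly_Mapping.lookup p m)) k" by simp
qed

lemma keys_plus_nat: "Poly_Mapping.keys (m + n :: nat \<Rightarrow>\<^sub>0 nat) = Poly_Mapping.keys m \<union> Poly_Mapping.keys n"
  by (auto simp: in_keys_iff lookup_add)

text \<open>Exponents are natural numbers, so the variables of a product of monomials are those of
  both factors, and it survives iff both factors do.\<close>

lemma eval01_mult: "eval01 S (p * q) = eval01 S p * eval01 S q"
proof -
  have "eval01 S (p * q) =
      eval01 S ((\<Sum>m\<in>Poly_Mapping.keys p. Poly_Mapping.single m (Poly_Mapping.lookup p m)) * (\<Sum>n\<in>Poly_Mapping.keys q. Poly_Mapping.single n (Poly_Mapping.lookup q n)))"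
    using poly_mapping_sum_single by metis
  also have "\<dots> = (\<Sum>m\<in>Poly_Mapping.keys p. \<Sum>n\<in>Poly_Mapping.keys q.
      (if Poly_Mapping.keys m \<subseteq> S then Poly_Mapping.lookup p m else 0) * (if Poly_Mapping.keys n \<subseteq> S then Poly_Mapping.lookup q n else 0))"
    by (auto simp: sum_product eval01_sum mult_single eval01_single keys_plus_nat intro!: sum.cong)
  also have "\<dots> = eval01 S p * eval01 S q"
    by (simp add: sum_product[symmetric] eval01_superset[of "Poly_Mapping.keys p" p] eval01_superset[of "Poly_Mapping.keys q" q])
  finally show ?thesis .
qed

lemma eval01_cst [simp]: "eval01 S (cst c) = c"
  by (simp add: cst_def eval01_single)

lemma eval01_mvar: "eval01 S (mvar i) = of_bool (i \<in> S)"
  by (simp add: mvar_def eval01_single)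

lemma eval01_prod: "eval01 S (prod f X) = (\<Prod>x\<in>X. eval01 S (f x))"
  using eval01_cst[of S 1]
  by (induction X rule: infinite_finite_induct) (auto simp: eval01_mult cst_simps)

lemma eval01_matching_fun:
  "eval01 S (matching_fun T (\<lambda>i. mvar (f i))) = matching_fun T (\<lambda>i. of_bool (f i \<in> S))"
  by (simp add: matching_fun_def eval01_prod eval01_diff eval01_mvar)

text \<open>Like the opening brackets of a bracket word, the left endpoints determine a noncrossing
  matching.\<close>

definition openers :: "nat set set \<Rightarrow> nat set" where
  "openers T = Min ` T"

text \<open>Equal openers make the mate of \<open>a\<close> in \<open>U\<close> lie to its right and
  the mate of \<open>b\<close> to its left. If one of these edges is shorter than
  \<open>{a, b}\<close>, it belongs to \<open>T\<close> by induction with the two matchings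
  exchanged, a contradiction; if both are longer, they cross.\<close>

lemma noncrossing_openers_subset:
  fixes T U :: "nat set set"
  assumes "perfect_matching A T" "perfect_matching A U" "noncrossing T" "noncrossing U"
    and "openers T = openers U" "{a, b} \<in> T" "a < b"
  shows "{a, b} \<in> U"
  using assms
proof (induction "b - a" arbitrary: a b T U rule: less_induct)
  case less
  note T = less.prems(1) and U = less.prems(2)
  have opener: "x < mate V x" if V: "perfect_matching A V" "x \<in> openers V" for x V
  proof -
    obtain e where e: "e \<in> V" "x = Min e" using V(2) by (auto simp: openers_def)
    obtain p q where "p < q" "e = {p, q}" using edge_cases_less[OF V(1) e(1)] by blast
    then show ?thesis using mate_eq[OF V(1), of p q] e by (simp add: Min_Max_pair)
  qed
  have closer: "mate V x < x" if V: "perfect_matching A V" and x: "x \<in> A" "x \<notin> openers V" for x V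
  proof (rule ccontr)
    assume "\<not> mate V x < x"
    then have "x < mate V x" using mate(2)[OF V x(1)] by linarith
    then have "Min {x, mate V x} = x" by (simp add: Min_Max_pair)
    then show False using mate(1)[OF V x(1)] x(2) unfolding openers_def by (metis imageI)
  qed
  have ab: "a \<in> A" "b \<in> A" using edge_props[OF T less.prems(6)] by auto
  have mT: "mate T a = b" "mate T b = a"
    using mate_eq[OF T] less.prems(6) by (auto simp: insert_commute)
  let ?b = "mate U a" and ?a = "mate U b"
  have "a \<in> openers T" using closer[OF T ab(1)] mT less.prems(7) by auto
  then have b: "a < ?b" using opener[OF U] less.prems(5) by simp
  have "b \<notin> openers T" using opener[OF T, of b] mT less.prems(7) by auto
  then have a: "?a < b" using closer[OF U ab(2)] less.prems(5) by simp
  have eb: "{a, ?b} \<in> U" and ea: "{?a, b} \<in> U"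
    using mate(1)[OF U ab(1)] mate(1)[OF U ab(2)] by (auto simp: insert_commute)
  have "\<not> ?b < b"
  proof
    assume "?b < b"
    then have "{a, ?b} \<in> T" using less.hyps[of ?b a U T] less.prems b eb by simp
    then show False using mate_eq[OF T] mT \<open>?b < b\<close> by auto
  qed
  moreover have "\<not> a < ?a"
  proof
    assume "a < ?a"
    then have "{?a, b} \<in> T" using less.hyps[of b ?a U T] less.prems a ea by simp
    then show False using mate_eq[OF T, of b ?a] mT \<open>a < ?a\<close> by (auto simp: insert_commute)
  qed
  moreover have "\<not> (?a < a \<and> b < ?b)"
    using less.prems(4) ea eb less.prems(7) unfolding noncrossing_def by blast
  ultimately have "?b = b \<or> ?a = a" by linarith
  then show ?case using ea eb by auto
qed

lemma noncrossing_openers_inj: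
  assumes "perfect_matching A T" "perfect_matching A U" "noncrossing T" "noncrossing U"
    and "openers T = openers U"
  shows "T = U"
proof (intro equalityI subsetI)
  fix e assume e: "e \<in> T"
  obtain p q where "p < q" "e = {p, q}" using edge_cases_less[OF assms(1) e] by blast
  then show "e \<in> U" using noncrossing_openers_subset[OF assms] e by simp
next
  fix e assume e: "e \<in> U"
  obtain p q where "p < q" "e = {p, q}" using edge_cases_less[OF assms(2) e] by blast
  then show "e \<in> T"
    using noncrossing_openers_subset[OF assms(2,1,4,3) assms(5)[symmetric]] e by simp
qed

lemma matching_fun_01_nonzero:
  assumes "matching_fun T (\<lambda>i. of_bool (i \<in> S) :: complex) \<noteq> 0" "finite T" "e \<in> T"
  shows "Min e \<in> S \<longleftrightarrow> Max e \<notin> S"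
  using assms unfolding matching_fun_def by auto

lemma openers_pair:
  assumes "perfect_matching A T" "p < q" "{p, q} \<in> T"
  shows "p \<in> openers T" "q \<notin> openers T"
proof -
  show "p \<in> openers T" using assms unfolding openers_def by (metis Min_Max_pair(1) imageI)
  show "q \<notin> openers T"
  proof
    assume "q \<in> openers T"
    then obtain e where e: "e \<in> T" "q = Min e" by (auto simp: openers_def)
    then have "q \<in> e" using perfect_matching_edge_finite[OF assms(1)] Min_in by auto
    then have "e = {p, q}"
      using edge_eq[OF assms(1) e(1)] mate_eq[OF assms(1), of q p] assms(3) by (auto simp: insert_commute)
    then have "Min e = Min {p, q}" by simp
    then show False using e(2) assms(2) Min_Max_pair(1)[OF assms(2)] by linarith
  qed
qed

lemma matching_fun_openers_self:
  fixes T assumes "perfect_matching A T" "finite A"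
  shows "matching_fun T (\<lambda>i. of_bool (i \<in> openers T)) \<noteq> (0 :: complex)"
proof -
  have "of_bool (Min e \<in> openers T) - of_bool (Max e \<in> openers T) \<noteq> (0::complex)" if e: "e \<in> T" for e
  proof -
    obtain p q where "p < q" "e = {p, q}" using edge_cases_less[OF assms(1) e] by blast
    then show ?thesis using openers_pair[OF assms(1), of p q] e by (simp add: Min_Max_pair)
  qed
  then show ?thesis using finite_matching[OF assms] by (simp add: matching_fun_def)
qed

text \<open>A nonzero value means that \<open>openers T\<close> contains exactly one endpoint of
  each edge of \<open>U\<close>. That endpoint is at least the left one, and somewhere larger
  because openers determine the matching. So the matrix of evaluations is triangular.\<close>

lemma matching_fun_openers_less:
  assumes T: "perfect_matching A T" "noncrossing T" and U: "perfect_matching A U" "noncrossing U"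
    and A: "finite A" and nz: "matching_fun U (\<lambda>i. of_bool (i \<in> openers T)) \<noteq> (0 :: complex)"
    and "T \<noteq> U"
  shows "\<Sum>(openers U) < \<Sum>(openers T)"
proof -
  let ?S = "openers T"
  note fin = finite_matching[OF U(1) A]
  define f where "f e = (if Min e \<in> ?S then Min e else Max e)" for e :: "nat set"
  have ne: "finite e \<and> e \<noteq> {}" if "e \<in> U" for e using perfect_matching_edge_finite[OF U(1) that] .
  have f: "f e \<in> e" "f e \<in> ?S" "Min e \<le> f e" if "e \<in> U" for e
    using ne[OF that] matching_fun_01_nonzero[OF nz fin that] by (auto simp: f_def)
  have S: "?S \<subseteq> A"
  proof
    fix x assume "x \<in> ?S"
    then obtain e where e: "e \<in> T" "x = Min e" by (auto simp: openers_def)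
    moreover obtain p q where "p < q" "e = {p, q}" "p \<in> A" using edge_cases_less[OF T(1) e(1)] by blast
    ultimately show "x \<in> A" by (simp add: Min_Max_pair)
  qed
  have disj: "e = e'" if "e \<in> U" "e' \<in> U" "x \<in> e" "x \<in> e'" for e e' x
    using edge_unique[OF U(1) that] .
  have img: "f ` U = ?S"
  proof
    show "f ` U \<subseteq> ?S" using f by auto
    show "?S \<subseteq> f ` U"
    proof
      fix x assume x: "x \<in> ?S"
      then have xA: "x \<in> A" using S by auto
      define e where "e = {x, mate U x}"
      have e: "e \<in> U" using mate(1)[OF U(1) xA] by (simp add: e_def)
      have "f e = x" using matching_fun_01_nonzero[OF nz fin e] x mate(2)[OF U(1) xA]
        by (cases "x < mate U x") (auto simp: f_def e_def Min_Max_pair)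
      then show "x \<in> f ` U" using e by auto
    qed
  qed
  have inj: "inj_on f U" by (rule inj_onI) (metis f(1) disj)
  have "Min e \<in> e" if "e \<in> U" for e using ne[OF that] by simp
  then have injM: "inj_on Min U" by (intro inj_onI) (metis disj)
  have "\<Sum>(f ` U) = (\<Sum>e\<in>U. f e)" "\<Sum>(Min ` U) = (\<Sum>e\<in>U. Min e)" by (simp_all add: sum.reindex inj injM)
  then have sums: "\<Sum>?S = (\<Sum>e\<in>U. f e)" "\<Sum>(openers U) = (\<Sum>e\<in>U. Min e)"
    unfolding img by (simp_all only: openers_def)
  have "\<exists>e\<in>U. Min e \<noteq> f e"
  proof (rule ccontr)
    assume "\<not> ?thesis"
    then have "Min ` U = f ` U" by (intro image_cong) auto
    then have "openers U = ?S" unfolding img by (simp only: openers_def)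
    then show False using noncrossing_openers_inj[OF T(1) U(1) T(2) U(2)] \<open>T \<noteq> U\<close> by simp
  qed
  then show ?thesis
    unfolding sums using f(3) fin by (intro sum_strict_mono_ex1) (auto simp: order.strict_iff_order)
qed

text \<open>By triangularity: among the matchings with nonzero coefficient, take \<open>E\<close>
  with the least sum of openers and evaluate at the indicator of \<open>openers E\<close>. All other
  terms vanish.\<close>

lemma nc_matchings_independent:
  assumes "(\<Sum>D\<in>nc_matchings l. cst (c D) * matching_poly D) = 0" "D \<in> nc_matchings l"
  shows "c D = 0"
proof (rule ccontr)
  let ?N = "nc_matchings l"
  assume "c D \<noteq> 0"
  let ?P = "\<lambda>n. \<exists>D\<in>?N. c D \<noteq> 0 \<and> \<Sum>(openers D) = n"
  have "?P (\<Sum>(openers D))" using assms(2) \<open>c D \<noteq> 0\<close> by blast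
  from LeastI[of ?P, OF this] obtain E where
    E: "E \<in> ?N" "c E \<noteq> 0" and E_least: "\<Sum>(openers E) = (LEAST n. ?P n)" by blast
  have min: "\<Sum>(openers E) \<le> \<Sum>(openers U)" if "U \<in> ?N" "c U \<noteq> 0" for U
    unfolding E_least using that by (intro Least_le) blast
  let ?ev = "\<lambda>U. matching_fun U (\<lambda>i. of_bool (i \<in> openers E)) :: complex"
  have zero: "c U * ?ev U = 0" if U: "U \<in> ?N - {E}" for U
  proof (rule ccontr)
    assume *: "c U * ?ev U \<noteq> 0"
    have "\<Sum>(openers U) < \<Sum>(openers E)" by (rule matching_fun_openers_less[of "{1..2*l}"])
        (use U E(1) * in \<open>auto simp add: nc_matchings_def\<close>)
    then show False using min[of U] U * by simp
  qed
  have "0 = eval01 (openers E) (\<Sum>D\<in>?N. cst (c D) * matching_poly D)" using assms(1) by simp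
  also have "\<dots> = (\<Sum>D\<in>?N. c D * ?ev D)" using eval01_matching_fun[of "openers E" _ id]
    by (simp add: eval01_sum eval01_mult matching_poly_eq)
  also have "\<dots> = c E * ?ev E"
    using sum.remove[OF finite_nc_matchings E(1), of "\<lambda>U. c U * ?ev U"] sum.neutral[of "?N - {E}"] zero
    by simp
  finally show False
    using E matching_fun_openers_self[of "{1..2*l}" E] by (auto simp: nc_matchings_def)
qed

text \<open>Required since \<open>nc_coeff\<close> indexes the basis by polynomials and not by
  matchings.\<close>

lemma matching_poly_inj: "inj_on matching_poly (nc_matchings l)"
proof (rule inj_onI, rule ccontr)
  fix T U assume *: "T \<in> nc_matchings l" "U \<in> nc_matchings l" "matching_poly T = matching_poly U" "T \<noteq> U"
  define c where "c D = (if D = T then 1 else if D = U then -1 else 0 :: complex)" for D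
  have "(\<Sum>D\<in>nc_matchings l. cst (c D) * matching_poly D) = (\<Sum>D\<in>{T, U}. cst (c D) * matching_poly D)"
    using * finite_nc_matchings by (intro sum.mono_neutral_right) (auto simp: c_def cst_simps)
  also have "\<dots> = 0" using * by (auto simp: c_def cst_simps)
  finally show False using nc_matchings_independent[of c l T] * by (simp add: c_def)
qed

lemma mpoly_scale_eq: "mpoly_scale c p = cst c * p"
  by (simp add: mpoly_scale_def cst_def)

lemma nc_coeff_eq:
  assumes "matching_poly T = (\<Sum>D\<in>nc_matchings l. cst (c D) * matching_poly D)" "D \<in> nc_matchings l"
  shows "nc_coeff l T D = c D"
proof -
  let ?N = "nc_matchings l"
  let ?B = "matching_poly ` ?N"
  let ?inv = "inv_into ?N matching_poly"
  have inv: "?inv (matching_poly D) = D" if "D \<in> ?N" for D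
    using inv_into_f_f[OF matching_poly_inj that] .
  have sumB: "(\<Sum>b\<in>?B. mpoly_scale (u b) b) = (\<Sum>D\<in>?N. cst (u (matching_poly D)) * matching_poly D)" for u
    by (simp add: sum.reindex[OF matching_poly_inj] mpoly_scale_eq)
  have indep: "mpoly.independent ?B"
  proof (rule mpoly.independent_if_scalars_zero)
    fix u b assume "(\<Sum>b\<in>?B. mpoly_scale (u b) b) = 0" "b \<in> ?B"
    then show "u b = 0" using nc_matchings_independent[of "\<lambda>D. u (matching_poly D)" l] sumB by auto
  qed (simp add: finite_nc_matchings)
  \<comment> \<open>A representation vanishes outside the basis, so \<open>f\<close> must be 0
    there.\<close>
  define f where "f b = (if b \<in> ?B then c (?inv b) else 0)" for b
  have f: "f (matching_poly D) = c D" if "D \<in> ?N" for D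
    unfolding f_def inv[OF that] using that by simp
  have "matching_poly T = (\<Sum>b\<in>?B. mpoly_scale (f b) b)"
    unfolding sumB assms(1) by (intro sum.cong refl) (simp add: f)
  moreover have "(\<Sum>b\<in>?B. mpoly_scale (f b) b) = (\<Sum>b | f b \<noteq> 0. mpoly_scale (f b) b)"
    using finite_nc_matchings by (intro sum.mono_neutral_right) (auto simp: f_def)
  ultimately have eq: "(\<Sum>b | f b \<noteq> 0. mpoly_scale (f b) b) = matching_poly T" by simp
  have span: "matching_poly T \<in> mpoly.span ?B" unfolding assms(1) mpoly_scale_eq[symmetric]
    by (intro mpoly.span_sum mpoly.span_scale mpoly.span_base) auto
  have "mpoly.representation ?B (matching_poly T) = f"
  proof (rule mpoly.representation_eqI[OF indep span _ _ eq])
    show "finite {b. f b \<noteq> 0}"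
      by (rule finite_subset[of _ ?B]) (auto simp: f_def finite_nc_matchings)
  qed (auto simp: f_def split: if_splits)
  then show ?thesis using assms(2) by (simp add: nc_coeff_def f)
qed

section \<open>Composition with a generator diagram\<close>

lemma column_point_left: "j \<le> l \<Longrightarrow> column_point l c d j = (c, j)"
  by (simp add: column_point_def)

lemma column_point_right:
  assumes "1 \<le> j" "j \<le> l"
  shows "column_point l c d (2 * l + 1 - j) = (d, j)"
proof -
  have "\<not> 2 * l + 1 - j \<le> l" "2 * l + 1 - (2 * l + 1 - j) = j" using assms by auto
  then show ?thesis by (simp only: column_point_def if_False)
qed

context
  fixes l i :: nat and D :: "nat set set"
  assumes i: "i \<in> {1..<l}" and pm: "perfect_matching {1..2 * l} D"
begin

private abbreviation (input) "g \<equiv> glued l (gen_diagram l i) D"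
private abbreviation (input) "E \<equiv> reconnect D i (i + 1)"
private abbreviation (input) "x \<equiv> mate D i"
private abbreviation (input) "y \<equiv> mate D (i + 1)"

lemma i_range: "i \<in> {1..2 * l}" "i + 1 \<in> {1..2 * l}" "i + 1 \<le> l" "1 \<le> i"
  using i by auto

lemma pmE: "perfect_matching {1..2 * l} E"
  using perfect_matching_reconnect[OF pm i_range(1,2)] by simp

lemma glued_cases:
  assumes "(u, v) \<in> g"
  obtains "(u, v) \<in> {((0, i), (0, i + 1)), ((0, i + 1), (0, i)), ((1, i), (1, i + 1)), ((1, i + 1), (1, i))}"
  | j where "j \<in> {1..l} - {i, i + 1}" "(u, v) \<in> {((0, j), (1, j)), ((1, j), (0, j))}"
  | a b where "{a, b} \<in> D" "u = column_point l 1 2 a" "v = column_point l 1 2 b"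
proof -
  from assms consider a b where "{a, b} \<in> gen_diagram l i" "u = column_point l 0 1 a" "v = column_point l 0 1 b"
    | a b where "{a, b} \<in> D" "u = column_point l 1 2 a" "v = column_point l 1 2 b"
    unfolding glued_def by blast
  then show thesis
  proof cases
    case 1
    from 1(1) consider "{a, b} = {i, i + 1}" | "{a, b} = {2 * l + 1 - i, 2 * l + 1 - (i + 1)}"
      | j where "j \<in> {1..l} - {i, i + 1}" "{a, b} = {j, 2 * l + 1 - j}"
      unfolding gen_diagram_def by blast
    then show thesis
    proof cases
      case 1
      then have "(a, b) = (i, i + 1) \<or> (a, b) = (i + 1, i)" by (auto simp: doubleton_eq_iff)
      then show thesis using \<open>u = _\<close> \<open>v = _\<close> i_range that(1) by (auto simp: column_point_def)
    next
      case 2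
      then have "(a, b) = (2 * l + 1 - i, 2 * l + 1 - (i + 1)) \<or> (a, b) = (2 * l + 1 - (i + 1), 2 * l + 1 - i)"
        by (auto simp: doubleton_eq_iff)
      then have "(u, v) \<in> {((1, i), (1, i + 1)), ((1, i + 1), (1, i))}" unfolding \<open>u = _\<close> \<open>v = _\<close>
        using column_point_right[of i l 0 1] column_point_right[of "i + 1" l 0 1] i_range by auto
      then show thesis by (intro that(1)) blast
    next
      case (3 j)
      then have "(a, b) = (j, 2 * l + 1 - j) \<or> (a, b) = (2 * l + 1 - j, j)"
        by (auto simp: doubleton_eq_iff)
      then have "(u, v) \<in> {((0, j), (1, j)), ((1, j), (0, j))}" unfolding \<open>u = _\<close> \<open>v = _\<close>
        using column_point_right[of j l 0 1] column_point_left[of j l 0 1] 3(1) by auto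
      then show thesis by (rule that(2)[OF 3(1)])
    qed
  next
    case 2
    then show thesis by (rule that(3))
  qed
qed

lemma glued_gen:
  "{a, b} \<in> gen_diagram l i \<Longrightarrow> (column_point l 0 1 a, column_point l 0 1 b) \<in> g"
  unfolding glued_def by blast

lemma glued_right: "{a, b} \<in> D \<Longrightarrow> (column_point l 1 2 a, column_point l 1 2 b) \<in> g"
  unfolding glued_def by blast

lemma glued_through:
  assumes "j \<in> {1..l} - {i, i + 1}"
  shows "((0, j), (1, j)) \<in> g"
proof -
  have "{j, 2 * l + 1 - j} \<in> gen_diagram l i" using assms unfolding gen_diagram_def by blast
  moreover have "column_point l 0 1 j = (0, j)" "column_point l 0 1 (2 * l + 1 - j) = (1, j)"
    using assms by (intro column_point_left column_point_right; simp)+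
  ultimately show ?thesis using glued_gen[of j "2 * l + 1 - j"] by (simp only:)
qed

lemma glued_left_cup: "((0, i), (0, i + 1)) \<in> g"
proof -
  have "{i, i + 1} \<in> gen_diagram l i" unfolding gen_diagram_def by blast
  from glued_gen[OF this] show ?thesis using i_range by (simp add: column_point_def)
qed

lemma glued_middle: "((1, i), (1, i + 1)) \<in> g"
proof -
  have "{2 * l + 1 - i, 2 * l + 1 - (i + 1)} \<in> gen_diagram l i" unfolding gen_diagram_def by blast
  moreover have "column_point l 0 1 (2 * l + 1 - i) = (1, i)"
      "column_point l 0 1 (2 * l + 1 - (i + 1)) = (1, i + 1)"
    using i_range by (intro column_point_right; simp)+
  ultimately show ?thesis using glued_gen[of "2 * l + 1 - i" "2 * l + 1 - (i + 1)"] by (simp only:)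
qed

lemma sym_glued: "sym (g\<^sup>*)"
proof (rule sym_rtrancl, rule symI)
  fix u v assume "(u, v) \<in> g"
  then consider a b where "{a, b} \<in> gen_diagram l i" "u = column_point l 0 1 a" "v = column_point l 0 1 b"
    | a b where "{a, b} \<in> D" "u = column_point l 1 2 a" "v = column_point l 1 2 b"
    unfolding glued_def by blast
  then show "(v, u) \<in> g"
  proof cases
    case 1
    then show ?thesis using glued_gen[of b a] by (simp add: insert_commute)
  next
    case 2
    then show ?thesis using glued_right[of b a] by (simp add: insert_commute)
  qed
qed

text \<open>Points of the glued diagram are labelled by the edge of the reconnected matching that their
  component carries, and by the empty set on a closed loop.\<close>

private definition edge_at :: "nat \<Rightarrow> nat set" where
  "edge_at p = {p, mate E p}"

text \<open>Labels the endpoints of \<open>D\<close> inside the glued diagram. Only \<open>i\<close>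
  and \<open>i + 1\<close> differ from the outer points: they lie on the closed loop or on the
  strand through the middle arc, which joins \<open>x\<close> to \<open>y\<close>.\<close>

private definition mid_label :: "nat \<Rightarrow> nat set" where
  "mid_label p = (if p \<in> {i, i + 1} then if {i, i + 1} \<in> D then {} else {x, y} else edge_at p)"

private definition label :: "nat \<times> nat \<Rightarrow> nat set" where
  "label v = (if fst v = 0 then edge_at (snd v) else if fst v = 1 then mid_label (snd v)
     else edge_at (2 * l + 1 - snd v))"

lemma edge_at_eq:
  assumes "{p, q} \<in> E"
  shows "edge_at p = {p, q}" "edge_at q = {p, q}"
proof -
  have "{q, p} \<in> E" using assms by (simp add: insert_commute)
  then show "edge_at p = {p, q}" "edge_at q = {p, q}"
    using mate_eq[OF pmE assms] mate_eq[OF pmE, of q p] by (auto simp: edge_at_def)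
qed

lemma mid_label_edge:
  assumes ab: "{a, b} \<in> D"
  shows "mid_label a = mid_label b"
proof -
  have *: "mid_label a = mid_label b" if "{a, b} \<in> D" "a \<in> {i, i + 1}" "b \<notin> {i, i + 1}" for a b
  proof -
    have "{i, i + 1} \<notin> D"
    proof
      assume "{i, i + 1} \<in> D"
      from edge_unique[OF pm this that(1), of a] that(2,3) show False by blast
    qed
    moreover have "b \<in> {x, y}" using mate_eq[OF pm that(1)] that(2) by auto
    moreover have "{x, y} \<in> E" unfolding reconnect_def by blast
    ultimately show ?thesis using edge_at_eq[of x y] that(2,3) by (auto simp: mid_label_def)
  qed
  have ba: "{b, a} \<in> D" using ab by (simp add: insert_commute)
  show ?thesis
  proof (cases "a \<in> {i, i + 1} \<or> b \<in> {i, i + 1}")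
    case True
    then show ?thesis using *[OF ab] *[OF ba] by (cases "a \<in> {i, i + 1}"; cases "b \<in> {i, i + 1}") (simp_all add: mid_label_def)
  next
    case False
    then have "{a, b} \<in> E" using ab unfolding reconnect_def by blast
    then show ?thesis using False edge_at_eq[of a b] by (simp add: mid_label_def)
  qed
qed

lemma label_outer: "p \<le> 2 * l \<Longrightarrow> label (column_point l 0 2 p) = edge_at p"
  by (simp add: label_def column_point_def)

lemma label_inner: "p \<le> 2 * l \<Longrightarrow> label (column_point l 1 2 p) = mid_label p"
proof (cases "p \<le> l")
  case False
  assume "p \<le> 2 * l"
  then have "2 * l + 1 - (2 * l + 1 - p) = p" by simp
  moreover have "p \<noteq> i" "p \<noteq> i + 1" using False i_range by auto
  ultimately show ?thesis using False by (simp add: label_def column_point_def mid_label_def)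
qed (simp add: label_def column_point_def)

lemma label_glued:
  assumes "(u, v) \<in> g"
  shows "label u = label v"
  using assms
proof (cases rule: glued_cases)
  case 1
  have "{i, i + 1} \<in> E" unfolding reconnect_def by blast
  from edge_at_eq[OF this] have "label (0, i) = label (0, i + 1)" by (simp add: label_def)
  moreover have "label (1, i) = label (1, i + 1)" by (simp add: label_def mid_label_def)
  ultimately show ?thesis using 1 by blast
next
  case (2 j)
  then have "label (0, j) = label (1, j)" by (simp add: label_def mid_label_def)
  then show ?thesis using 2 by blast
next
  case (3 a b)
  then have "a \<le> 2 * l" "b \<le> 2 * l" using edge_props[OF pm 3(1)] by auto
  then show ?thesis using 3 label_inner mid_label_edge by simp
qed

text \<open>The label is an invariant of components, so it separates outer points that the
  reconnected matching does not join.\<close>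

lemma label_rtrancl: "(u, v) \<in> g\<^sup>* \<Longrightarrow> label u = label v"
  by (induction rule: rtrancl_induct) (auto dest: label_glued)

text \<open>Points of the left column are linked by a through strand of the generator; for points of
  the right column both descriptions give the same point.\<close>

lemma outer_inner:
  assumes "p \<in> {1..2 * l}" "p \<notin> {i, i + 1}"
  shows "(column_point l 0 2 p, column_point l 1 2 p) \<in> g\<^sup>*"
proof (cases "p \<le> l")
  case True
  then have "((0, p), (1, p)) \<in> g" using assms by (intro glued_through) auto
  then show ?thesis using True by (auto simp: column_point_def)
qed (simp add: column_point_def)

lemma outer_edge:
  assumes pq: "{p, q} \<in> D" "p \<notin> {i, i + 1}" "q \<in> {1..2 * l}"
  shows "(column_point l 0 2 p, column_point l 1 2 q) \<in> g\<^sup>*"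
proof -
  have "p \<in> {1..2 * l}" using edge_props[OF pm pq(1)] by simp
  from outer_inner[OF this pq(2)] glued_right[OF pq(1)] show ?thesis by (rule rtrancl_into_rtrancl)
qed

text \<open>The counterpart of the label invariant: old edges are reached along the through strands,
  \<open>{i, i + 1}\<close> is the left arc of the generator, and \<open>x\<close> and
  \<open>y\<close> meet through its other arc.\<close>

lemma connected_edge:
  assumes "{p, q} \<in> E"
  shows "(column_point l 0 2 p, column_point l 0 2 q) \<in> g\<^sup>*"
proof -
  have symI: "(v, u) \<in> g\<^sup>*" if "(u, v) \<in> g\<^sup>*" for u v using sym_glued that by (rule symD)
  have cup: "(column_point l 0 2 i, column_point l 0 2 (i + 1)) \<in> g\<^sup>*"
    using glued_left_cup i_range by (auto simp: column_point_def)
  consider "{p, q} = {i, i + 1}" | "{p, q} = {x, y}" "{i, i + 1} \<notin> D" | "{p, q} \<in> D" "i \<notin> {p, q}" "i + 1 \<notin> {p, q}"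
  proof (cases "{p, q} = {x, y} \<and> {i, i + 1} \<in> D")
    case True
    \<comment> \<open>The mates are \<open>i + 1\<close> and \<open>i\<close> themselves, so the new
      edge is again the left arc, while the middle arc closes up to a loop.\<close>
    have "{i + 1, i} \<in> D" using True by (simp add: insert_commute)
    then have "x = i + 1" "y = i" using mate_eq[OF pm] True by blast+
    then have "{p, q} = {i, i + 1}" using True by (simp add: insert_commute)
    then show thesis by (rule that(1))
  next
    case False
    then show thesis using assms that unfolding reconnect_def by blast
  qed
  then show ?thesis
  proof cases
    case 1
    then have "p = i \<and> q = i + 1 \<or> p = i + 1 \<and> q = i" by (auto simp: doubleton_eq_iff)
    then show ?thesis using cup symI by blast
  next
    case 2
    have ne: "i \<noteq> i + 1" by simp
    have fin: "finite {1..2 * l}" by simp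
    note d = mate_distinct[OF fin pm i_range(1,2) ne 2(2)]
    have "{x, i} \<in> D" "{y, i + 1} \<in> D"
      using mate(1)[OF pm i_range(1)] mate(1)[OF pm i_range(2)] by (simp_all add: insert_commute)
    then have "(column_point l 0 2 x, column_point l 1 2 i) \<in> g\<^sup>*"
        "(column_point l 0 2 y, column_point l 1 2 (i + 1)) \<in> g\<^sup>*"
      using outer_edge[of x i] outer_edge[of y "i + 1"] d i_range by auto
    moreover have "(column_point l 1 2 i, column_point l 1 2 (i + 1)) \<in> g\<^sup>*"
      using glued_middle i_range by (auto simp: column_point_def)
    ultimately have xy: "(column_point l 0 2 x, column_point l 0 2 y) \<in> g\<^sup>*"
      using symI by (meson rtrancl_trans)
    have "p = x \<and> q = y \<or> p = y \<and> q = x" using 2(1) by (auto simp: doubleton_eq_iff)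
    then show ?thesis using xy symI by blast
  next
    case 3
    have q: "q \<in> {1..2 * l}" using edge_props[OF pm 3(1)] by simp
    have "(column_point l 0 2 p, column_point l 1 2 q) \<in> g\<^sup>*"
      using outer_edge[OF 3(1) _ q] 3 by auto
    moreover have "(column_point l 0 2 q, column_point l 1 2 q) \<in> g\<^sup>*"
      using outer_inner[OF q] 3 by auto
    ultimately show ?thesis using symI by (meson rtrancl_trans)
  qed
qed

lemma diagram_comp_gen: "diagram_comp l (gen_diagram l i) D = E"
proof (intro equalityI subsetI)
  fix e assume "e \<in> diagram_comp l (gen_diagram l i) D"
  then obtain p q where e: "e = {p, q}" and pq: "p \<in> {1..2 * l}" "q \<in> {1..2 * l}" "p \<noteq> q"
    and conn: "(column_point l 0 2 p, column_point l 0 2 q) \<in> g\<^sup>*"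
    unfolding diagram_comp_def by blast
  have "edge_at p = edge_at q"
    using label_rtrancl[OF conn] label_outer[of p] label_outer[of q] pq by simp
  then have "q = mate E p" using pq(3) by (auto simp: edge_at_def)
  then show "e \<in> E" using mate(1)[OF pmE pq(1)] e by simp
next
  fix e assume e: "e \<in> E"
  obtain p q where pq: "p \<in> {1..2 * l}" "q \<in> {1..2 * l}" "p < q" "e = {p, q}"
    using edge_cases_less[OF pmE e] by blast
  then have "(column_point l 0 2 p, column_point l 0 2 q) \<in> g\<^sup>*"
    using connected_edge[of p q] e by simp
  then show "e \<in> diagram_comp l (gen_diagram l i) D" unfolding diagram_comp_def using pq by blast
qed

text \<open>Every other height has a strand to the left column, and \<open>i\<close>,
  \<open>i + 1\<close> share a component, so there is at most one loop. If \<open>D\<close> closes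
  the middle arc, the empty label confines this component to the middle; otherwise the strand leaves
  through \<open>x\<close>.\<close>

lemma loops_gen: "loops l (gen_diagram l i) D = (if {i, i + 1} \<in> D then 1 else 0)"
proof -
  let ?L = "{C. \<exists>j\<in>{1..l}. C = g\<^sup>* `` {(1, j)} \<and> C \<subseteq> {1} \<times> UNIV}"
  have symI: "(v, u) \<in> g\<^sup>*" if "(u, v) \<in> g\<^sup>*" for u v using sym_glued that by (rule symD)
  have other: "\<not> g\<^sup>* `` {(1, j)} \<subseteq> {1} \<times> UNIV" if "j \<in> {1..l}" "j \<notin> {i, i + 1}" for j
  proof -
    have "((0, j), (1, j)) \<in> g\<^sup>*" using glued_through[of j] that by blast
    then have "(0, j) \<in> g\<^sup>* `` {(1, j)}" using symI by blast
    then show ?thesis by auto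
  qed
  have mid: "g\<^sup>* `` {(1, i + 1)} = g\<^sup>* `` {(1, i)}"
  proof -
    have *: "((1, i), (1, i + 1)) \<in> g\<^sup>*" using glued_middle by blast
    then have "((1, i + 1), (1, i)) \<in> g\<^sup>*" by (rule symI)
    with * show ?thesis by (auto intro: rtrancl_trans)
  qed
  have eq: "C = g\<^sup>* `` {(1, i)}" if C: "C \<in> ?L" for C
  proof -
    obtain j where j: "j \<in> {1..l}" "C = g\<^sup>* `` {(1, j)}" "C \<subseteq> {1} \<times> UNIV"
      using C by blast
    then have "j = i \<or> j = i + 1" using other[of j] by blast
    then show ?thesis using j(2) mid by blast
  qed
  show ?thesis
  proof (cases "{i, i + 1} \<in> D")
    case True
    have "g\<^sup>* `` {(1, i)} \<subseteq> {1} \<times> UNIV"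
    proof
      fix v assume "v \<in> g\<^sup>* `` {(1, i)}"
      then have "label v = {}"
        using label_rtrancl[of "(1, i)" v] True by (simp add: label_def mid_label_def)
      then show "v \<in> {1} \<times> UNIV"
        by (cases v) (auto simp: label_def mid_label_def edge_at_def split: if_splits)
    qed
    moreover have "i \<in> {1..l}" using i_range by simp
    ultimately have "g\<^sup>* `` {(1, i)} \<in> ?L" by blast
    then have "?L = {g\<^sup>* `` {(1, i)}}" using eq by blast
    then show ?thesis using True by (simp add: loops_def)
  next
    case False
    have fin: "finite {1..2 * l}" and ne: "i \<noteq> i + 1" by simp_all
    note d = mate_distinct[OF fin pm i_range(1,2) ne False]
    have xi: "{x, i} \<in> D" using mate(1)[OF pm i_range(1)] by (simp add: insert_commute)
    have "(column_point l 0 2 x, column_point l 1 2 i) \<in> g\<^sup>*"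
      by (rule outer_edge[OF xi d(1) i_range(1)])
    moreover have "column_point l 1 2 i = (1, i)" using i_range by (intro column_point_left) simp
    ultimately have "(column_point l 0 2 x) \<in> g\<^sup>* `` {(1, i)}" using symI by auto
    moreover have "column_point l 0 2 x \<notin> {1} \<times> UNIV" by (simp add: column_point_def)
    ultimately have "\<not> g\<^sup>* `` {(1, i)} \<subseteq> {1} \<times> UNIV" by blast
    then have "?L = {}" using eq by blast
    then show ?thesis using False by (simp add: loops_def)
  qed
qed

end

section \<open>The action of words on matching polynomials\<close>

definition perm_matching :: "nat \<Rightarrow> (nat \<Rightarrow> nat) \<Rightarrow> nat set set" where
  "perm_matching l w = (\<lambda>j. {w j, 2 * l + 1 - j}) ` {1..l}"

text \<open>Every edge runs from \<open>w j \<le> l\<close> to a point above \<open>l\<close>, so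
  sorting the endpoints produces no signs.\<close>

lemma matching_fun_perm_matching:
  assumes w: "w permutes {1..l}"
  shows "matching_fun (perm_matching l w) a = (\<Prod>j\<in>{1..l}. a (w j) - a (2 * l + 1 - j))"
proof -
  have wj: "1 \<le> w j" "w j < 2 * l + 1 - j" "w j \<le> l" if "j \<in> {1..l}" for j
    using permutes_in_image[OF w, of j] that by auto
  have mm: "Min {w j, 2 * l + 1 - j} = w j" "Max {w j, 2 * l + 1 - j} = 2 * l + 1 - j" if "j \<in> {1..l}" for j
    using wj[OF that] by (simp_all only: Min_Max_pair)
  have inj: "inj_on (\<lambda>j. {w j, 2 * l + 1 - j}) {1..l}"
  proof (rule inj_onI)
    fix j k assume *: "j \<in> {1..l}" "k \<in> {1..l}" "{w j, 2 * l + 1 - j} = {w k, 2 * l + 1 - k}"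
    then have "2 * l + 1 - j = 2 * l + 1 - k" using mm(2) by metis
    then show "j = k" using *(1,2) by auto
  qed
  show ?thesis unfolding matching_fun_def perm_matching_def prod.reindex[OF inj] comp_def
    by (rule prod.cong[OF refl]) (simp only: mm)
qed

lemma id_diagram_eq: "id_diagram l = perm_matching l id"
  by (auto simp: id_diagram_def perm_matching_def)

abbreviation id_poly :: "nat \<Rightarrow> polyfun" where
  "id_poly l \<equiv> matching_fun (id_diagram l)"

lemma matching_fun_perm_act:
  assumes w: "w permutes {1..l}"
  shows "matching_fun (perm_matching l w) = perm_act w (id_poly l)"
proof
  fix a :: "nat \<Rightarrow> mpoly"
  have "w (2 * l + 1 - j) = 2 * l + 1 - j" if "j \<in> {1..l}" for j
  proof -
    have "2 * l + 1 - j > l" using that by auto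
    then show ?thesis using permutes_not_in[OF w, of "2 * l + 1 - j"] by simp
  qed
  then show "matching_fun (perm_matching l w) a = perm_act w (id_poly l) a"
    unfolding matching_fun_perm_matching[OF w] perm_act_def id_diagram_eq
      matching_fun_perm_matching[OF permutes_id] by (intro prod.cong[OF refl]) simp
qed

lemma id_diagram_nc: "id_diagram l \<in> nc_matchings l"
proof -
  have edge: "q = 2 * l + 1 - p \<and> p \<in> {1..2 * l}" if "{p, q} \<in> id_diagram l" for p q
    using that unfolding id_diagram_def by (auto simp: doubleton_eq_iff)
  have "perfect_matching {1..2 * l} (id_diagram l)" unfolding perfect_matching_iff
  proof (intro conjI ballI)
    fix e assume "e \<in> id_diagram l"
    then obtain j where j: "j \<in> {1..l}" "e = {j, 2 * l + 1 - j}" unfolding id_diagram_def by blast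
    then have "j \<noteq> 2 * l + 1 - j" "j \<in> {1..2*l}" "2 * l + 1 - j \<in> {1..2*l}" by auto
    then show "\<exists>p q. e = {p, q} \<and> p \<noteq> q \<and> p \<in> {1..2 * l} \<and> q \<in> {1..2 * l}" using j by blast
  next
    fix p assume p: "p \<in> {1..2 * l}"
    have "{p, 2 * l + 1 - p} \<in> id_diagram l"
    proof (cases "p \<le> l")
      case True
      then show ?thesis using p unfolding id_diagram_def by auto
    next
      case False
      then have "2 * l + 1 - p \<in> {1..l}" "2 * l + 1 - (2 * l + 1 - p) = p" using p by auto
      then show ?thesis unfolding id_diagram_def
        by (intro CollectI exI[of _ "2 * l + 1 - p"]) (simp only: insert_commute simp_thms)
    qed
    moreover have "e = {p, 2 * l + 1 - p}" if e: "e \<in> id_diagram l" "p \<in> e" for e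
    proof -
      obtain j where j: "j \<in> {1..l}" "e = {j, 2 * l + 1 - j}" using e(1) unfolding id_diagram_def by blast
      then have "p = j \<or> p = 2 * l + 1 - j \<and> 2 * l + 1 - p = j" using e(2) by auto
      then show ?thesis using j(2) by (auto simp: insert_commute)
    qed
    ultimately show "\<exists>!e. e \<in> id_diagram l \<and> p \<in> e" by blast
  qed
  moreover have "noncrossing (id_diagram l)" unfolding noncrossing_def
  proof clarify
    fix a1 a2 b1 b2 assume *: "{a1, a2} \<in> id_diagram l" "{b1, b2} \<in> id_diagram l" "a1 < b1" "b1 < a2" "a2 < b2"
    show False using edge[OF *(1)] edge[OF *(2)] *(3-5) by auto
  qed
  ultimately show ?thesis by (simp add: nc_matchings_def)
qed

lemma tl_op_nc_matching:
  assumes "D \<in> nc_matchings l" "i \<in> {1..<l}"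
  shows "tl_op i (matching_fun D) =
    (\<lambda>a. cst (if {i, i + 1} \<in> D then - 2 else 1) * matching_fun (reconnect D i (i + 1)) a)"
proof -
  have D: "perfect_matching {1..2 * l} D" "noncrossing D" using assms(1) by (auto simp: nc_matchings_def)
  have "i \<in> {1..2 * l}" "i + 1 \<in> {1..2 * l}" using assms(2) by auto
  note * = tl_op_matching_fun[OF _ D this, simplified]
  have "cst (- 2) = - 2" by (simp add: cst_def single_uminus)
  then show ?thesis using * reconnect_edge[OF D(1), of i "i + 1"] by (auto simp: cst_simps)
qed

definition word_diagram :: "nat \<Rightarrow> nat list \<Rightarrow> complex \<times> nat set set" where
  "word_diagram l is = foldr (\<lambda>i. diagram_mult l (1, gen_diagram l i)) is (1, id_diagram l)"

text \<open>Action and diagram calculus follow the same recursion: a letter reconnects the matching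
  and, on a closed loop, contributes -2. That the coefficient is a power of -2 is recorded for the
  later proof that it is 1 on reduced words of 321-avoiding permutations.\<close>

lemma word_diagram_conj:
  assumes "is \<in> lists {1..<l}"
  shows "snd (word_diagram l is) \<in> nc_matchings l \<and> (\<exists>n. fst (word_diagram l is) = (- 2) ^ n) \<and>
    word_act is (id_poly l) = (\<lambda>a. cst (fst (word_diagram l is)) * matching_fun (snd (word_diagram l is)) a)"
  using assms
proof (induction "is")
  case Nil
  have "word_diagram l [] = (1, id_diagram l)" by (simp add: word_diagram_def)
  then show ?case using id_diagram_nc by (auto simp: cst_simps intro: exI[of _ 0])
next
  case (Cons i "is")
  define c D where "c = fst (word_diagram l is)" and "D = snd (word_diagram l is)"
  have i: "i \<in> {1..<l}" using Cons.hyps by auto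
  have IH: "D \<in> nc_matchings l" "\<exists>n. c = (- 2) ^ n"
      "word_act is (id_poly l) = (\<lambda>a. cst c * matching_fun D a)"
    using Cons by (auto simp: c_def D_def)
  have pm: "perfect_matching {1..2 * l} D" using IH(1) by (simp add: nc_matchings_def)
  define k :: nat where "k = (if {i, i + 1} \<in> D then 1 else 0)"
  have "word_diagram l (i # is) = diagram_mult l (1, gen_diagram l i) (c, D)"
    by (simp add: word_diagram_def c_def D_def)
  also have "\<dots> = (c * (- 2) ^ k, reconnect D i (i + 1))"
    using diagram_comp_gen[OF i pm] loops_gen[OF i pm] by (simp add: diagram_mult_def k_def)
  finally have wd: "word_diagram l (i # is) = (c * (- 2) ^ k, reconnect D i (i + 1))" .
  have "tl_op i (\<lambda>a. cst c * matching_fun D a) =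
      (\<lambda>a. cst (c * (- 2) ^ k) * matching_fun (reconnect D i (i + 1)) a)"
    unfolding tl_op_scale tl_op_nc_matching[OF IH(1) i] by (auto simp: k_def cst_simps mult.assoc)
  then have "word_act (i # is) (id_poly l) =
      (\<lambda>a. cst (c * (- 2) ^ k) * matching_fun (reconnect D i (i + 1)) a)"
    by (simp add: IH(3))
  moreover have "i \<in> {1..<2 * l}" using i by auto
  then have "reconnect D i (i + 1) \<in> nc_matchings l" by (rule nc_matchings_reconnect[OF IH(1)])
  moreover have "\<exists>n. c * (- 2) ^ k = (- 2) ^ n" using IH(2) by (metis power_add)
  ultimately show ?case unfolding wd by simp
qed

lemmas word_diagram = word_diagram_conj[THEN conjunct1]
  word_diagram_conj[THEN conjunct2, THEN conjunct1] word_diagram_conj[THEN conjunct2, THEN conjunct2]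

lemma kauffman_eq: "kauffman l w = word_diagram l (red_word l w)"
  by (simp add: kauffman_def word_diagram_def)

section \<open>The Temperley-Lieb relations for the operators\<close>

lemma tl_op_square: "tl_op i (tl_op i v) = (\<lambda>a. - 2 * tl_op i v a)"
  by (simp add: tl_op_def swap_twice algebra_simps)

lemma tl_op_commute:
  assumes "i + 1 < j \<or> j + 1 < i"
  shows "tl_op i (tl_op j v) = tl_op j (tl_op i v)"
proof -
  have "a \<circ> adj_swap i \<circ> adj_swap j = a \<circ> adj_swap j \<circ> adj_swap i"
    for a :: "nat \<Rightarrow> mpoly"
    using swap_commute[OF assms] by (simp only: comp_assoc)
  then show ?thesis by (simp add: tl_op_def algebra_simps del: o_apply)
qed

text \<open>\<open>p\<close> and \<open>q\<close> are the ends of an arc, \<open>q\<close> is the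
  point shared by the two transpositions, \<open>r\<close> the third point and \<open>z\<close> its
  mate. \<open>e\<close> absorbs the signs of sorted factors, and \<open>R\<close> stands for the
  factors left alone by both transpositions.\<close>

lemma tl_op_braid_aux:
  fixes R :: polyfun
  assumes v: "\<And>b. v b = (b p - b q) * (e * (b r - b z)) * R b"
    and dist: "p \<noteq> q" "p \<noteq> r" "q \<noteq> r" "z \<noteq> p" "z \<noteq> q" "z \<noteq> r"
    and R: "\<And>b. R (b \<circ> transpose p q) = R b" "\<And>b. R (b \<circ> transpose q r) = R b"
  shows "v (a \<circ> transpose p q \<circ> transpose q r) - v (a \<circ> transpose p q) - (v (a \<circ> transpose q r) - v a) = v a"
proof -
  have val: "(b \<circ> transpose p q) p = b q" "(b \<circ> transpose p q) q = b p" "(b \<circ> transpose p q) r = b r"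
    "(b \<circ> transpose p q) z = b z" "(b \<circ> transpose q r) p = b p" "(b \<circ> transpose q r) q = b r"
    "(b \<circ> transpose q r) r = b q" "(b \<circ> transpose q r) z = b z" for b :: "nat \<Rightarrow> mpoly"
    using dist by simp_all
  show ?thesis unfolding v R val by (simp only: algebra_simps)
qed

text \<open>In terms of diagrams, t_j moves the arc from \<open>{i, i + 1}\<close> to
  \<open>{j, j + 1}\<close> and t_i moves it back. Unlike the other relations, this one depends on
  the shape of the function.\<close>

lemma tl_op_braid_cup:
  assumes D: "D \<in> nc_matchings l" and i: "i \<in> {1..<l}" and j: "j \<in> {1..<l}"
    and ij: "j = i + 1 \<or> i = j + 1" and cup: "{i, i + 1} \<in> D"
  shows "tl_op i (tl_op j (matching_fun D)) = matching_fun D"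
proof -
  have pm: "perfect_matching {1..2 * l} D" using D by (simp add: nc_matchings_def)
  \<comment> \<open>Naming the common point of both swaps \<open>q\<close> treats
    \<open>j = i + 1\<close> and \<open>i = j + 1\<close> at once.\<close>
  define p where "p = (if j = i + 1 then i else i + 1)"
  define q where "q = (if j = i + 1 then i + 1 else i)"
  define r where "r = (if j = i + 1 then i + 2 else j)"
  define z where "z = mate D r"
  define R :: polyfun where "R = matching_fun {e \<in> D. p \<notin> e \<and> r \<notin> e}"
  have pq: "{p, q} = {i, i + 1}" "p \<noteq> q" "p \<noteq> r" "q \<noteq> r" using ij by (auto simp: p_def q_def r_def)
  have range: "p \<in> {1..2 * l}" "r \<in> {1..2 * l}" using i j ij by (auto simp: p_def r_def)
  have ti: "adj_swap i = transpose p q" by (simp add: p_def q_def transpose_commute)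
  have tj: "adj_swap j = transpose q r" using ij by (auto simp: q_def r_def transpose_commute)
  have "{p, q} \<in> D" using cup pq by simp
  then have mp: "mate D p = q" and "mate D q = p"
    using mate_eq[OF pm, of p q] mate_eq[OF pm, of q p] by (simp_all add: insert_commute)
  have "{p, r} \<notin> D" using mate_eq[OF pm, of p r] mp pq by auto
  have "finite {1..2 * l}" by simp
  note split = matching_fun_split[OF this pm range \<open>p \<noteq> r\<close> \<open>{p, r} \<notin> D\<close>, where 'a = mpoly, folded R_def]
    and dist = mate_distinct[OF this pm range \<open>p \<noteq> r\<close> \<open>{p, r} \<notin> D\<close>]
  have z: "z \<noteq> p" "z \<noteq> q" "z \<noteq> r" using dist mp by (auto simp: z_def)
  have sgn: "\<exists>e. \<forall>b :: nat \<Rightarrow> mpoly. b (Min {x, y}) - b (Max {x, y}) = e * (b x - b y)" if "x \<noteq> y" for x y :: nat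
  proof (cases "x < y")
    case True
    then show ?thesis by (intro exI[of _ 1]) (simp add: Min_Max_pair)
  next
    case False
    then have "y < x" using that by simp
    then show ?thesis by (intro exI[of _ "- 1 :: mpoly"]) (simp add: Min_Max_pair)
  qed
  obtain e1 where e1: "\<And>b :: nat \<Rightarrow> mpoly. b (Min {p, q}) - b (Max {p, q}) = e1 * (b p - b q)"
    using sgn[OF pq(2)] by blast
  obtain e2 where e2: "\<And>b :: nat \<Rightarrow> mpoly. b (Min {r, z}) - b (Max {r, z}) = e2 * (b r - b z)"
    using sgn[of r z] z by metis
  have v: "matching_fun D b = (b p - b q) * (e1 * e2 * (b r - b z)) * R b" for b :: "nat \<Rightarrow> mpoly"
    unfolding split mp z_def[symmetric] e1 e2 by (simp add: mult_ac)
  have avoid: "x \<notin> {p, q, r}" if x: "e \<in> D" "p \<notin> e" "r \<notin> e" "x \<in> e" for x e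
  proof -
    have "q \<notin> e" using edge_unique[OF pm x(1) \<open>{p, q} \<in> D\<close>, of q] x(2) by blast
    then show ?thesis using x by blast
  qed
  have "R (b \<circ> transpose p q) = R b" "R (b \<circ> transpose q r) = R b" for b unfolding R_def
  proof (rule matching_fun_cong)
    fix x e assume "e \<in> {e \<in> D. p \<notin> e \<and> r \<notin> e}" "x \<in> e"
    then show "(b \<circ> transpose p q) x = b x" using avoid[of e x] by auto
  next
    show "matching_fun {e \<in> D. p \<notin> e \<and> r \<notin> e} (b \<circ> transpose q r) = matching_fun {e \<in> D. p \<notin> e \<and> r \<notin> e} b"
    proof (rule matching_fun_cong)
      fix x e assume "e \<in> {e \<in> D. p \<notin> e \<and> r \<notin> e}" "x \<in> e"
      then show "(b \<circ> transpose q r) x = b x" using avoid[of e x] by auto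
    qed (use perfect_matching_edge_finite[OF pm] in auto)
  qed (use perfect_matching_edge_finite[OF pm] in auto)
  from tl_op_braid_aux[OF v pq(2,3,4) z(1,2,3) this] show ?thesis unfolding tl_op_def ti tj by blast
qed

text \<open>t_i sends P_D to a multiple of the polynomial of a matching that contains
  \<open>{i, i + 1}\<close>, where \<open>tl_op_braid_cup\<close> applies.\<close>

lemma tl_op_braid:
  assumes D: "D \<in> nc_matchings l" and i: "i \<in> {1..<l}" and j: "j \<in> {1..<l}"
    and ij: "j = i + 1 \<or> i = j + 1"
  shows "tl_op i (tl_op j (tl_op i (matching_fun D))) = tl_op i (matching_fun D)"
proof -
  let ?E = "reconnect D i (i + 1)"
  obtain c where c: "tl_op i (matching_fun D) = (\<lambda>a. cst c * matching_fun ?E a)"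
    using tl_op_nc_matching[OF D i] by blast
  have "i \<in> {1..<2 * l}" using i by auto
  then have E: "?E \<in> nc_matchings l" by (rule nc_matchings_reconnect[OF D])
  have "{i, i + 1} \<in> ?E" unfolding reconnect_def by blast
  note b = tl_op_braid_cup[OF E i j ij this]
  show ?thesis unfolding c tl_op_scale b ..
qed

section \<open>Matchings between the two halves and their permutations\<close>

lemma mate_bipartite:
  assumes pm: "perfect_matching (X \<union> Y) T" and "X \<inter> Y = {}" "card X = card Y" "finite X" "finite Y"
    and X: "\<And>p. p \<in> X \<Longrightarrow> mate T p \<in> Y" and q: "q \<in> Y"
  shows "mate T q \<in> X"
proof -
  have "inj_on (mate T) X" by (rule inj_onI) (metis UnI1 mate_inj[OF pm])
  then have "mate T ` X = Y" using X assms(3,5) by (intro card_subset_eq) (auto simp: card_image)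
  then obtain p where p: "p \<in> X" "q = mate T p" using q by blast
  then show ?thesis using mate(4)[OF pm, of p] by simp
qed

lemma matching_perm:
  assumes pm: "perfect_matching {1..2 * l} T"
    and bip: "\<And>q. q \<in> {l + 1..2 * l} \<Longrightarrow> mate T q \<in> {1..l}"
  shows "matching_perm l T permutes {1..l}" "T = perm_matching l (matching_perm l T)"
proof -
  define w where "w j = (if j \<in> {1..l} then mate T (2 * l + 1 - j) else j)" for j
  have inj: "inj_on w {1..l}"
  proof (rule inj_onI)
    fix j k assume jk: "j \<in> {1..l}" "k \<in> {1..l}" "w j = w k"
    have "2 * l + 1 - j = 2 * l + 1 - k" by (rule mate_inj[OF pm]) (use jk in \<open>auto simp: w_def\<close>)
    then show "j = k" using jk by auto
  qed
  have "w ` {1..l} \<subseteq> {1..l}"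
  proof
    fix p assume "p \<in> w ` {1..l}"
    then obtain j where j: "j \<in> {1..l}" "p = mate T (2 * l + 1 - j)" by (auto simp: w_def)
    then have "2 * l + 1 - j \<in> {l + 1..2 * l}" by auto
    from bip[OF this] show "p \<in> {1..l}" using j(2) by simp
  qed
  then have "w ` {1..l} = {1..l}" using inj by (intro endo_inj_surj) auto
  then have w: "w permutes {1..l}"
    using inj by (intro bij_imp_permutes) (auto simp: bij_betw_def w_def)
  have wT: "{w j, 2 * l + 1 - j} \<in> T" if "j \<in> {1..l}" for j
  proof -
    have "2 * l + 1 - j \<in> {1..2 * l}" using that by auto
    from mate(1)[OF pm this] show ?thesis using that by (simp add: w_def insert_commute)
  qed
  have "matching_perm l T = w" unfolding matching_perm_def
  proof (rule the_equality)
    fix v assume v: "v permutes {1..l} \<and> (\<forall>j\<in>{1..l}. {v j, 2 * l + 1 - j} \<in> T)"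
    show "v = w"
    proof
      fix j
      show "v j = w j"
      proof (cases "j \<in> {1..l}")
        case True
        then have "{2 * l + 1 - j, v j} \<in> T" using v by (simp add: insert_commute)
        then show ?thesis using mate_eq[OF pm] True by (simp add: w_def)
      next
        case False
        then show ?thesis using v permutes_not_in[of v "{1..l}" j] permutes_not_in[OF w False] by simp
      qed
    qed
  qed (use w wT in blast)
  moreover have "T = perm_matching l w"
  proof (intro equalityI subsetI)
    fix e assume e: "e \<in> T"
    obtain p q where pq: "p \<in> {1..2 * l}" "q \<in> {1..2 * l}" "p < q" "e = {p, q}"
      using edge_cases_less[OF pm e] by blast
    have "q > l"
    proof (rule ccontr)
      assume "\<not> q > l"
      then have q: "q \<in> {1..l}" and p: "p \<in> {1..l}" using pq by auto
      have "{l + 1..2 * l} \<union> {1..l} = {1..2 * l}" by auto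
      then have pm': "perfect_matching ({l + 1..2 * l} \<union> {1..l}) T" using pm by (simp only:)
      have "mate T q \<in> {l + 1..2 * l}" using bip q by (intro mate_bipartite[OF pm']) auto
      moreover have "mate T q = p" using mate_eq[OF pm, of q p] e pq(4) by (simp add: insert_commute)
      ultimately show False using p by auto
    qed
    then have j: "2 * l + 1 - q \<in> {1..l}" "2 * l + 1 - (2 * l + 1 - q) = q" using pq by auto
    have "{q, p} \<in> T" using e pq(4) by (simp add: insert_commute)
    then have "w (2 * l + 1 - q) = p" using j mate_eq[OF pm] by (simp only: w_def if_True)
    then show "e \<in> perm_matching l w"
      unfolding perm_matching_def using j pq(4) by (intro image_eqI[of _ _ "2 * l + 1 - q"]) (simp_all only:)
  next
    fix e assume "e \<in> perm_matching l w"
    then show "e \<in> T" using wT unfolding perm_matching_def by blast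
  qed
  ultimately show "matching_perm l T permutes {1..l}" "T = perm_matching l (matching_perm l T)"
    using w by simp_all
qed

text \<open>Integral combinations of the w P_id. Closure under differences is what the Pluecker
  relation below calls for.\<close>

inductive_set perm_span :: "nat \<Rightarrow> polyfun set" for l where
  perm_span_base: "w permutes {1..l} \<Longrightarrow> perm_act w (id_poly l) \<in> perm_span l"
| perm_span_diff: "g \<in> perm_span l \<Longrightarrow> h \<in> perm_span l \<Longrightarrow> (\<lambda>a. g a - h a) \<in> perm_span l"

text \<open>(x_i - x_j)(x_p - x_q) = (x_i - x_p)(x_j - x_q) - (x_i - x_q)(x_j - x_p), with every
  factor sorted because of the order of the four points.\<close>

lemma matching_fun_pluecker:
  assumes fin: "finite A" and pm: "perfect_matching A T"
    and e: "{i, j} \<in> T" "{p, q} \<in> T" and less: "i < j" "j < p" "p < q"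
  shows "matching_fun T = (\<lambda>a. matching_fun (reconnect T i p) a - matching_fun (reconnect T i q) a :: mpoly)"
proof -
  note A = edge_props(2,3)[OF pm e(1)] edge_props(2,3)[OF pm e(2)]
  have m: "mate T i = j" "mate T p = q" "mate T q = p"
    using mate_eq[OF pm] e by (auto simp: insert_commute)
  have ne: "i \<noteq> p" "i \<noteq> q" using less by auto
  have nT: "{i, p} \<notin> T" "{i, q} \<notin> T" using mate_eq[OF pm, of i p] mate_eq[OF pm, of i q] m less by auto
  have "p \<notin> e' \<longleftrightarrow> q \<notin> e'" if "e' \<in> T" for e'
    using edge_unique[OF pm that e(2), of p] edge_unique[OF pm that e(2), of q] by blast
  then have R: "{e \<in> T. i \<notin> e \<and> q \<notin> e} = {e \<in> T. i \<notin> e \<and> p \<notin> e}" by blast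
  have lt: "i < p" "i < q" "j < q" using less by auto
  show ?thesis
  proof
    fix a :: "nat \<Rightarrow> mpoly"
    show "matching_fun T a = matching_fun (reconnect T i p) a - matching_fun (reconnect T i q) a"
      unfolding matching_fun_split[OF fin pm A(1,3) ne(1) nT(1)]
        matching_fun_reconnect[OF fin pm A(1,3) ne(1) nT(1)]
        matching_fun_reconnect[OF fin pm A(1,4) ne(2) nT(2)] m R
      using less lt by (simp only: Min_Max_pair) (simp only: algebra_simps)
  qed
qed

text \<open>An edge inside the left half forces, by counting, one inside the right half, and the
  Pluecker relation trades the two for edges between the halves. Once no such edge is left, the
  matching is that of a permutation.\<close>

lemma matching_fun_perm_span:
  assumes "perfect_matching {1..2 * l} T"
  shows "matching_fun T \<in> perm_span l"
  using assms
proof (induction "card {e \<in> T. e \<subseteq> {1..l}}" arbitrary: T rule: less_induct)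
  case less
  note pm = less.prems
  have fin: "finite {1..2 * l}" by simp
  note finT = finite_matching[OF pm fin]
  have "{1..l} \<union> {l + 1..2 * l} = {1..2 * l}" "{l + 1..2 * l} \<union> {1..l} = {1..2 * l}" by auto
  then have pm': "perfect_matching ({1..l} \<union> {l + 1..2 * l}) T" "perfect_matching ({l + 1..2 * l} \<union> {1..l}) T"
    using pm by (simp_all only:)
  show ?case
  proof (cases "\<exists>e\<in>T. e \<subseteq> {1..l}")
    case False
    have "mate T p \<in> {l + 1..2 * l}" if "p \<in> {1..l}" for p
    proof -
      have p: "p \<in> {1..2 * l}" using that by auto
      have "\<not> {p, mate T p} \<subseteq> {1..l}" using False mate(1)[OF pm p] by blast
      then have "\<not> mate T p \<in> {1..l}" using that by simp
      then show ?thesis using mate(3)[OF pm p] by auto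
    qed
    then have bip: "mate T q \<in> {1..l}" if "q \<in> {l + 1..2 * l}" for q
      using that by (intro mate_bipartite[OF pm'(1)]) auto
    note w = matching_perm[OF pm bip]
    have "matching_fun T = (matching_fun (perm_matching l (matching_perm l T)) :: polyfun)"
      using w(2) by simp
    also have "\<dots> = perm_act (matching_perm l T) (id_poly l)" by (rule matching_fun_perm_act[OF w(1)])
    finally show ?thesis using perm_span_base[OF w(1)] by simp
  next
    case True
    then obtain e where e: "e \<in> T" "e \<subseteq> {1..l}" by blast
    obtain i j where ij: "i < j" "e = {i, j}" using edge_cases_less[OF pm e(1)] by blast
    have "\<exists>p\<in>{l + 1..2 * l}. mate T p \<notin> {1..l}"
    proof (rule ccontr)
      assume "\<not> ?thesis"
      then have "mate T i \<in> {l + 1..2 * l}" using e ij by (intro mate_bipartite[OF pm'(2)]) auto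
      moreover have "mate T i = j" using mate_eq[OF pm] e ij by simp
      ultimately show False using e ij by auto
    qed
    then obtain p' where p': "p' \<in> {l + 1..2 * l}" "mate T p' \<notin> {1..l}" by blast
    have p'A: "p' \<in> {1..2 * l}" using p'(1) by auto
    have "\<exists>p q. l < p \<and> p < q \<and> {p, q} \<in> T"
    proof (cases "p' < mate T p'")
      case True
      moreover have "l < p'" using p'(1) by simp
      ultimately show ?thesis using mate(1)[OF pm p'A] by blast
    next
      case False
      then have "mate T p' < p'" using mate(2)[OF pm p'A] by simp
      moreover have "l < mate T p'" using mate(3)[OF pm p'A] p'(2) by auto
      moreover have "{mate T p', p'} \<in> T" using mate(1)[OF pm p'A] by (simp add: insert_commute)
      ultimately show ?thesis by blast
    qed
    then obtain p q where pq: "l < p" "p < q" "{p, q} \<in> T" by blast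
    have ijl: "i \<in> {1..l}" "j \<in> {1..l}" and ijT: "{i, j} \<in> T" using e ij by auto
    have "j < p" using ijl pq by auto
    note pl = matching_fun_pluecker[OF fin pm ijT pq(3) ij(1) this pq(2)]
    have A: "i \<in> {1..2 * l}" "p \<in> {1..2 * l}" "q \<in> {1..2 * l}"
      using edge_props[OF pm ijT] edge_props[OF pm pq(3)] by auto
    have step: "matching_fun (reconnect T i r) \<in> perm_span l" if r: "r \<in> {1..2 * l}" "r > l" "mate T r > l" for r
    proof (rule less.hyps)
      show "perfect_matching {1..2 * l} (reconnect T i r)"
        using perfect_matching_reconnect[OF pm A(1) r(1)] r ijl by auto
      have "{e \<in> reconnect T i r. e \<subseteq> {1..l}} \<subseteq> {e \<in> T. e \<subseteq> {1..l}} - {{i, j}}"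
      proof
        fix f assume f: "f \<in> {e \<in> reconnect T i r. e \<subseteq> {1..l}}"
        have "r \<notin> {1..l}" "mate T r \<notin> {1..l}" using r(2,3) by simp_all
        then have "f \<noteq> {i, r}" "f \<noteq> {mate T i, mate T r}" using f by blast+
        then have "f \<in> T" "i \<notin> f" using f unfolding reconnect_def by blast+
        then show "f \<in> {e \<in> T. e \<subseteq> {1..l}} - {{i, j}}" using f by blast
      qed
      then have "card {e \<in> reconnect T i r. e \<subseteq> {1..l}} \<le> card ({e \<in> T. e \<subseteq> {1..l}} - {{i, j}})"
        using finT by (intro card_mono) auto
      also have "\<dots> < card {e \<in> T. e \<subseteq> {1..l}}" using finT e ij by (intro card_Diff1_less) auto
      finally show "card {e \<in> reconnect T i r. e \<subseteq> {1..l}} < card {e \<in> T. e \<subseteq> {1..l}}" .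
    qed
    have m: "mate T p = q" "mate T q = p" using mate_eq[OF pm] pq(3) by (auto simp: insert_commute)
    show ?thesis unfolding pl using step[of p] step[of q] A m pq by (intro perm_span_diff) auto
  qed
qed

section \<open>Leading terms\<close>

definition lr_maxima :: "nat \<Rightarrow> (nat \<Rightarrow> nat) \<Rightarrow> nat set" where
  "lr_maxima l w = {j \<in> {1..l}. \<forall>k. 1 \<le> k \<longrightarrow> k < j \<longrightarrow> w k < w j}"

text \<open>A permutation avoiding 321 is increasing on its left-to-right maxima and on their complement,
  so it is lexicographically minimal among the permutations with the same image of the maxima.
  Evaluating at the indicator of \<open>lead_set\<close> selects the permutations with that image.\<close>

definition lead_set :: "nat \<Rightarrow> (nat \<Rightarrow> nat) \<Rightarrow> nat set" where
  "lead_set l w = w ` lr_maxima l w \<union> (\<lambda>j. 2 * l + 1 - j) ` ({1..l} - lr_maxima l w)"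

definition lead_eval :: "nat \<Rightarrow> (nat \<Rightarrow> nat) \<Rightarrow> polyfun \<Rightarrow> complex" where
  "lead_eval l w v = eval01 (lead_set l w) (v mvar)"

lemma lead_set_iff:
  assumes w: "w permutes {1..l}" and u: "u permutes {1..l}" and j: "j \<in> {1..l}"
  shows "u j \<in> lead_set l w \<longleftrightarrow> u j \<in> w ` lr_maxima l w"
    and "2 * l + 1 - j \<in> lead_set l w \<longleftrightarrow> j \<notin> lr_maxima l w"
proof -
  let ?S = "lr_maxima l w"
  have S: "?S \<subseteq> {1..l}" by (auto simp: lr_maxima_def)
  have wS: "w ` ?S \<subseteq> {1..l}" using S permutes_image[OF w] by blast
  have uj: "u j \<in> {1..l}" using permutes_in_image[OF u, of j] j by simp
  have "u j \<noteq> 2 * l + 1 - k" if "k \<in> {1..l}" for k using uj that by auto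
  then show "u j \<in> lead_set l w \<longleftrightarrow> u j \<in> w ` ?S" unfolding lead_set_def by blast
  have "2 * l + 1 - j \<notin> w ` ?S"
  proof
    assume "2 * l + 1 - j \<in> w ` ?S"
    then have "2 * l + 1 - j \<in> {1..l}" using wS by blast
    then show False using j by auto
  qed
  moreover have "k = j" if "2 * l + 1 - j = 2 * l + 1 - k" "k \<in> {1..l}" for k using that j by auto
  ultimately show "2 * l + 1 - j \<in> lead_set l w \<longleftrightarrow> j \<notin> ?S" unfolding lead_set_def using j by blast
qed

text \<open>A factor vanishes exactly when \<open>u\<close> sends a maximum outside the image of the
  maxima or a non-maximum into it; every other factor is 1 or -1.\<close>

lemma lead_eval_perm_act:
  assumes w: "w permutes {1..l}" and u: "u permutes {1..l}"
  shows "lead_eval l w (perm_act u (id_poly l)) =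
    (\<Prod>j\<in>{1..l}. of_bool (u j \<in> w ` lr_maxima l w) - of_bool (j \<notin> lr_maxima l w))"
proof -
  have "lead_eval l w (perm_act u (id_poly l)) =
      matching_fun (perm_matching l u) (\<lambda>i. of_bool (i \<in> lead_set l w))"
    unfolding lead_eval_def matching_fun_perm_act[OF u, symmetric]
    using eval01_matching_fun[of "lead_set l w" "perm_matching l u" id] by simp
  also have "\<dots> = (\<Prod>j\<in>{1..l}. of_bool (u j \<in> lead_set l w) - of_bool (2 * l + 1 - j \<in> lead_set l w))"
    by (rule matching_fun_perm_matching[OF u])
  also have "\<dots> = (\<Prod>j\<in>{1..l}. of_bool (u j \<in> w ` lr_maxima l w) - of_bool (j \<notin> lr_maxima l w))"
    by (rule prod.cong[OF refl]) (simp only: lead_set_iff[OF w u])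
  finally show ?thesis .
qed

lemma norm_lead_eval_self:
  assumes w: "w permutes {1..l}"
  shows "norm (lead_eval l w (perm_act w (id_poly l))) = 1"
proof -
  have "w j \<in> w ` lr_maxima l w \<longleftrightarrow> j \<in> lr_maxima l w" for j
    using permutes_inj[OF w] by (simp add: inj_image_mem_iff)
  then show ?thesis unfolding lead_eval_perm_act[OF w w] prod_norm[symmetric]
    by (intro prod.neutral ballI) simp
qed

text \<open>At the first \<open>k\<close> where \<open>u\<close> and \<open>w\<close> differ,
  \<open>w\<close> takes the value \<open>u k\<close> at a later position \<open>m\<close>. A
  nonzero value makes \<open>k\<close> and \<open>m\<close> both maxima or both non-maxima, and
  \<open>w\<close> increases on either kind.\<close>

lemma lead_eval_nonzero:
  assumes w: "w \<in> avoiding321 l" and u: "u permutes {1..l}"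
    and nz: "lead_eval l w (perm_act u (id_poly l)) \<noteq> 0"
  shows "u = w \<or> less_fun w u"
proof (cases "u = w")
  case False
  let ?S = "lr_maxima l w"
  have wp: "w permutes {1..l}" and av: "avoids321 l w" using w by (auto simp: avoiding321_iff)
  have S: "u j \<in> w ` ?S \<longleftrightarrow> j \<in> ?S" if "j \<in> {1..l}" for j
  proof -
    have "of_bool (u j \<in> w ` ?S) - of_bool (j \<notin> ?S) \<noteq> (0 :: complex)"
      using nz that unfolding lead_eval_perm_act[OF wp u] by (simp only: prod_zero_iff finite_atLeastAtMost) blast
    then show ?thesis by (cases "u j \<in> w ` ?S"; cases "j \<in> ?S") simp_all
  qed
  define k where "k = (LEAST k. u k \<noteq> w k)"
  have "\<exists>k. u k \<noteq> w k" using False by (auto simp: fun_eq_iff)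
  then have k: "u k \<noteq> w k" unfolding k_def by (rule LeastI_ex)
  have less: "u k' = w k'" if "k' < k" for k' using not_less_Least[of k' "\<lambda>k. u k \<noteq> w k"] that by (auto simp: k_def)
  have kl: "k \<in> {1..l}"
  proof (rule ccontr)
    assume "k \<notin> {1..l}"
    then show False using k permutes_not_in[OF u] permutes_not_in[OF wp] by simp
  qed
  define m where "m = inv' w (u k)"
  have wm: "w m = u k" by (simp add: m_def permutes_inverses[OF wp])
  have "u k \<in> {1..l}" using permutes_in_image[OF u, of k] kl by simp
  then have ml: "m \<in> {1..l}" using permutes_in_image[OF wp, of m] wm by simp
  have iff: "m \<in> ?S \<longleftrightarrow> k \<in> ?S"
    using S[OF kl] permutes_inj[OF wp] unfolding wm[symmetric] by (simp add: inj_image_mem_iff)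
  have "\<not> m < k"
  proof
    assume "m < k"
    then have "u m = u k" using less wm by simp
    then have "m = k" using permutes_inj[OF u] by (simp add: inj_eq)
    then show False using \<open>m < k\<close> by simp
  qed
  moreover have "m \<noteq> k" using wm k by auto
  ultimately have km: "k < m" by simp
  have "w k < w m"
  proof (cases "k \<in> ?S")
    case True
    then have "m \<in> ?S" using iff by simp
    then show ?thesis using km kl by (auto simp: lr_maxima_def)
  next
    case False
    \<comment> \<open>The earlier larger entry at \<open>i\<close> would complete a decrease from
      \<open>k\<close> to \<open>m\<close> to a 321-pattern.\<close>
    then obtain i where i: "1 \<le> i" "i < k" "\<not> w i < w k" using kl by (auto simp: lr_maxima_def)
    have inj: "w a = w b \<longleftrightarrow> a = b" for a b using permutes_inj[OF wp] by (simp add: inj_eq)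
    have "w k < w i" using i inj[of i k] by linarith
    then have "\<not> w m < w k" using avoids321D[OF av, of i k m] i km ml by auto
    then show ?thesis using inj[of k m] km by linarith
  qed
  then have "less_fun w u" using less unfolding wm by (intro less_funI) auto
  then show ?thesis ..
qed simp

text \<open>Together with \<open>word_act_reduced\<close>, this makes the evaluation see only the
  leading term of t_v P_id.\<close>

lemma lead_eval_lower:
  assumes "g \<in> lower l (id_poly l) v" "w \<in> avoiding321 l" "v = w \<or> less_fun v w"
  shows "lead_eval l w g = 0"
  using assms(1)
proof (induction rule: lower.induct)
  case (lower_perm u)
  have uw: "less_fun u w" using lower_perm(2) assms(3) by (auto intro: less_fun_trans)
  show ?case
  proof (rule ccontr)
    assume "lead_eval l w (perm_act u (id_poly l)) \<noteq> 0"
    then have "u = w \<or> less_fun w u" by (rule lead_eval_nonzero[OF assms(2) lower_perm(1)])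
    then show False using uw less_fun_asym less_fun_irrefl by blast
  qed
qed (simp_all add: lead_eval_def eval01_diff)

lemma lead_eval_word_act:
  assumes v: "v \<in> avoiding321 l" and w: "w \<in> avoiding321 l" and vw: "v = w \<or> less_fun v w"
  shows "lead_eval l w (word_act (red_word l v) (id_poly l)) = lead_eval l w (perm_act v (id_poly l))"
proof -
  have "v permutes {1..l}" using v by (simp add: avoiding321_iff)
  note red = red_word(1,2)[OF this]
  have "lead_eval l w (\<lambda>a. word_act (red_word l v) (id_poly l) a - perm_act v (id_poly l) a) = 0"
    by (rule lead_eval_lower[OF _ w vw]) (use word_act_reduced[OF red(1)] red(2) in simp)
  then show ?thesis by (simp add: lead_eval_def eval01_diff)
qed

lemma norm_matching_fun_01:
  "norm (matching_fun T (\<lambda>i. of_bool (i \<in> S)) :: complex) \<in> {0, 1}"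
proof -
  have "norm (of_bool (Min e \<in> S) - of_bool (Max e \<in> S) :: complex) \<in> {0, 1}" for e
    by (cases "Min e \<in> S"; cases "Max e \<in> S") simp_all
  then have "(\<Prod>e\<in>T. norm (of_bool (Min e \<in> S) - of_bool (Max e \<in> S) :: complex)) \<in> {0, 1}"
    by (induction T rule: infinite_finite_induct) auto
  then show ?thesis by (simp add: matching_fun_def prod_norm)
qed

definition kauffman_diagram :: "nat \<Rightarrow> (nat \<Rightarrow> nat) \<Rightarrow> nat set set" where
  "kauffman_diagram l w = snd (kauffman l w)"

text \<open>2^n times the absolute value, 0 or 1, of a matching polynomial at the leading point
  equals 1. So no closed loop arises along the chosen reduced word.\<close>

lemma kauffman_avoiding:
  assumes w: "w \<in> avoiding321 l"
  shows "kauffman l w = (1, kauffman_diagram l w)" "kauffman_diagram l w \<in> nc_matchings l"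
    "word_act (red_word l w) (id_poly l) = matching_fun (kauffman_diagram l w)"
proof -
  have wp: "w permutes {1..l}" using w by (simp add: avoiding321_iff)
  note wd = word_diagram[OF red_word(3)[OF wp], folded kauffman_eq]
  obtain n where n: "fst (kauffman l w) = (- 2) ^ n" using wd(2) by blast
  let ?e = "matching_fun (kauffman_diagram l w) (\<lambda>i. of_bool (i \<in> lead_set l w)) :: complex"
  have "1 = norm (lead_eval l w (word_act (red_word l w) (id_poly l)))"
    using lead_eval_word_act[OF w w] norm_lead_eval_self[OF wp] by simp
  also have "\<dots> = norm ((- 2) ^ n * ?e)" unfolding wd(3) lead_eval_def n kauffman_diagram_def
    using eval01_matching_fun[of "lead_set l w" _ id] by (simp add: eval01_mult)
  also have "\<dots> = 2 ^ n * norm ?e" by (simp add: norm_mult norm_power)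
  finally have "(2 :: real) ^ n * norm ?e = 1" by simp
  moreover have "norm ?e = 0 \<or> norm ?e = 1" using norm_matching_fun_01 by blast
  ultimately have "(2 :: real) ^ n = 1" by (elim disjE) simp_all
  then have "n = 0" using one_less_power[of "2 :: real" n] by (cases "n = 0") auto
  then have one: "fst (kauffman l w) = 1" using n by simp
  then show "kauffman l w = (1, kauffman_diagram l w)"
    unfolding kauffman_diagram_def by (metis prod.collapse)
  show "kauffman_diagram l w \<in> nc_matchings l" using wd(1) by (simp add: kauffman_diagram_def)
  show "word_act (red_word l w) (id_poly l) = matching_fun (kauffman_diagram l w)"
    unfolding wd(3) one by (simp add: kauffman_diagram_def cst_simps)
qed

text \<open>If \<open>v\<close> is lexicographically below \<open>w\<close>, evaluation at the point
  of \<open>w\<close> is nonzero on t_w P_id but zero on t_v P_id.\<close>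

lemma kauffman_diagram_inj: "inj_on (kauffman_diagram l) (avoiding321 l)"
proof (rule inj_onI, rule ccontr)
  fix v w assume v: "v \<in> avoiding321 l" and w: "w \<in> avoiding321 l"
    and eq: "kauffman_diagram l v = kauffman_diagram l w" and ne: "v \<noteq> w"
  have perm: "v permutes {1..l}" "w permutes {1..l}" using v w by (simp_all add: avoiding321_iff)
  have act: "word_act (red_word l v) (id_poly l) = word_act (red_word l w) (id_poly l)"
    using kauffman_avoiding(3)[OF v] kauffman_avoiding(3)[OF w] eq by simp
  have contra: False if x: "x \<in> avoiding321 l" and y: "y \<in> avoiding321 l" and less: "less_fun x y"
    and eq: "word_act (red_word l x) (id_poly l) = word_act (red_word l y) (id_poly l)" for x y
  proof -
    have xp: "x permutes {1..l}" and yp: "y permutes {1..l}" using x y by (simp_all add: avoiding321_iff)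
    have "lead_eval l y (perm_act x (id_poly l)) = lead_eval l y (perm_act y (id_poly l))"
      using lead_eval_word_act[OF x y] lead_eval_word_act[OF y y] less eq by simp
    then have "lead_eval l y (perm_act x (id_poly l)) \<noteq> 0" using norm_lead_eval_self[OF yp] by auto
    from lead_eval_nonzero[OF y xp this] show False
      using less less_fun_asym less_fun_irrefl by blast
  qed
  have "{k. v k \<noteq> w k} \<subseteq> {1..l}"
    using permutes_not_in[OF perm(1)] permutes_not_in[OF perm(2)] by fastforce
  then have "finite {k. v k \<noteq> w k}" by (rule finite_subset) simp
  then have "less_fun v w \<or> v = w \<or> less_fun w v" by (rule less_fun_trichotomy)
  then show False using contra[OF v w _ act] contra[OF w v _ act[symmetric]] ne by blast
qed

lemma finite_avoiding321: "finite (avoiding321 l)"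
  by (rule finite_subset[OF _ finite_permutations[of "{1..l}"]]) (auto simp: avoiding321_iff)

lemma kauffman_diagram_sum:
  "(\<Sum>w\<in>avoiding321 l. cst (c w) * matching_poly (kauffman_diagram l w)) =
    (\<Sum>D\<in>nc_matchings l. cst (if D \<in> kauffman_diagram l ` avoiding321 l
       then c (inv_into (avoiding321 l) (kauffman_diagram l) D) else 0) * matching_poly D)"
proof -
  let ?A = "avoiding321 l" and ?k = "kauffman_diagram l"
  let ?c = "\<lambda>D. if D \<in> ?k ` ?A then c (inv_into ?A ?k D) else 0"
  have "(\<Sum>D\<in>nc_matchings l. cst (?c D) * matching_poly D) = (\<Sum>D\<in>?k ` ?A. cst (?c D) * matching_poly D)"
    using kauffman_avoiding(2) finite_nc_matchings by (intro sum.mono_neutral_right) (auto simp: cst_simps)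
  also have "\<dots> = (\<Sum>w\<in>?A. cst (?c (?k w)) * matching_poly (?k w))"
    by (rule sum.reindex[OF kauffman_diagram_inj, unfolded comp_def])
  also have "\<dots> = (\<Sum>w\<in>?A. cst (c w) * matching_poly (?k w))"
    by (rule sum.cong[OF refl]) (simp add: inv_into_f_f[OF kauffman_diagram_inj])
  finally show ?thesis by simp
qed

lemma kauffman_diagram_independent:
  assumes "(\<Sum>w\<in>avoiding321 l. cst (c w) * matching_poly (kauffman_diagram l w)) = 0" "w \<in> avoiding321 l"
  shows "c w = 0"
proof -
  note sum0 = assms(1)[unfolded kauffman_diagram_sum]
  from nc_matchings_independent[OF sum0 kauffman_avoiding(2)[OF assms(2)]] show ?thesis
    using assms(2) inv_into_f_f[OF kauffman_diagram_inj assms(2)] by simp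
qed

section \<open>The Temperley-Lieb algebra\<close>

lemma monoid_word: "monoid (word_monoid l)"
  by (rule monoidI) (auto simp: word_monoid_def)

lemma word_monoid_simps [simp]:
  "carrier (word_monoid l) = lists {1..<l}" "u \<otimes>\<^bsub>word_monoid l\<^esub> v = u @ v" "\<one>\<^bsub>word_monoid l\<^esub> = []"
  by (simp_all add: word_monoid_def)

lemma ring_free: "ring (free_algebra l)"
  by (rule ring_monoid_algebra[OF monoid_word])

lemma monoid_algebra_mult_diff:
  assumes "f \<in> carrier (monoid_algebra G)" "g \<in> carrier (monoid_algebra G)" "h \<in> carrier (monoid_algebra G)"
  shows "f \<otimes>\<^bsub>monoid_algebra G\<^esub> (\<lambda>x. g x - c * h x) =
      (\<lambda>x. (f \<otimes>\<^bsub>monoid_algebra G\<^esub> g) x - c * (f \<otimes>\<^bsub>monoid_algebra G\<^esub> h) x)" (is ?r)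
    and "(\<lambda>x. g x - c * h x) \<otimes>\<^bsub>monoid_algebra G\<^esub> f =
      (\<lambda>x. (g \<otimes>\<^bsub>monoid_algebra G\<^esub> f) x - c * (h \<otimes>\<^bsub>monoid_algebra G\<^esub> f) x)" (is ?l)
proof -
  let ?F = "{x. f x \<noteq> 0}" and ?H = "{x. g x \<noteq> 0} \<union> {x. h x \<noteq> 0}"
  have fin: "finite ?F" "finite ?H" using assms by (auto simp: monoid_algebra_carrier)
  have sub: "{x. g x - c * h x \<noteq> 0} \<subseteq> ?H" "{x. g x \<noteq> 0} \<subseteq> ?H" "{x. h x \<noteq> 0} \<subseteq> ?H" by auto
  show ?r
  proof
    fix x
    show "(f \<otimes>\<^bsub>monoid_algebra G\<^esub> (\<lambda>x. g x - c * h x)) x =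
        (f \<otimes>\<^bsub>monoid_algebra G\<^esub> g) x - c * (f \<otimes>\<^bsub>monoid_algebra G\<^esub> h) x"
      unfolding monoid_algebra_mult[OF fin order_refl sub(1)] monoid_algebra_mult[OF fin order_refl sub(2)]
        monoid_algebra_mult[OF fin order_refl sub(3)] sum_distrib_left sum_subtractf[symmetric]
      by (intro sum.cong refl) (simp add: algebra_simps)
  qed
  show ?l
  proof
    fix x
    show "((\<lambda>x. g x - c * h x) \<otimes>\<^bsub>monoid_algebra G\<^esub> f) x =
        (g \<otimes>\<^bsub>monoid_algebra G\<^esub> f) x - c * (h \<otimes>\<^bsub>monoid_algebra G\<^esub> f) x"
      unfolding monoid_algebra_mult[OF fin(2,1) sub(1) order_refl] monoid_algebra_mult[OF fin(2,1) sub(2) order_refl]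
        monoid_algebra_mult[OF fin(2,1) sub(3) order_refl] sum_distrib_left sum_subtractf[symmetric]
      by (intro sum.cong refl) (simp add: algebra_simps)
  qed
qed

text \<open>All relators and all consequences of rewriting have this two-term shape, which
  multiplication by words on either side preserves.\<close>

definition word_diff :: "nat list \<Rightarrow> complex \<Rightarrow> nat list \<Rightarrow> nat list \<Rightarrow> complex" where
  "word_diff u c v = (\<lambda>x. delta u x - c * delta v x)"

lemma word_diff_carrier: "u \<in> lists {1..<l} \<Longrightarrow> v \<in> lists {1..<l} \<Longrightarrow> word_diff u c v \<in> carrier (free_algebra l)"
  unfolding word_diff_def by (intro diff_carrier scale_carrier) (simp_all del: lists.simps)

lemma word_diff_mult_left:
  assumes "u \<in> lists {1..<l}" "v \<in> lists {1..<l}" "w \<in> lists {1..<l}"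
  shows "delta w \<otimes>\<^bsub>free_algebra l\<^esub> word_diff u c v = word_diff (w @ u) c (w @ v)"
  unfolding word_diff_def using assms by (subst monoid_algebra_mult_diff(1)) (simp_all add: delta_mult)

lemma word_diff_mult_right:
  assumes "u \<in> lists {1..<l}" "v \<in> lists {1..<l}" "w \<in> lists {1..<l}"
  shows "word_diff u c v \<otimes>\<^bsub>free_algebra l\<^esub> delta w = word_diff (u @ w) c (v @ w)"
  unfolding word_diff_def using assms by (subst monoid_algebra_mult_diff(2)) (simp_all add: delta_mult)

lemma setcompr_cong:
  "(\<And>i. P i \<Longrightarrow> F i = G i) \<Longrightarrow> {F i | i. P i} = {G i | i. P i}"
  by (intro Collect_cong iffI; elim exE; metis)

lemma setcompr_cong2:
  "(\<And>i j. Q i j \<Longrightarrow> F i j = G i j) \<Longrightarrow> {F i j | i j. Q i j} = {G i j | i j. Q i j}"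
  by (intro Collect_cong iffI; elim exE; metis)

lemma tl_relators_eq:
  "tl_relators l = {word_diff [i, i] (- 2) [i] | i. i \<in> {1..<l}} \<union>
     {word_diff [i, j, i] 1 [i] | i j. i \<in> {1..<l} \<and> j \<in> {1..<l} \<and> \<bar>int i - int j\<bar> = 1} \<union>
     {word_diff [i, j] 1 [j, i] | i j. i \<in> {1..<l} \<and> j \<in> {1..<l} \<and> \<bar>int i - int j\<bar> \<ge> 2}"
proof -
  have d: "delta u \<in> carrier (free_algebra l)" if "set u \<subseteq> {1..<l}" for u
    using that by (auto simp: in_lists_conv_set)
  have minus: "delta u \<ominus>\<^bsub>free_algebra l\<^esub> delta v = word_diff u 1 v" if "set u \<subseteq> {1..<l}" "set v \<subseteq> {1..<l}" for u v
    using monoid_algebra_minus[OF monoid_word d[OF that(1)] d[OF that(2)]] by (simp add: word_diff_def)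
  have minus2: "delta u \<ominus>\<^bsub>free_algebra l\<^esub> scalar (word_monoid l) (- 2) \<otimes>\<^bsub>free_algebra l\<^esub> delta v = word_diff u (- 2) v"
    if "set u \<subseteq> {1..<l}" "set v \<subseteq> {1..<l}" for u v
    using monoid_algebra_minus[OF monoid_word d[OF that(1)] scale_carrier[OF d[OF that(2)], of "- 2"]]
    unfolding scale_delta_mult[OF monoid_word d[OF that(2)]] by (simp add: word_diff_def)
  have "{delta [i, i] \<ominus>\<^bsub>free_algebra l\<^esub> scalar (word_monoid l) (- 2) \<otimes>\<^bsub>free_algebra l\<^esub> delta [i] | i. i \<in> {1..<l}}
      = {word_diff [i, i] (- 2) [i] | i. i \<in> {1..<l}}"
    by (rule setcompr_cong, rule minus2) auto
  moreover have "{delta [i, j, i] \<ominus>\<^bsub>free_algebra l\<^esub> delta [i] | i j. i \<in> {1..<l} \<and> j \<in> {1..<l} \<and> \<bar>int i - int j\<bar> = 1}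
      = {word_diff [i, j, i] 1 [i] | i j. i \<in> {1..<l} \<and> j \<in> {1..<l} \<and> \<bar>int i - int j\<bar> = 1}"
    by (rule setcompr_cong2, rule minus) auto
  moreover have "{delta [i, j] \<ominus>\<^bsub>free_algebra l\<^esub> delta [j, i] | i j. i \<in> {1..<l} \<and> j \<in> {1..<l} \<and> \<bar>int i - int j\<bar> \<ge> 2}
      = {word_diff [i, j] 1 [j, i] | i j. i \<in> {1..<l} \<and> j \<in> {1..<l} \<and> \<bar>int i - int j\<bar> \<ge> 2}"
    by (rule setcompr_cong2, rule minus) auto
  ultimately show ?thesis unfolding tl_relators_def by simp
qed

lemma tl_relators_carrier: "tl_relators l \<subseteq> carrier (free_algebra l)"
  unfolding tl_relators_eq using word_diff_carrier by fastforce

lemma ideal_tl_ideal: "ideal (tl_ideal l) (free_algebra l)"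
  unfolding tl_ideal_def by (rule ring.genideal_ideal[OF ring_free tl_relators_carrier])

lemma tl_relators_tl_ideal: "tl_relators l \<subseteq> tl_ideal l"
  unfolding tl_ideal_def by (rule ring.genideal_self[OF ring_free tl_relators_carrier])

lemma tl_ideal_carrier: "f \<in> tl_ideal l \<Longrightarrow> f \<in> carrier (free_algebra l)"
  using additive_subgroup.a_subset[OF ideal.axioms(1)[OF ideal_tl_ideal]] by blast

lemma tl_ideal_zero: "(\<lambda>_. 0) \<in> tl_ideal l"
  using additive_subgroup.zero_closed[OF ideal.axioms(1)[OF ideal_tl_ideal]]
  by (simp add: monoid_algebra_zero)

lemma tl_ideal_add: "f \<in> tl_ideal l \<Longrightarrow> g \<in> tl_ideal l \<Longrightarrow> (\<lambda>x. f x + g x) \<in> tl_ideal l"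
  using additive_subgroup.a_closed[OF ideal.axioms(1)[OF ideal_tl_ideal]]
  by (simp add: monoid_algebra_add)

lemma tl_ideal_scale:
  assumes "f \<in> tl_ideal l"
  shows "(\<lambda>x. c * f x) \<in> tl_ideal l"
  using ideal.I_l_closed[OF ideal_tl_ideal assms scalar_carrier[OF monoid_word], of c]
  by (simp only: scale_delta_mult[OF monoid_word tl_ideal_carrier[OF assms]])

lemma tl_ideal_sum:
  assumes "finite S" "\<And>s. s \<in> S \<Longrightarrow> f s \<in> tl_ideal l"
  shows "(\<lambda>x. \<Sum>s\<in>S. c s * f s x) \<in> tl_ideal l"
  using assms
proof (induction S rule: finite_induct)
  case (insert s S)
  have "(\<lambda>x. c s * f s x + (\<Sum>s\<in>S. c s * f s x)) \<in> tl_ideal l"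
    using insert by (intro tl_ideal_add tl_ideal_scale) auto
  then show ?case using insert by simp
qed (simp add: tl_ideal_zero)

lemma tl_cong_ideal:
  "tl_cong l u n v \<Longrightarrow> word_diff u ((- 2) ^ n) v \<in> tl_ideal l"
proof (induction rule: tl_cong.induct)
  case (tl_cong_refl u)
  then show ?case using tl_ideal_zero by (simp add: word_diff_def)
next
  case (tl_cong_trans u m v n w)
  \<comment> \<open>Telescoping: u - (-2)^(m+n) w = (u - (-2)^m v) + (-2)^m (v - (-2)^n w).\<close>
  have "(\<lambda>x. word_diff u ((- 2) ^ m) v x + (- 2) ^ m * word_diff v ((- 2) ^ n) w x) \<in> tl_ideal l"
    by (intro tl_ideal_add tl_ideal_scale tl_cong_trans.IH)
  moreover have "(\<lambda>x. word_diff u ((- 2) ^ m) v x + (- 2) ^ m * word_diff v ((- 2) ^ n) w x) = word_diff u ((- 2) ^ (m + n)) w"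
    by (simp add: word_diff_def algebra_simps power_add)
  ultimately show ?case by simp
next
  case (tl_cong_Cons u n v i)
  then have "delta [i] \<otimes>\<^bsub>free_algebra l\<^esub> word_diff u ((- 2) ^ n) v \<in> tl_ideal l"
    by (intro ideal.I_l_closed[OF ideal_tl_ideal]) (auto simp: in_lists_conv_set)
  then show ?case
    using word_diff_mult_left[of u l v "[i]"] tl_cong_lists[OF tl_cong_Cons.hyps(1)] tl_cong_Cons.hyps(2) by simp
next
  case (tl_cong_square i u)
  then have "word_diff [i, i] (- 2) [i] \<in> tl_relators l" unfolding tl_relators_eq by blast
  then have "word_diff [i, i] (- 2) [i] \<otimes>\<^bsub>free_algebra l\<^esub> delta u \<in> tl_ideal l"
    using tl_relators_tl_ideal tl_cong_square by (intro ideal.I_r_closed[OF ideal_tl_ideal]) auto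
  then show ?case using word_diff_mult_right[of "[i, i]" l "[i]" u] tl_cong_square by simp
next
  case (tl_cong_braid i j u)
  then have "\<bar>int i - int j\<bar> = 1" by auto
  then have "word_diff [i, j, i] 1 [i] \<in> tl_relators l" unfolding tl_relators_eq using tl_cong_braid by blast
  then have "word_diff [i, j, i] 1 [i] \<otimes>\<^bsub>free_algebra l\<^esub> delta u \<in> tl_ideal l"
    using tl_relators_tl_ideal tl_cong_braid by (intro ideal.I_r_closed[OF ideal_tl_ideal]) auto
  then show ?case using word_diff_mult_right[of "[i, j, i]" l "[i]" u] tl_cong_braid by simp
next
  case (tl_cong_commute i j u)
  then have "\<bar>int i - int j\<bar> \<ge> 2" by auto
  then have "word_diff [i, j] 1 [j, i] \<in> tl_relators l" unfolding tl_relators_eq using tl_cong_commute by blast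
  then have "word_diff [i, j] 1 [j, i] \<otimes>\<^bsub>free_algebra l\<^esub> delta u \<in> tl_ideal l"
    using tl_relators_tl_ideal tl_cong_commute by (intro ideal.I_r_closed[OF ideal_tl_ideal]) auto
  then show ?case using word_diff_mult_right[of "[i, j]" l "[j, i]" u] tl_cong_commute by simp
qed

section \<open>The action of the free algebra and its kernel\<close>

abbreviation ev :: "(nat list \<Rightarrow> complex) \<Rightarrow> polyfun \<Rightarrow> polyfun" where
  "ev \<equiv> lin_ext word_act"

lemma finite_support: "f \<in> carrier (monoid_algebra G) \<Longrightarrow> finite {x. f x \<noteq> 0}"
  by (simp add: monoid_algebra_carrier)

lemma ev_mult:
  "f \<in> carrier (free_algebra l) \<Longrightarrow> g \<in> carrier (free_algebra l) \<Longrightarrow>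
    ev (f \<otimes>\<^bsub>free_algebra l\<^esub> g) v = ev f (ev g v)"
  by (rule lin_ext_mult[OF monoid_word]) (auto simp: linear_word_act word_act_append)

lemma ev_word_diff: "ev (word_diff u c v) w = (\<lambda>a. word_act u w a - cst c * word_act v w a)"
  unfolding word_diff_def
  by (subst lin_ext_diff; (subst lin_ext_scale)?; (simp add: support_delta lin_ext_delta)?)

lemma word_act_nc_matching:
  assumes "is \<in> lists {1..<l}" "D \<in> nc_matchings l"
  shows "\<exists>c E. E \<in> nc_matchings l \<and> word_act is (matching_fun D) = (\<lambda>a. cst c * matching_fun E a)"
  using assms(1)
proof (induction "is" rule: list.induct)
  case Nil
  then show ?case using assms(2) by (intro exI[of _ 1] exI[of _ D]) (simp add: cst_simps)
next
  case (Cons i "is")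
  then have i: "i \<in> {1..<l}" and "is \<in> lists {1..<l}" by auto
  then obtain c E where E: "E \<in> nc_matchings l" "word_act is (matching_fun D) = (\<lambda>a. cst c * matching_fun E a)"
    using Cons.IH by blast
  obtain d where d: "tl_op i (matching_fun E) = (\<lambda>a. cst d * matching_fun (reconnect E i (i + 1)) a)"
    using tl_op_nc_matching[OF E(1) i] by blast
  have "word_act (i # is) (matching_fun D) = (\<lambda>a. cst (c * d) * matching_fun (reconnect E i (i + 1)) a)"
    unfolding word_act_simps E(2) tl_op_scale d by (simp add: cst_simps mult.assoc)
  moreover have "i \<in> {1..<2 * l}" using i by auto
  then have "reconnect E i (i + 1) \<in> nc_matchings l" by (rule nc_matchings_reconnect[OF E(1)])
  ultimately show ?case by blast
qed

text \<open>Killing P_id alone would a priori give only a left ideal. Asking for all noncrossing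
  polynomials makes the ideal two-sided, and on these polynomials the braid relation holds.\<close>

definition annihilator :: "nat \<Rightarrow> (nat list \<Rightarrow> complex) set" where
  "annihilator l = {f \<in> carrier (free_algebra l). \<forall>D\<in>nc_matchings l. ev f (matching_fun D) = (\<lambda>_. 0)}"

lemma ideal_annihilator: "ideal (annihilator l) (free_algebra l)"
proof (rule idealI[OF ring_free])
  interpret F: ring "free_algebra l" by (rule ring_free)
  have lin: "linear_op (ev f)" for f by (rule linear_op_lin_ext) (rule linear_word_act)
  show "subgroup (annihilator l) (add_monoid (free_algebra l))"
  proof (rule group.subgroupI[OF F.a_group])
    show "annihilator l \<subseteq> carrier (add_monoid (free_algebra l))" by (auto simp: annihilator_def)
    have "(\<lambda>_. 0) \<in> annihilator l"
      using F.zero_closed by (simp add: annihilator_def monoid_algebra_zero lin_ext_def)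
    then show "annihilator l \<noteq> {}" by blast
  next
    fix f assume f: "f \<in> annihilator l"
    then have fc: "f \<in> carrier (free_algebra l)" by (simp add: annihilator_def)
    have "\<ominus>\<^bsub>free_algebra l\<^esub> f = \<zero>\<^bsub>free_algebra l\<^esub> \<ominus>\<^bsub>free_algebra l\<^esub> f"
      using fc by (simp add: F.minus_eq)
    also have "\<dots> = (\<lambda>x. - 1 * f x)"
      unfolding monoid_algebra_minus[OF monoid_word F.zero_closed fc] by (simp add: monoid_algebra_zero)
    finally have "inv\<^bsub>add_monoid (free_algebra l)\<^esub> f = (\<lambda>x. - 1 * f x)" by (simp only: a_inv_def)
    moreover have "(\<lambda>x. - 1 * f x) \<in> annihilator l"
      using f scale_carrier[OF fc, of "- 1"] lin_ext_scale[OF finite_support[OF fc], of word_act "- 1"]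
      by (simp add: annihilator_def del: mult_minus1)
    ultimately show "inv\<^bsub>add_monoid (free_algebra l)\<^esub> f \<in> annihilator l" by simp
  next
    fix f g assume f: "f \<in> annihilator l" and g: "g \<in> annihilator l"
    then have fc: "f \<in> carrier (free_algebra l)" "g \<in> carrier (free_algebra l)" by (simp_all add: annihilator_def)
    show "f \<otimes>\<^bsub>add_monoid (free_algebra l)\<^esub> g \<in> annihilator l"
      using f g add_carrier[OF fc] lin_ext_add[OF finite_support[OF fc(1)] finite_support[OF fc(2)], of word_act]
      by (simp add: annihilator_def monoid_algebra_add)
  qed
  fix f x assume f: "f \<in> annihilator l" and x: "x \<in> carrier (free_algebra l)"
  have fc: "f \<in> carrier (free_algebra l)" using f by (simp add: annihilator_def)
  show "x \<otimes>\<^bsub>free_algebra l\<^esub> f \<in> annihilator l" using f F.m_closed[OF x fc] linear_op_zero[OF lin]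
    by (simp add: annihilator_def ev_mult[OF x fc])
  \<comment> \<open>Each word of \<open>x\<close> sends P_D to a multiple of a noncrossing
    polynomial, which \<open>f\<close> kills.\<close>
  have "ev f (ev x (matching_fun D)) = (\<lambda>_. 0)" if D: "D \<in> nc_matchings l" for D
  proof -
    have sup: "finite {u. x u \<noteq> 0}" "{u. x u \<noteq> 0} \<subseteq> lists {1..<l}"
      using x by (simp_all add: monoid_algebra_carrier)
    have "ev f (word_act u (matching_fun D)) = (\<lambda>_. 0)" if u: "u \<in> {u. x u \<noteq> 0}" for u
    proof -
      have "u \<in> lists {1..<l}" using sup(2) u by blast
      then obtain c E where E: "E \<in> nc_matchings l" "word_act u (matching_fun D) = (\<lambda>a. cst c * matching_fun E a)"
        using word_act_nc_matching[OF _ D] by blast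
      have "ev f (\<lambda>a. cst c * matching_fun E a) = (\<lambda>a. cst c * ev f (matching_fun E) a)"
        using lin[of f] unfolding linear_op_def by blast
      then show ?thesis using f E by (simp add: annihilator_def)
    qed
    then show ?thesis unfolding lin_ext_def[of word_act x] linear_op_sum[OF lin sup(1)] by simp
  qed
  then show "f \<otimes>\<^bsub>free_algebra l\<^esub> x \<in> annihilator l"
    using F.m_closed[OF fc x] by (simp add: annihilator_def ev_mult[OF fc x])
qed

lemma tl_ideal_annihilator: "tl_ideal l \<subseteq> annihilator l"
  unfolding tl_ideal_def
proof (rule ring.genideal_minimal[OF ring_free ideal_annihilator], rule subsetI)
  fix f assume f: "f \<in> tl_relators l"
  then have fc: "f \<in> carrier (free_algebra l)" using tl_relators_carrier by blast
  have "ev f (matching_fun D) = (\<lambda>_. 0)" if D: "D \<in> nc_matchings l" for D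
  proof -
    from f consider i where "i \<in> {1..<l}" "f = word_diff [i, i] (- 2) [i]"
      | i j where "i \<in> {1..<l}" "j \<in> {1..<l}" "\<bar>int i - int j\<bar> = 1" "f = word_diff [i, j, i] 1 [i]"
      | i j where "i \<in> {1..<l}" "j \<in> {1..<l}" "\<bar>int i - int j\<bar> \<ge> 2" "f = word_diff [i, j] 1 [j, i]"
      unfolding tl_relators_eq by blast
    then show ?thesis
    proof cases
      case 1
      have "cst (- 2) = - 2" by (simp add: cst_def single_uminus)
      then show ?thesis using 1 by (simp add: ev_word_diff tl_op_square)
    next
      case (2 i j)
      then have "j = i + 1 \<or> i = j + 1" by auto
      then show ?thesis using 2 tl_op_braid[OF D, of i j] by (simp add: ev_word_diff cst_simps)
    next
      case (3 i j)
      then have "i + 1 < j \<or> j + 1 < i" by auto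
      then show ?thesis using 3 tl_op_commute[of i j "matching_fun D"] by (simp add: ev_word_diff cst_simps)
    qed
  qed
  then show "f \<in> annihilator l" using fc by (simp add: annihilator_def)
qed

text \<open>Each word of the support rewrites to the chosen word of some 321-avoiding permutation,
  up to a power of -2; the coefficients are then collected by permutation.\<close>

lemma tl_spanning:
  assumes f: "f \<in> carrier (free_algebra l)"
  shows "\<exists>c. (\<lambda>x. f x - (\<Sum>w\<in>avoiding321 l. c w * delta (red_word l w) x)) \<in> tl_ideal l"
proof -
  let ?S = "{u. f u \<noteq> 0}"
  have S: "finite ?S" "?S \<subseteq> lists {1..<l}" using f by (simp_all add: monoid_algebra_carrier)
  have "\<exists>nw. snd nw \<in> avoiding321 l \<and> tl_cong l u (fst nw) (red_word l (snd nw))" if u: "u \<in> ?S" for u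
  proof -
    have "u \<in> lists {1..<l}" using S(2) u by blast
    then obtain n w where "w \<in> avoiding321 l" "tl_cong l u n (red_word l w)" by (rule tl_cong_red_word)
    then show ?thesis by (intro exI[of _ "(n, w)"]) simp
  qed
  then have "\<exists>nw. \<forall>u\<in>?S. snd (nw u) \<in> avoiding321 l \<and> tl_cong l u (fst (nw u)) (red_word l (snd (nw u)))"
    by (intro bchoice ballI)
  then obtain nw where "\<forall>u\<in>?S. snd (nw u) \<in> avoiding321 l \<and> tl_cong l u (fst (nw u)) (red_word l (snd (nw u)))"
    by blast
  moreover define n w where "n u = fst (nw u)" and "w u = snd (nw u)" for u
  ultimately have nw: "w u \<in> avoiding321 l \<and> tl_cong l u (n u) (red_word l (w u))" if "u \<in> ?S" for u
    using that by simp
  define c where "c v = (\<Sum>u\<in>?S. if w u = v then f u * (- 2) ^ n u else 0)" for v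
  have "(\<lambda>x. \<Sum>u\<in>?S. f u * word_diff u ((- 2) ^ n u) (red_word l (w u)) x) \<in> tl_ideal l"
    using nw by (intro tl_ideal_sum[OF S(1)] tl_cong_ideal) blast
  moreover have "(\<Sum>u\<in>?S. f u * word_diff u ((- 2) ^ n u) (red_word l (w u)) x) =
      f x - (\<Sum>v\<in>avoiding321 l. c v * delta (red_word l v) x)" for x
  proof -
    have "(\<Sum>u\<in>?S. f u * delta u x) = (\<Sum>u\<in>?S. if u = x then f u else 0)"
      by (rule sum.cong) (auto simp: delta_def)
    also have "\<dots> = f x" using S(1) by simp
    finally have 1: "(\<Sum>u\<in>?S. f u * delta u x) = f x" .
    have "(\<Sum>v\<in>avoiding321 l. c v * delta (red_word l v) x) =
        (\<Sum>v\<in>avoiding321 l. \<Sum>u\<in>?S. if v = w u then f u * (- 2) ^ n u * delta (red_word l v) x else 0)"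
      unfolding c_def sum_distrib_right by (intro sum.cong refl) auto
    also have "\<dots> = (\<Sum>u\<in>?S. \<Sum>v\<in>avoiding321 l. if v = w u then f u * (- 2) ^ n u * delta (red_word l v) x else 0)"
      by (rule sum.swap)
    also have "\<dots> = (\<Sum>u\<in>?S. f u * (- 2) ^ n u * delta (red_word l (w u)) x)"
      using nw finite_avoiding321 by (intro sum.cong refl) simp
    finally show ?thesis
      using 1 by (simp add: word_diff_def right_diff_distrib sum_subtractf mult.assoc)
  qed
  ultimately show ?thesis by auto
qed

lemma ev_basis_sum:
  "ev (\<lambda>x. \<Sum>w\<in>avoiding321 l. c w * delta (red_word l w) x) (id_poly l) =
     (\<lambda>a. \<Sum>w\<in>avoiding321 l. cst (c w) * matching_fun (kauffman_diagram l w) a)"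
  by (subst lin_ext_sum[OF finite_avoiding321])
    (auto simp: support_delta lin_ext_delta kauffman_avoiding(3) intro!: sum.cong)

lemma basis_sum_carrier:
  "(\<lambda>x. \<Sum>w\<in>avoiding321 l. c w * delta (red_word l w) x) \<in> carrier (free_algebra l)"
proof (intro sum_carrier[OF finite_avoiding321] scale_carrier)
  fix w assume "w \<in> avoiding321 l"
  then have "red_word l w \<in> lists {1..<l}" by (intro red_word(3)) (simp add: avoiding321_iff)
  then show "delta (red_word l w) \<in> carrier (free_algebra l)" by simp
qed

lemma ev_cong_ideal:
  assumes "f \<in> carrier (free_algebra l)" "g \<in> carrier (free_algebra l)" "(\<lambda>x. f x - g x) \<in> tl_ideal l"
  shows "ev f (id_poly l) = ev g (id_poly l)"
proof -
  have "ev (\<lambda>x. f x - g x) (id_poly l) = (\<lambda>_. 0)"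
    using assms(3) tl_ideal_annihilator id_diagram_nc unfolding annihilator_def by blast
  then show ?thesis
    unfolding lin_ext_diff[OF finite_support[OF assms(1)] finite_support[OF assms(2)]]
    by (auto simp: fun_eq_iff)
qed

text \<open>P_id is a separating vector: modulo the ideal \<open>f\<close> is a combination of the
  t_w, and the t_w P_id are polynomials of distinct noncrossing matchings, hence
  independent.\<close>

lemma tl_ideal_iff:
  assumes f: "f \<in> carrier (free_algebra l)"
  shows "f \<in> tl_ideal l \<longleftrightarrow> ev f (id_poly l) = (\<lambda>_. 0)"
proof
  assume "f \<in> tl_ideal l"
  then show "ev f (id_poly l) = (\<lambda>_. 0)"
    using tl_ideal_annihilator id_diagram_nc unfolding annihilator_def by blast
next
  assume ev: "ev f (id_poly l) = (\<lambda>_. 0)"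
  obtain c where c: "(\<lambda>x. f x - (\<Sum>w\<in>avoiding321 l. c w * delta (red_word l w) x)) \<in> tl_ideal l"
    using tl_spanning[OF f] by blast
  have "(\<lambda>a. \<Sum>w\<in>avoiding321 l. cst (c w) * matching_fun (kauffman_diagram l w) a) = (\<lambda>_. 0)"
    using ev_cong_ideal[OF f basis_sum_carrier c] ev unfolding ev_basis_sum by simp
  then have "(\<Sum>w\<in>avoiding321 l. cst (c w) * matching_poly (kauffman_diagram l w)) = 0"
    unfolding matching_poly_eq by (rule fun_cong)
  then have "c w = 0" if "w \<in> avoiding321 l" for w using kauffman_diagram_independent that by blast
  then show "f \<in> tl_ideal l" using c by simp
qed

section \<open>Classes and coefficients in the quotient\<close>

definition tl_class :: "nat \<Rightarrow> (nat list \<Rightarrow> complex) \<Rightarrow> (nat list \<Rightarrow> complex) set" where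
  "tl_class l f = tl_ideal l +>\<^bsub>free_algebra l\<^esub> f"

lemma tl_class_hom: "tl_class l \<in> ring_hom (free_algebra l) (TL l)"
  using ideal.rcos_ring_hom[OF ideal_tl_ideal] unfolding TL_def tl_class_def .

lemma ring_TL: "ring (TL l)"
  unfolding TL_def by (rule ideal.quotient_is_ring[OF ideal_tl_ideal])

text \<open>Turns equations in \<open>TL l\<close> into equations between functions obtained from
  P_id.\<close>

lemma tl_class_eq_iff:
  assumes f: "f \<in> carrier (free_algebra l)" and g: "g \<in> carrier (free_algebra l)"
  shows "tl_class l f = tl_class l g \<longleftrightarrow> ev f (id_poly l) = ev g (id_poly l)"
proof -
  have "tl_class l f = tl_class l g \<longleftrightarrow> (\<lambda>x. f x - g x) \<in> tl_ideal l"
    using ring.quotient_eq_iff_same_a_r_cos[OF ring_free ideal_tl_ideal f g]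
    unfolding monoid_algebra_minus[OF monoid_word f g] tl_class_def by simp
  also have "\<dots> \<longleftrightarrow> ev f (id_poly l) = ev g (id_poly l)"
    unfolding tl_ideal_iff[OF diff_carrier[OF f g]]
      lin_ext_diff[OF finite_support[OF f] finite_support[OF g]]
    by (auto simp: fun_eq_iff)
  finally show ?thesis .
qed

lemma tl_basis_eq:
  assumes "w permutes {1..l}"
  shows "tl_basis l w = tl_class l (delta (red_word l w))"
proof -
  have "foldr (\<lambda>i x. tl_gen l i \<otimes>\<^bsub>TL l\<^esub> x) is \<one>\<^bsub>TL l\<^esub> = tl_class l (delta is)" if "is \<in> lists {1..<l}" for "is"
    using that
  proof (induction "is" rule: list.induct)
    case Nil
    then show ?case using ring_hom_one[OF tl_class_hom[of l]] by (simp add: monoid_algebra_one)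
  next
    case (Cons i "is")
    then have c: "delta [i] \<in> carrier (free_algebra l)" "delta is \<in> carrier (free_algebra l)" by simp_all
    show ?case
      using Cons ring_hom_mult[OF tl_class_hom[of l] c] by (simp add: delta_mult tl_gen_def tl_class_def)
  qed
  then show ?thesis unfolding tl_basis_def using red_word(3)[OF assms] by blast
qed

lemma finsum_tl_class:
  assumes "finite S" "S \<subseteq> avoiding321 l"
  shows "(\<Oplus>\<^bsub>TL l\<^esub>w\<in>S. tl_scalar l (c w) \<otimes>\<^bsub>TL l\<^esub> tl_basis l w) =
    tl_class l (\<lambda>x. \<Sum>w\<in>S. c w * delta (red_word l w) x)"
  using assms
proof (induction S rule: finite_induct)
  case empty
  interpret TL: ring "TL l" by (rule ring_TL)
  show ?case using ring_hom_zero[OF tl_class_hom ring_free ring_TL, of l]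
    by (simp add: monoid_algebra_zero)
next
  case (insert w S)
  interpret TL: ring "TL l" by (rule ring_TL)
  have d: "delta (red_word l v) \<in> carrier (free_algebra l)" if "v \<in> insert w S" for v
  proof -
    have "v permutes {1..l}" using that insert.prems avoiding321_iff by blast
    from red_word(3)[OF this] show ?thesis by simp
  qed
  have smul: "tl_scalar l (c v) \<otimes>\<^bsub>TL l\<^esub> tl_basis l v = tl_class l (\<lambda>x. c v * delta (red_word l v) x)"
    if "v \<in> insert w S" for v
  proof -
    have "v permutes {1..l}" using insert.prems that avoiding321_iff by blast
    then show ?thesis
      using ring_hom_mult[OF tl_class_hom[of l] scalar_carrier[OF monoid_word] d[OF that], of "c v"]
      by (simp add: tl_basis_eq tl_scalar_def tl_class_def scale_delta_mult[OF monoid_word d[OF that]])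
  qed
  have sc: "(\<lambda>x. c v * delta (red_word l v) x) \<in> carrier (free_algebra l)" if "v \<in> insert w S" for v
    by (rule scale_carrier[OF d[OF that]])
  have carr: "tl_scalar l (c v) \<otimes>\<^bsub>TL l\<^esub> tl_basis l v \<in> carrier (TL l)" if "v \<in> insert w S" for v
    unfolding smul[OF that] by (rule ring_hom_closed[OF tl_class_hom sc[OF that]])
  have sumc: "(\<lambda>x. \<Sum>v\<in>S. c v * delta (red_word l v) x) \<in> carrier (free_algebra l)"
    using insert.hyps(1) sc by (intro sum_carrier) auto
  have "(\<Oplus>\<^bsub>TL l\<^esub>v\<in>insert w S. tl_scalar l (c v) \<otimes>\<^bsub>TL l\<^esub> tl_basis l v) =
      tl_class l (\<lambda>x. c w * delta (red_word l w) x) \<oplus>\<^bsub>TL l\<^esub> tl_class l (\<lambda>x. \<Sum>v\<in>S. c v * delta (red_word l v) x)"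
  proof (subst TL.finsum_insert[OF insert.hyps(1,2)])
    show "(\<lambda>v. tl_scalar l (c v) \<otimes>\<^bsub>TL l\<^esub> tl_basis l v) \<in> S \<rightarrow> carrier (TL l)" using carr by blast
    show "tl_scalar l (c w) \<otimes>\<^bsub>TL l\<^esub> tl_basis l w \<in> carrier (TL l)" using carr by blast
    have "S \<subseteq> avoiding321 l" using insert.prems by blast
    from insert.IH[OF this] smul[of w]
    show "tl_scalar l (c w) \<otimes>\<^bsub>TL l\<^esub> tl_basis l w \<oplus>\<^bsub>TL l\<^esub>
        (\<Oplus>\<^bsub>TL l\<^esub>v\<in>S. tl_scalar l (c v) \<otimes>\<^bsub>TL l\<^esub> tl_basis l v) =
        tl_class l (\<lambda>x. c w * delta (red_word l w) x) \<oplus>\<^bsub>TL l\<^esub> tl_class l (\<lambda>x. \<Sum>v\<in>S. c v * delta (red_word l v) x)"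
      by simp
  qed
  also have "\<dots> = tl_class l (\<lambda>x. c w * delta (red_word l w) x + (\<Sum>v\<in>S. c v * delta (red_word l v) x))"
    using ring_hom_add[OF tl_class_hom[of l] sc[of w] sumc] by (simp add: monoid_algebra_add)
  finally show ?case using insert.hyps by simp
qed

text \<open>An expansion of the class in the t_w is the same as an expansion of
  \<open>ev f (id_poly l)\<close> in polynomials of Kauffman diagrams, and these are independent; so
  the definite description denotes \<open>c\<close>.\<close>

lemma tl_coeff_eq:
  assumes f: "f \<in> carrier (free_algebra l)" and w: "w \<in> avoiding321 l"
    and ev: "ev f (id_poly l) = (\<lambda>a. \<Sum>w\<in>avoiding321 l. cst (c w) * matching_fun (kauffman_diagram l w) a)"
  shows "tl_coeff l (tl_class l f) w = c w"
proof -
  let ?P = "\<lambda>d. d \<in> extensional (avoiding321 l) \<and>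
     tl_class l f = (\<Oplus>\<^bsub>TL l\<^esub>w\<in>avoiding321 l. tl_scalar l (d w) \<otimes>\<^bsub>TL l\<^esub> tl_basis l w)"
  have iff: "tl_class l f = (\<Oplus>\<^bsub>TL l\<^esub>w\<in>avoiding321 l. tl_scalar l (d w) \<otimes>\<^bsub>TL l\<^esub> tl_basis l w) \<longleftrightarrow>
      ev f (id_poly l) = (\<lambda>a. \<Sum>w\<in>avoiding321 l. cst (d w) * matching_fun (kauffman_diagram l w) a)" for d
    unfolding finsum_tl_class[OF finite_avoiding321 order_refl] tl_class_eq_iff[OF f basis_sum_carrier] ev_basis_sum ..
  have "tl_coeff l (tl_class l f) = restrict c (avoiding321 l)" unfolding tl_coeff_def
  proof (rule the_equality)
    show "?P (restrict c (avoiding321 l))" unfolding iff ev by auto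
    fix d assume d: "?P d"
    have "(\<Sum>w\<in>avoiding321 l. cst (d w - c w) * matching_poly (kauffman_diagram l w)) = 0"
      using fun_cong[of _ _ mvar, OF trans[OF ev[symmetric] d[THEN conjunct2, unfolded iff]]]
      by (simp add: cst_simps left_diff_distrib sum_subtractf matching_poly_eq)
    then have "d w = c w" if "w \<in> avoiding321 l" for w
      using kauffman_diagram_independent[of "\<lambda>w. d w - c w"] that by fastforce
    then show "d = restrict c (avoiding321 l)" using d by (intro ext) (auto simp: extensional_def)
  qed
  then show ?thesis using w by simp
qed

section \<open>The homomorphism theta\<close>

abbreviation ev_perm :: "((nat \<Rightarrow> nat) \<Rightarrow> complex) \<Rightarrow> polyfun \<Rightarrow> polyfun" where
  "ev_perm \<equiv> lin_ext perm_act"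

lemma monoid_sym: "monoid (sym_group l)"
  by (rule group.is_monoid[OF sym_group_is_group])

text \<open>The lift is the product of the t_i + 1 along the word. It agrees with the permutation on
  every \<open>v\<close> and not only on P_id, as multiplying lifts requires.\<close>

lemma word_lift:
  assumes "is \<in> lists {1..<l}"
  shows "\<exists>x. x \<in> carrier (free_algebra l) \<and> (\<forall>v. ev x v = perm_act (word_perm is) v)"
  using assms
proof (induction "is" rule: list.induct)
  case Nil
  show ?case by (intro exI[of _ "delta []"]) (simp add: lin_ext_delta perm_act_def comp_def)
next
  case (Cons i "is")
  then obtain x where x: "x \<in> carrier (free_algebra l)" "\<And>v. ev x v = perm_act (word_perm is) v" by auto
  let ?t = "\<lambda>y. delta [i] y + delta [] y :: complex"
  have t: "?t \<in> carrier (free_algebra l)" using Cons.prems by (intro add_carrier) auto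
  have evt: "ev ?t v = perm_act (adj_swap i) v" for v
    by (subst lin_ext_add) (auto simp: support_delta lin_ext_delta tl_op_def perm_act_def)
  have "ev (?t \<otimes>\<^bsub>free_algebra l\<^esub> x) v = perm_act (word_perm (i # is)) v" for v
    unfolding ev_mult[OF t x(1)] evt x(2) word_perm_simps perm_act_comp ..
  then show ?case using ring.ring_simprules(5)[OF ring_free t x(1)] by blast
qed

lemma perm_lift:
  assumes "w permutes {1..l}"
  shows "\<exists>x. x \<in> carrier (free_algebra l) \<and> (\<forall>v. ev x v = perm_act w v)"
  using word_lift[OF red_word(3)[OF assms]] unfolding red_word(2)[OF assms] .

lemma sym_algebra_lift:
  assumes f: "f \<in> carrier (monoid_algebra (sym_group l))"
  shows "\<exists>x. x \<in> carrier (free_algebra l) \<and> (\<forall>v. ev x v = ev_perm f v)"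
proof -
  let ?S = "{w. f w \<noteq> 0}"
  have S: "finite ?S" "\<And>w. w \<in> ?S \<Longrightarrow> w permutes {1..l}"
    using f by (auto simp: monoid_algebra_carrier sym_group_carrier)
  define x where "x w = (SOME x. x \<in> carrier (free_algebra l) \<and> (\<forall>v. ev x v = perm_act w v))" for w
  have x: "x w \<in> carrier (free_algebra l) \<and> (\<forall>v. ev (x w) v = perm_act w v)" if "w \<in> ?S" for w
    unfolding x_def by (rule someI_ex[OF perm_lift[OF S(2)[OF that]]])
  let ?y = "\<lambda>u. \<Sum>w\<in>?S. f w * x w u"
  have "?y \<in> carrier (free_algebra l)" using x by (intro sum_carrier[OF S(1)] scale_carrier) blast
  moreover have "ev ?y v = ev_perm f v" for v
  proof -
    have "ev ?y v = (\<lambda>a. \<Sum>w\<in>?S. cst (f w) * ev (x w) v a)"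
      using x by (intro lin_ext_sum[OF S(1)] finite_support) blast
    also have "\<dots> = ev_perm f v"
      unfolding lin_ext_def[of perm_act] using x by (intro ext sum.cong refl) simp
    finally show ?thesis .
  qed
  ultimately show ?thesis by blast
qed

text \<open>An arbitrary lift: its class in \<open>TL l\<close> is determined by the action on P_id
  and so does not depend on the choice.\<close>

definition theta_lift :: "nat \<Rightarrow> ((nat \<Rightarrow> nat) \<Rightarrow> complex) \<Rightarrow> nat list \<Rightarrow> complex" where
  "theta_lift l f = (SOME x. x \<in> carrier (free_algebra l) \<and> (\<forall>v. ev x v = ev_perm f v))"

lemma theta_lift:
  assumes "f \<in> carrier (monoid_algebra (sym_group l))"
  shows "theta_lift l f \<in> carrier (free_algebra l)" "ev (theta_lift l f) v = ev_perm f v"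
  using someI_ex[OF sym_algebra_lift[OF assms]] unfolding theta_lift_def by blast+

lemma ev_perm_mult:
  "f \<in> carrier (monoid_algebra (sym_group l)) \<Longrightarrow> g \<in> carrier (monoid_algebra (sym_group l)) \<Longrightarrow>
    ev_perm (f \<otimes>\<^bsub>monoid_algebra (sym_group l)\<^esub> g) v = ev_perm f (ev_perm g v)"
  by (rule lin_ext_mult[OF monoid_sym]) (auto simp: linear_perm_act sym_group_mult perm_act_comp)

text \<open>Adjacent swaps generate S_l, so agreement on them gives agreement on all permutations;
  scalars and additivity extend it to the group algebra.\<close>

lemma theta_unique:
  assumes h: "h \<in> ring_hom (monoid_algebra (sym_group l)) (TL l)"
    and k: "k \<in> ring_hom (monoid_algebra (sym_group l)) (TL l)"
    and scal: "\<And>c. h (scalar (sym_group l) c) = k (scalar (sym_group l) c)"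
    and gen: "\<And>i. i \<in> {1..<l} \<Longrightarrow> h (delta (adj_swap i)) = k (delta (adj_swap i))"
    and f: "f \<in> carrier (monoid_algebra (sym_group l))"
  shows "h f = k f"
proof -
  let ?C = "monoid_algebra (sym_group l)"
  have word: "h (delta (word_perm is)) = k (delta (word_perm is))" if "is \<in> lists {1..<l}" for "is"
    using that
  proof (induction "is" rule: list.induct)
    case Nil
    show ?case using ring_hom_one[OF h] ring_hom_one[OF k]
      by (simp only: word_perm_simps monoid_algebra_one sym_group_one)
  next
    case (Cons i "is")
    then have i: "i \<in> {1..<l}" and "is": "is \<in> lists {1..<l}" by auto
    have "adj_swap i permutes {1..l}" using i by (intro permutes_swap_id) auto
    then have c: "delta (adj_swap i) \<in> carrier ?C" "delta (word_perm is) \<in> carrier ?C"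
      using word_perm_permutes[OF "is"] by (simp_all add: sym_group_carrier)
    have eq: "delta (word_perm (i # is)) = delta (adj_swap i) \<otimes>\<^bsub>?C\<^esub> delta (word_perm is)"
      unfolding delta_mult sym_group_mult word_perm_simps ..
    show ?case
      unfolding eq ring_hom_mult[OF h c] ring_hom_mult[OF k c] gen[OF i] using Cons.IH "is" by simp
  qed
  have perm: "h (delta w) = k (delta w)" if "w permutes {1..l}" for w
    using word[OF red_word(3)[OF that]] unfolding red_word(2)[OF that] .
  let ?S = "{w. f w \<noteq> 0}"
  have S: "finite ?S" "?S \<subseteq> {w. w permutes {1..l}}"
    using f by (auto simp: monoid_algebra_carrier sym_group_carrier)
  have "h (\<lambda>x. \<Sum>w\<in>R. f w * delta w x) = k (\<lambda>x. \<Sum>w\<in>R. f w * delta w x)"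
    if "finite R" "R \<subseteq> {w. w permutes {1..l}}" for R
    using that
  proof (induction R rule: finite_induct)
    case empty
    have "(\<lambda>x. 0) = scalar (sym_group l) 0" by (auto simp: scalar_def)
    then show ?case using scal[of 0] by simp
  next
    case (insert w R)
    have d: "delta v \<in> carrier ?C" if "v \<in> insert w R" for v
      using insert.prems that by (auto simp: sym_group_carrier)
    have c1: "scalar (sym_group l) (f w) \<in> carrier ?C" by (rule scalar_carrier[OF monoid_sym])
    have m: "scalar (sym_group l) (f w) \<otimes>\<^bsub>?C\<^esub> delta w = (\<lambda>x. f w * delta w x)"
      by (rule scale_delta_mult[OF monoid_sym]) (use d in blast)
    have c2: "(\<lambda>x. f w * delta w x) \<in> carrier ?C" by (rule scale_carrier) (use d in blast)
    have c3: "(\<lambda>x. \<Sum>v\<in>R. f v * delta v x) \<in> carrier ?C"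
      using d insert.hyps by (intro sum_carrier scale_carrier) blast+
    have "h (\<lambda>x. f w * delta w x) = k (\<lambda>x. f w * delta w x)"
      unfolding m[symmetric] using d[of w] c1 ring_hom_mult[OF h c1] ring_hom_mult[OF k c1] scal perm insert.prems
      by simp
    then have "h ((\<lambda>x. f w * delta w x) \<oplus>\<^bsub>?C\<^esub> (\<lambda>x. \<Sum>v\<in>R. f v * delta v x)) =
        k ((\<lambda>x. f w * delta w x) \<oplus>\<^bsub>?C\<^esub> (\<lambda>x. \<Sum>v\<in>R. f v * delta v x))"
      using ring_hom_add[OF h c2 c3] ring_hom_add[OF k c2 c3] insert by simp
    then show ?case using insert.hyps by (simp add: monoid_algebra_add)
  qed
  note sum_eq = this[OF S]
  have "(\<lambda>x. \<Sum>w\<in>?S. f w * delta w x) = f"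
  proof
    fix x
    have "(\<Sum>w\<in>?S. f w * delta w x) = (\<Sum>w\<in>?S. if w = x then f w else 0)"
      by (rule sum.cong) (auto simp: delta_def)
    also have "\<dots> = f x" using S(1) by simp
    finally show "(\<Sum>w\<in>?S. f w * delta w x) = f x" .
  qed
  then show ?thesis using sum_eq by simp
qed

lemma tl_theta_eq:
  assumes f: "f \<in> carrier (monoid_algebra (sym_group l))"
  shows "tl_theta l f = tl_class l (theta_lift l f)"
proof -
  let ?C = "monoid_algebra (sym_group l)"
  define H where "H = restrict (\<lambda>f. tl_class l (theta_lift l f)) (carrier ?C)"
  let ?P = "\<lambda>h. h \<in> ring_hom ?C (TL l) \<and> h \<in> extensional (carrier ?C) \<and>
     (\<forall>c. h (scalar (sym_group l) c) = tl_scalar l c) \<and>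
     (\<forall>i\<in>{1..<l}. h (delta (adj_swap i)) = tl_gen l i \<oplus>\<^bsub>TL l\<^esub> \<one>\<^bsub>TL l\<^esub>)"
  interpret C: ring ?C by (rule ring_monoid_algebra[OF monoid_sym])
  interpret F: ring "free_algebra l" by (rule ring_free)
  have H: "H g = tl_class l (theta_lift l g)" if "g \<in> carrier ?C" for g using that by (simp add: H_def)
  \<comment> \<open>Any element that acts on P_id as \<open>g\<close> does represents
    \<open>H g\<close>, so each clause below can use its own convenient lift.\<close>
  have HI: "H g = tl_class l x" if "g \<in> carrier ?C" "x \<in> carrier (free_algebra l)"
      "ev x (id_poly l) = ev_perm g (id_poly l)" for g x
    unfolding H[OF that(1)] tl_class_eq_iff[OF theta_lift(1)[OF that(1)] that(2)] theta_lift(2)[OF that(1)] that(3) ..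
  have "?P H"
  proof (intro conjI allI ballI)
    show "H \<in> ring_hom ?C (TL l)"
    proof (rule ring_hom_memI)
      fix g assume g: "g \<in> carrier ?C"
      show "H g \<in> carrier (TL l)"
        unfolding H[OF g] by (rule ring_hom_closed[OF tl_class_hom theta_lift(1)[OF g]])
      fix h assume h: "h \<in> carrier ?C"
      note lg = theta_lift(1)[OF g] and lh = theta_lift(1)[OF h]
      show "H (g \<otimes>\<^bsub>?C\<^esub> h) = H g \<otimes>\<^bsub>TL l\<^esub> H h"
        unfolding H[OF g] H[OF h] ring_hom_mult[OF tl_class_hom lg lh, symmetric]
        by (rule HI) (simp_all add: g h lg lh ev_mult[OF lg lh] ev_perm_mult[OF g h] theta_lift)
      have "ev (theta_lift l g \<oplus>\<^bsub>free_algebra l\<^esub> theta_lift l h) v = ev_perm (g \<oplus>\<^bsub>?C\<^esub> h) v" for v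
        unfolding monoid_algebra_add lin_ext_add[OF finite_support[OF lg] finite_support[OF lh]]
          lin_ext_add[OF finite_support[OF g] finite_support[OF h]] theta_lift(2)[OF g] theta_lift(2)[OF h] ..
      then show "H (g \<oplus>\<^bsub>?C\<^esub> h) = H g \<oplus>\<^bsub>TL l\<^esub> H h"
        unfolding H[OF g] H[OF h] ring_hom_add[OF tl_class_hom lg lh, symmetric]
        by (intro HI) (simp_all add: g h lg lh)
    next
      show "H \<one>\<^bsub>?C\<^esub> = \<one>\<^bsub>TL l\<^esub>" unfolding ring_hom_one[OF tl_class_hom, symmetric]
        by (rule HI) (simp_all add: monoid_algebra_one lin_ext_delta sym_group_one sym_group_carrier permutes_id perm_act_def comp_def)
    qed
    show "H \<in> extensional (carrier ?C)" by (simp add: H_def)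
  next
    fix c
    show "H (scalar (sym_group l) c) = tl_scalar l c"
      unfolding tl_scalar_def tl_class_def[symmetric]
    proof (rule HI)
      have d: "finite {y. delta x y \<noteq> 0}" for x :: 'z by (simp add: support_delta)
      show "ev (scalar (word_monoid l) c) (id_poly l) = ev_perm (scalar (sym_group l) c) (id_poly l)"
        unfolding scalar_eq lin_ext_scale[OF d] lin_ext_delta by (simp add: sym_group_one perm_act_def comp_def)
    qed (rule scalar_carrier[OF monoid_sym] scalar_carrier[OF monoid_word])+
  next
    fix i assume i: "i \<in> {1..<l}"
    have d: "delta [i] \<in> carrier (free_algebra l)" using i by simp
    have perm: "adj_swap i permutes {1..l}" using i by (intro permutes_swap_id) auto
    have "H (delta (adj_swap i)) = tl_class l (delta [i] \<oplus>\<^bsub>free_algebra l\<^esub> \<one>\<^bsub>free_algebra l\<^esub>)"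
    proof (rule HI)
      show "delta (adj_swap i) \<in> carrier ?C" using perm by (simp add: sym_group_carrier)
      show "delta [i] \<oplus>\<^bsub>free_algebra l\<^esub> \<one>\<^bsub>free_algebra l\<^esub> \<in> carrier (free_algebra l)" using d by simp
      show "ev (delta [i] \<oplus>\<^bsub>free_algebra l\<^esub> \<one>\<^bsub>free_algebra l\<^esub>) (id_poly l) =
          ev_perm (delta (adj_swap i)) (id_poly l)"
        unfolding monoid_algebra_add monoid_algebra_one
        by (subst lin_ext_add) (simp_all add: support_delta lin_ext_delta tl_op_def perm_act_def)
    qed
    then show "H (delta (adj_swap i)) = tl_gen l i \<oplus>\<^bsub>TL l\<^esub> \<one>\<^bsub>TL l\<^esub>"
      unfolding ring_hom_add[OF tl_class_hom d F.one_closed] ring_hom_one[OF tl_class_hom]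
      by (simp only: tl_gen_def tl_class_def)
  qed
  moreover have "h = H" if h: "?P h" for h
  proof
    fix g
    show "h g = H g"
    proof (cases "g \<in> carrier ?C")
      case True
      show ?thesis by (rule theta_unique[OF _ _ _ _ True]) (use h \<open>?P H\<close> in auto)
    next
      case False
      then show ?thesis using h \<open>?P H\<close> by (simp add: extensional_def)
    qed
  qed
  ultimately have "tl_theta l = H" unfolding tl_theta_def by (rule the_equality)
  then show ?thesis using H[OF f] by simp
qed

section \<open>Surjectivity and comparison of the expansions\<close>

lemma perm_span_ev:
  assumes "g \<in> perm_span l"
  shows "\<exists>x. x \<in> carrier (free_algebra l) \<and> ev x (id_poly l) = g"
  using assms
proof (induction rule: perm_span.induct)
  case (perm_span_base w)
  then show ?case using perm_lift by blast
next
  case (perm_span_diff g h)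
  then obtain x y where xy: "x \<in> carrier (free_algebra l)" "ev x (id_poly l) = g"
    "y \<in> carrier (free_algebra l)" "ev y (id_poly l) = h" by blast
  have "ev (\<lambda>u. x u - y u) (id_poly l) = (\<lambda>a. g a - h a)"
    unfolding lin_ext_diff[OF finite_support[OF xy(1)] finite_support[OF xy(3)]] xy(2,4) ..
  then show ?case using diff_carrier[OF xy(1,3)] by blast
qed

lemma ev_expansion:
  assumes f: "f \<in> carrier (free_algebra l)"
  shows "\<exists>c. ev f (id_poly l) = (\<lambda>a. \<Sum>w\<in>avoiding321 l. cst (c w) * matching_fun (kauffman_diagram l w) a)"
proof -
  obtain c where "(\<lambda>x. f x - (\<Sum>w\<in>avoiding321 l. c w * delta (red_word l w) x)) \<in> tl_ideal l"
    using tl_spanning[OF f] by blast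
  from ev_cong_ideal[OF f basis_sum_carrier this] show ?thesis unfolding ev_basis_sum by blast
qed

text \<open>P_D lies in the span of the w P_id, so it is x P_id for some \<open>x\<close> and hence
  a combination of polynomials of Kauffman diagrams. Independence of the noncrossing polynomials
  forces \<open>D\<close> to be among them.\<close>

lemma kauffman_diagram_surj:
  assumes D: "D \<in> nc_matchings l"
  shows "D \<in> kauffman_diagram l ` avoiding321 l"
proof (rule ccontr)
  assume nD: "D \<notin> kauffman_diagram l ` avoiding321 l"
  have "perfect_matching {1..2 * l} D" using D by (simp add: nc_matchings_def)
  from perm_span_ev[OF matching_fun_perm_span[OF this]]
  obtain x where x: "x \<in> carrier (free_algebra l)" "ev x (id_poly l) = matching_fun D" by blast
  obtain c where "matching_fun D = (\<lambda>a. \<Sum>w\<in>avoiding321 l. cst (c w) * matching_fun (kauffman_diagram l w) a)"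
    using ev_expansion[OF x(1)] x(2) by auto
  then have sum: "matching_poly D = (\<Sum>w\<in>avoiding321 l. cst (c w) * matching_poly (kauffman_diagram l w))"
    unfolding matching_poly_eq by (rule fun_cong)
  let ?c = "\<lambda>E. if E \<in> kauffman_diagram l ` avoiding321 l
    then c (inv_into (avoiding321 l) (kauffman_diagram l) E) else 0"
  \<comment> \<open>The expansion minus the trivial expansion of P_D by itself; its coefficient at
    \<open>D\<close> would be -1.\<close>
  let ?d = "\<lambda>E. ?c E - (if E = D then 1 else 0)"
  have "(\<Sum>E\<in>nc_matchings l. cst (if E = D then 1 else 0) * matching_poly E) =
      (\<Sum>E\<in>nc_matchings l. if E = D then matching_poly E else 0)"
    by (rule sum.cong) (simp_all add: cst_simps)
  also have "\<dots> = matching_poly D" using D finite_nc_matchings by simp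
  finally have "(\<Sum>E\<in>nc_matchings l. cst (?d E) * matching_poly E) = 0"
    using sum[unfolded kauffman_diagram_sum]
    by (simp only: cst_simps(6) left_diff_distrib sum_subtractf) simp
  from nc_matchings_independent[OF this D] show False using nD by simp
qed

theorem theorem16:
  fixes l :: nat and T T0 :: "nat set set"
  assumes "l \<ge> 1"
    and "perfect_matching {1..2 * l} T"
    and "\<forall>e\<in>T. \<exists>a\<in>{1..l}. \<exists>b\<in>{l + 1..2 * l}. e = {a, b}"
    and "perfect_matching {1..2 * l} T0"
    and "noncrossing T0"
  shows "nc_coeff l T T0 =
    tl_coeff l (tl_theta l (delta (matching_perm l T))) (matching_avoiding l T0)"
proof -
  note pm = assms(2)
  have bip: "mate T q \<in> {1..l}" if q: "q \<in> {l + 1..2 * l}" for q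
  proof -
    have "q \<in> {1..2 * l}" using q by auto
    then have e: "{q, mate T q} \<in> T" by (rule mate(1)[OF pm])
    then obtain a b where ab: "a \<in> {1..l}" "b \<in> {l + 1..2 * l}" "{q, mate T q} = {a, b}"
      using assms(3) by blast
    have "q \<noteq> a" using ab(1) q by auto
    then have "mate T q = a" using ab(3) by (auto simp: doubleton_eq_iff)
    then show ?thesis using ab(1) by simp
  qed
  let ?w = "matching_perm l T"
  note w = matching_perm[OF pm bip]
  have dw: "delta ?w \<in> carrier (monoid_algebra (sym_group l))"
    using w(1) by (simp add: sym_group_carrier)
  define x where "x = theta_lift l (delta ?w)"
  have x: "x \<in> carrier (free_algebra l)" using theta_lift(1)[OF dw] by (simp add: x_def)
  have "ev x (id_poly l) = perm_act ?w (id_poly l)"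
    using theta_lift(2)[OF dw] by (simp add: x_def lin_ext_delta)
  also have "\<dots> = matching_fun (perm_matching l ?w)" by (rule matching_fun_perm_act[OF w(1), symmetric])
  also have "\<dots> = matching_fun T" using w(2) by simp
  finally have evx: "ev x (id_poly l) = matching_fun T" .
  \<comment> \<open>Both sides of the theorem read off this one expansion: as that of theta applied
    to the permutation of \<open>T\<close>, and, at the assignment \<open>mvar\<close>, as that of
    P_T.\<close>
  obtain c where c: "ev x (id_poly l) = (\<lambda>a. \<Sum>v\<in>avoiding321 l. cst (c v) * matching_fun (kauffman_diagram l v) a)"
    using ev_expansion[OF x] by blast
  have T0: "T0 \<in> nc_matchings l" using assms(4,5) by (simp add: nc_matchings_def)
  obtain v where v: "v \<in> avoiding321 l" "T0 = kauffman_diagram l v"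
    using kauffman_diagram_surj[OF T0] by blast
  have "matching_avoiding l T0 = v" unfolding matching_avoiding_def
  proof (rule the_equality)
    show "v \<in> avoiding321 l \<and> kauffman l v = (1, T0)" using v kauffman_avoiding(1)[OF v(1)] by simp
    fix u assume u: "u \<in> avoiding321 l \<and> kauffman l u = (1, T0)"
    then have "kauffman_diagram l u = kauffman_diagram l v" using v(2) by (simp add: kauffman_diagram_def)
    then show "u = v" using inj_onD[OF kauffman_diagram_inj] u v(1) by blast
  qed
  moreover have "tl_coeff l (tl_theta l (delta ?w)) v = c v"
    unfolding tl_theta_eq[OF dw] x_def[symmetric] by (rule tl_coeff_eq[OF x v(1) c])
  moreover have "matching_poly T = (\<Sum>v\<in>avoiding321 l. cst (c v) * matching_poly (kauffman_diagram l v))"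
    unfolding matching_poly_eq by (rule fun_cong[OF evx[symmetric, unfolded c]])
  then have "nc_coeff l T T0 = c v"
    using nc_coeff_eq[OF _ T0] inv_into_f_f[OF kauffman_diagram_inj v(1)] v
    unfolding kauffman_diagram_sum by fastforce
  ultimately show ?thesis by simp
qed

end
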